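(* Let $\mathcal H$ be a complex Hilbert space of arbitrary dimension and let $P$ be a positive operator on $\mathcal H$. Then the following statements are equivalent. (1) $P\in\mathcal{AN}_{[k]}(\mathcal H)$ for every $k\in\mathbb N$. (2) $P\in\mathcal{AN}_{[k]}(\mathcal H)$ for some $k\in\mathbb N$. (3) $P=\alpha I+K+F$, where $\alpha\ge0$, $K$ is a positive compact operator and $F$ is a self-adjoint finite-rank operator.
   Context: For a positive $A\in\mathcal B(\mathcal H)$ define $\lambda_j(A)$ as follows. The essential spectrum $\sigma_e(A)$ is the set of points of $\sigma(A)$ that are accumulation points of $\sigma(A)$ or eigenvalues of infinite multiplicity. Let $\mu=\sup\sigma(A)$. If $\mu\in\sigma_e(A)$, put $\lambda_j(A)=\mu$ for $j=1,\dots,\operatorname{rank}(A)$. Otherwise $\mu$ is an eigenvalue of finite multiplicity $m$; put $\lambda_j(A)=\mu$ for $1\le j\le m$ and $\lambda_{m+j}(A)=\lambda_j(A_1)$ for $1\le j\le\operatorname{rank}(A_1)$, where $A_1=A-\mu P_{E_\mu}$ and $P_{E_\mu}$ is the orthogonal projection onto the eigenspace of $\mu$. If $\operatorname{rank}(A)<\infty$, put $\lambda_j(A)=0$ for $j>\operatorname{rank}(A)$. For $T\in\mathcal B(\mathcal H,\mathcal K)$, with $|T|=\sqrt{T^*T}$, the s-numbers are $s_j(T)=\lambda_j(|T|)$. The Ky Fan $k$-norm is $\|T\|_{[k]}=\sum_{j=1}^ks_j(T)$. $T\in\mathcal B(\mathcal H,\mathcal K)$ is $[k]$-norming, written $T\in\mathcal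 N_{[k]}(\mathcal H,\mathcal K)$, if there are orthonormal $x_1,\dots,x_k\in\mathcal H$ with $\|T\|_{[k]}=\sum_{j=1}^k\|Tx_j\|$; if $\dim\mathcal H=r<k$, the requirement is instead that there are orthonormal $x_1,\dots,x_r\in\mathcal H$ with $\|T\|_{[k]}=\sum_{j=1}^r\|Tx_j\|$. $T$ is absolutely $[k]$-norming, written $T\in\mathcal{AN}_{[k]}(\mathcal H,\mathcal K)$, if for every nontrivial (nonzero; $\mathcal M=\mathcal H$ allowed) closed subspace $\mathcal M\subseteq\mathcal H$ the restriction $T|_{\mathcal M}:\mathcal M\to\mathcal K$ is $[k]$-norming. $\mathcal{AN}_{[k]}(\mathcal H)=\mathcal{AN}_{[k]}(\mathcal H,\mathcal H)$. *)

theory Defs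
  imports "HOL-Analysis.Analysis" "HOL-Library.Extended_Nat" "HOL-Library.FuncSet"
begin

text \<open>The inner product is linear in its first argument. The norm, the metric, the topology and the
real vector space structure are those of \<^class>\<open>real_normed_vector\<close>, tied to the complex structure
by the axioms \<open>scaleC_of_real\<close> and \<open>cinner_self\<close>.\<close>

class complex_inner = real_normed_vector +
  fixes scaleC :: "complex \<Rightarrow> 'a \<Rightarrow> 'a" (infixr "*\<^sub>C" 75)
    and cinner :: "'a \<Rightarrow> 'a \<Rightarrow> complex"
  assumes scaleC_add_right: "a *\<^sub>C (x + y) = a *\<^sub>C x + a *\<^sub>C y"
    and scaleC_add_left: "(a + b) *\<^sub>C x = a *\<^sub>C x + b *\<^sub>C x"
    and scaleC_scaleC: "a *\<^sub>C b *\<^sub>C x = (a * b) *\<^sub>C x"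
    and scaleC_of_real: "complex_of_real r *\<^sub>C x = r *\<^sub>R x"
    and cinner_commute: "cinner x y = cnj (cinner y x)"
    and cinner_add_left: "cinner (x + y) z = cinner x z + cinner y z"
    and cinner_scaleC_left: "cinner (a *\<^sub>C x) y = a * cinner x y"
    and cinner_self: "cinner x x = complex_of_real ((norm x)\<^sup>2)"

class chilbert_space = complex_inner + complete_space

global_interpretation complex_vector:
  vector_space "scaleC :: complex \<Rightarrow> 'a \<Rightarrow> 'a::complex_inner"
proof
  show "1 *\<^sub>C x = x" for x :: 'a
    using scaleC_of_real[of 1 x] by simp
qed (simp_all add: scaleC_add_right scaleC_add_left scaleC_scaleC)

definition cdim :: "'a::complex_inner set \<Rightarrow> enat" where
  "cdim V = (if \<exists>B. finite B \<and> V \<subseteq> complex_vector.span B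
             then enat (complex_vector.dim V) else \<infinity>)"

text \<open>The s-numbers of a restriction \<open>T|\<^sub>M\<close> are computed from operators on the Hilbert space \<open>M\<close>
(its adjoint, its modulus, the spectrum in \<open>B(M)\<close>). Therefore all notions below take the carrier
\<open>M\<close>, a closed subspace of the ambient space, as an argument; an operator on \<open>M\<close> is a function on the
ambient type of which only the values on \<open>M\<close> matter, so that \<open>T|\<^sub>M\<close> is \<open>T\<close> considered on the
carrier \<open>M\<close>. The whole space is the carrier \<open>UNIV\<close>.\<close>

definition closed_csubspace :: "'a::complex_inner set \<Rightarrow> bool" where
  "closed_csubspace M \<longleftrightarrow> complex_vector.subspace M \<and> closed M"

definition bounded_op ::
    "'a::complex_inner set \<Rightarrow> 'b::complex_inner set \<Rightarrow> ('a \<Rightarrow> 'b) \<Rightarrow> bool" where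
  "bounded_op M N T \<longleftrightarrow>
     T \<in> M \<rightarrow> N \<and>
     (\<forall>x\<in>M. \<forall>y\<in>M. T (x + y) = T x + T y) \<and>
     (\<forall>c. \<forall>x\<in>M. T (c *\<^sub>C x) = c *\<^sub>C T x) \<and>
     (\<exists>C. \<forall>x\<in>M. norm (T x) \<le> C * norm x)"

definition adjoint_op ::
    "'a::complex_inner set \<Rightarrow> ('a \<Rightarrow> 'b::complex_inner) \<Rightarrow> 'b \<Rightarrow> 'a" where
  "adjoint_op M T y = (THE x. x \<in> M \<and> (\<forall>z\<in>M. cinner (T z) y = cinner z x))"

definition positive_op :: "'a::complex_inner set \<Rightarrow> ('a \<Rightarrow> 'a) \<Rightarrow> bool" where
  "positive_op M A \<longleftrightarrow> bounded_op M M A \<and> (\<forall>x\<in>M. cinner (A x) x \<in> \<real>\<^sub>\<ge>\<^sub>0)"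

text \<open>Membership in \<^term>\<open>extensional M\<close> only fixes the irrelevant values outside \<open>M\<close>, which makes
the root unique as a function.\<close>

definition sqrt_op :: "'a::complex_inner set \<Rightarrow> ('a \<Rightarrow> 'a) \<Rightarrow> 'a \<Rightarrow> 'a" where
  "sqrt_op M A = (THE S. S \<in> extensional M \<and> positive_op M S \<and> (\<forall>x\<in>M. S (S x) = A x))"

definition abs_op :: "'a::complex_inner set \<Rightarrow> ('a \<Rightarrow> 'b::complex_inner) \<Rightarrow> 'a \<Rightarrow> 'a" where
  "abs_op M T = sqrt_op M (\<lambda>x. adjoint_op M T (T x))"

definition spectrum_op :: "'a::complex_inner set \<Rightarrow> ('a \<Rightarrow> 'a) \<Rightarrow> complex set" where
  "spectrum_op M A =
     {z. \<not> (\<exists>B. bounded_op M M B \<and>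
                (\<forall>x\<in>M. B (A x - z *\<^sub>C x) = x \<and> A (B x) - z *\<^sub>C B x = x))}"

definition eigenspace_op :: "'a::complex_inner set \<Rightarrow> ('a \<Rightarrow> 'a) \<Rightarrow> complex \<Rightarrow> 'a set" where
  "eigenspace_op M A z = {x \<in> M. A x = z *\<^sub>C x}"

definition ess_spectrum_op :: "'a::complex_inner set \<Rightarrow> ('a \<Rightarrow> 'a) \<Rightarrow> complex set" where
  "ess_spectrum_op M A =
     {z \<in> spectrum_op M A. z islimpt spectrum_op M A \<or> cdim (eigenspace_op M A z) = \<infinity>}"

text \<open>For positive \<open>A\<close> the spectrum is real, so this is its supremum.\<close>

definition sup_spectrum_op :: "'a::complex_inner set \<Rightarrow> ('a \<Rightarrow> 'a) \<Rightarrow> real" where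
  "sup_spectrum_op M A = Sup {r. complex_of_real r \<in> spectrum_op M A}"

definition rank_op :: "'a::complex_inner set \<Rightarrow> ('a \<Rightarrow> 'b::complex_inner) \<Rightarrow> enat" where
  "rank_op M A = cdim (A ` M)"

definition orth_proj :: "'a::complex_inner set \<Rightarrow> 'a \<Rightarrow> 'a" where
  "orth_proj E x = (THE y. y \<in> E \<and> (\<forall>z\<in>E. cinner (x - y) z = 0))"

text \<open>The sequence \<open>\<lambda>\<^sub>j(A)\<close>, \<open>j \<ge> 1\<close>, of a positive operator \<open>A\<close> on \<open>M\<close>. Outside the essential
spectrum, \<open>\<mu> = sup \<sigma>(A)\<close> is an isolated point of the spectrum and hence an eigenvalue, so its
multiplicity \<open>m\<close> is positive; the test \<open>m = 0\<close> (like the value for \<open>j = 0\<close>) serves only to make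
the function total.\<close>

function lambda_op :: "'a::complex_inner set \<Rightarrow> ('a \<Rightarrow> 'a) \<Rightarrow> nat \<Rightarrow> real" where
  "lambda_op M A j =
     (if j = 0 \<or> rank_op M A < enat j then 0
      else let \<mu> = sup_spectrum_op M A;
               E = eigenspace_op M A (complex_of_real \<mu>);
               m = the_enat (cdim E)
           in if complex_of_real \<mu> \<in> ess_spectrum_op M A then \<mu>
              else if j \<le> m \<or> m = 0 then \<mu>
              else lambda_op M (\<lambda>x. A x - \<mu> *\<^sub>R orth_proj E x) (j - m))"
  by pat_completeness auto
termination
  by (relation "Wellfounded.measure (\<lambda>(M, A, j). j)") auto

declare lambda_op.simps [simp del]

definition s_number ::
    "'a::complex_inner set \<Rightarrow> ('a \<Rightarrow> 'b::complex_inner) \<Rightarrow> nat \<Rightarrow> real" where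
  "s_number M T j = lambda_op M (abs_op M T) j"

definition ky_fan_norm ::
    "'a::complex_inner set \<Rightarrow> nat \<Rightarrow> ('a \<Rightarrow> 'b::complex_inner) \<Rightarrow> real" where
  "ky_fan_norm M k T = (\<Sum>j=1..k. s_number M T j)"

definition k_norming ::
    "'a::complex_inner set \<Rightarrow> nat \<Rightarrow> ('a \<Rightarrow> 'b::complex_inner) \<Rightarrow> bool" where
  "k_norming M k T \<longleftrightarrow>
     bounded_op M UNIV T \<and>
     (let n = (if cdim M < enat k then the_enat (cdim M) else k)
      in \<exists>x :: nat \<Rightarrow> 'a.
           (\<forall>i\<in>{1..n}. x i \<in> M) \<and>
           (\<forall>i\<in>{1..n}. \<forall>j\<in>{1..n}. cinner (x i) (x j) = (if i = j then 1 else 0)) \<and>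
           ky_fan_norm M k T = (\<Sum>j=1..n. norm (T (x j))))"

definition abs_k_norming :: "nat \<Rightarrow> ('a::complex_inner \<Rightarrow> 'b::complex_inner) \<Rightarrow> bool" where
  "abs_k_norming k T \<longleftrightarrow>
     bounded_op UNIV UNIV T \<and>
     (\<forall>M. closed_csubspace M \<and> M \<noteq> {0} \<longrightarrow> k_norming M k T)"

definition compact_op :: "('a::complex_inner \<Rightarrow> 'b::complex_inner) \<Rightarrow> bool" where
  "compact_op T \<longleftrightarrow> bounded_op UNIV UNIV T \<and> compact (closure (T ` cball 0 1))"

definition self_adjoint_op :: "('a::complex_inner \<Rightarrow> 'a) \<Rightarrow> bool" where
  "self_adjoint_op T \<longleftrightarrow> bounded_op UNIV UNIV T \<and> adjoint_op UNIV T = T"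

definition finite_rank_op :: "('a::complex_inner \<Rightarrow> 'b::complex_inner) \<Rightarrow> bool" where
  "finite_rank_op T \<longleftrightarrow> bounded_op UNIV UNIV T \<and> rank_op UNIV T < \<infinity>"

end

theory Submission
  imports Defs
begin

text \<open>An operator \<open>P \<ge> 0\<close> is absolutely \<open>[k]\<close>-norming for some \<open>k\<close> iff its restriction to every closed
subspace \<open>M\<close> attains the operator norm \<open>\<mu>\<close>. If it does not, then \<open>\<mu>\<close> is not an eigenvalue of \<open>|P|\<^sub>M|\<close>,
hence not isolated in the spectrum, so the first \<open>k\<close> s-numbers all equal \<open>\<mu>\<close>, while each \<open>\<parallel>P x\<^sub>j\<parallel>\<close> is
smaller than \<open>\<mu>\<close>. Conversely, attainment on the complements of the eigenspaces that were already split off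
yields eigenvectors for all s-numbers.

If norms are always attained, then successive maximizers form an orthonormal sequence of eigenvectors with
eigenvalues decreasing to some \<open>\<alpha>\<close>, which gives the compact part. On the orthogonal complement
\<open>\<alpha> - P \<ge> 0\<close> has finite rank, since eigenvectors for infinitely many eigenvalues below \<open>\<alpha>\<close> could be mixed
with the former ones so that the norm is approached by strictly increasing values. Conversely, for
\<open>P = \<alpha> + K + F\<close> a maximizing sequence for \<open>P|\<^sub>M\<close> has a convergent subsequence by compactness if
\<open>\<mu> \<noteq> \<alpha>\<close>, and any unit vector of \<open>M\<close> killed by \<open>F\<close> is maximizing if \<open>\<mu> = \<alpha>\<close>.\<close>

section \<open>Geometry of complex inner product spaces\<close>

text \<open>Attainment on every closed subspace does not mention \<open>k\<close>, which is why some
  \<open>k\<close> gives all \<open>k\<close>. The obstacle is that s-numbers of a restriction live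
  on \<open>M\<close>, which \<open>P\<close> need not leave invariant: the modulus is the root of
  the compression of P^2 to \<open>M\<close>, not the compression of \<open>P\<close>. What is used
  of it is that it is positive on \<open>M\<close>, that its square is this compression, and that it
  has the same norms as \<open>P\<close> on \<open>M\<close>. So attainment passes freely between
  \<open>P\<close> and the modulus, and for the modulus a maximizer is an eigenvector. In the
  decomposition, P - \<alpha> is split along \<open>N\<close>, the orthogonal complement of the
  maximizers. On their closed span it is diagonal with nonnegative entries tending to 0, hence
  compact. One sequence suffices in any dimension: on \<open>N\<close> the norm of \<open>P\<close>
  is at most \<alpha>, and the eigenspace of \<alpha> inside \<open>N\<close>, however large, is
  annihilated by P - \<alpha>. Only its complement in \<open>N\<close> has to be
  finite-dimensional.\<close>

abbreviation "csubspace \<equiv> complex_vector.subspace"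
abbreviation "cspan \<equiv> complex_vector.span"

lemma cinner_add_right: "cinner x (y + z) = cinner x y + cinner x (z::'a::complex_inner)"
  by (metis cinner_add_left cinner_commute complex_cnj_add)

lemma cinner_scaleC_right: "cinner x (a *\<^sub>C y) = cnj a * cinner x (y::'a::complex_inner)"
  by (metis cinner_commute cinner_scaleC_left complex_cnj_mult)

lemma cinner_scaleR_left: "cinner (r *\<^sub>R x) y = of_real r * cinner x (y::'a::complex_inner)"
  by (metis cinner_scaleC_left scaleC_of_real)

lemma cinner_scaleR_right: "cinner x (r *\<^sub>R y) = of_real r * cinner x (y::'a::complex_inner)"
  by (metis cinner_scaleC_right complex_cnj_complex_of_real scaleC_of_real)

lemma Re_cinner_self: "Re (cinner x x) = (norm (x::'a::complex_inner))\<^sup>2"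
  by (simp add: cinner_self)

lemma Re_cinner_commute: "Re (cinner x y) = Re (cinner y (x::'a::complex_inner))"
  by (subst cinner_commute) simp

lemma norm_add_sq: "(norm (x + y))\<^sup>2 = (norm x)\<^sup>2 + 2 * Re (cinner x y) + (norm (y::'a::complex_inner))\<^sup>2"
  using Re_cinner_commute[of y x]
  by (simp flip: Re_cinner_self add: cinner_add_left cinner_add_right)

text \<open>Discriminant criterion, the common source of the Cauchy-Schwarz inequalities for the
  inner product and for positive operators and of the variational step in the projection
  theorem.\<close>

lemma sq_le_of_quadratic_nonneg:
  fixes a b c :: real
  assumes "\<And>t. 0 \<le> a + 2 * t * b + t\<^sup>2 * c"
  shows "b\<^sup>2 \<le> a * c"
proof (cases "c = 0")
  case True
  show ?thesis
  proof (cases "b = 0")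
    case False
    \<comment> \<open>With this \<open>t\<close> the affine function takes the value -1.\<close>
    then show ?thesis using assms[of "-(a + 1) / (2 * b)"] True by (simp add: field_simps)
  qed (use True in simp)
next
  case False
  have "c > 0"
  proof (rule ccontr)
    assume "\<not> c > 0"
    then have "c < 0" using False by simp
    \<comment> \<open>Averaging over \<open>t\<close> and \<open>-t\<close> removes the linear term;
      the \<open>s\<close> below then produces the value -1.\<close>
    have a: "0 \<le> a + t\<^sup>2 * c" for t
      using assms[of t] assms[of "-t"] by simp
    define s where "s = sqrt ((a + 1) / (- c))"
    have "a \<ge> 0" using a[of 0] by simp
    then have "s\<^sup>2 = (a + 1) / (- c)"
      unfolding s_def using \<open>c < 0\<close> by (intro real_sqrt_pow2 divide_nonneg_nonneg) auto
    then show False using a[of s] \<open>c < 0\<close> by (simp add: field_simps)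
  qed
  then show ?thesis using assms[of "- b / c"]
    by (simp add: field_simps power2_eq_square)
qed

lemma Re_cinner_le: "\<bar>Re (cinner x y)\<bar> \<le> norm x * norm (y::'a::complex_inner)"
proof -
  have "0 \<le> (norm x)\<^sup>2 + 2 * t * Re (cinner x y) + t\<^sup>2 * (norm y)\<^sup>2" for t
    using norm_add_sq[of x "t *\<^sub>R y"] zero_le_power2[of "norm (x + t *\<^sub>R y)"]
    by (simp add: cinner_scaleR_right power_mult_distrib algebra_simps)
  then have "(Re (cinner x y))\<^sup>2 \<le> (norm x)\<^sup>2 * (norm y)\<^sup>2"
    by (rule sq_le_of_quadratic_nonneg)
  then show ?thesis
    by (metis abs_le_square_iff abs_mult abs_norm_cancel power_mult_distrib)
qed

lemma norm_scaleC: "norm (a *\<^sub>C x) = cmod a * norm (x::'a::complex_inner)"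
proof -
  have "complex_of_real ((norm (a *\<^sub>C x))\<^sup>2) = a * (cnj a * cinner x x)"
    by (metis cinner_scaleC_left cinner_scaleC_right cinner_self)
  also have "\<dots> = complex_of_real ((cmod a * norm x)\<^sup>2)"
    using complex_norm_square[of a] by (simp add: cinner_self power_mult_distrib mult_ac)
  finally have "(norm (a *\<^sub>C x))\<^sup>2 = (cmod a * norm x)\<^sup>2"
    using of_real_eq_iff by blast
  then show ?thesis by (simp add: power2_eq_iff_nonneg)
qed

lemma scaleC_scaleR_commute: "a *\<^sub>C (r *\<^sub>R x) = r *\<^sub>R (a *\<^sub>C (x::'a::complex_inner))"
  by (metis mult.commute scaleC_of_real scaleC_scaleC)

text \<open>Carries facts about real parts over to the whole inner product: multiplying the second
  argument by \<i> exposes the imaginary part.\<close>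

lemma Im_cinner: "Im (cinner x y) = Re (cinner x (\<i> *\<^sub>C (y::'a::complex_inner)))"
  by (simp add: cinner_scaleC_right)

text \<open>The constant 2 comes from estimating real and imaginary part separately, which is enough
  for continuity.\<close>

lemma bounded_bilinear_cinner:
  "bounded_bilinear (cinner :: 'a::complex_inner \<Rightarrow> 'a \<Rightarrow> complex)"
proof
  show "\<exists>K. \<forall>a b::'a. cmod (cinner a b) \<le> norm a * norm b * K"
  proof (intro exI allI)
    fix a b :: 'a
    have "cmod (cinner a b) \<le> \<bar>Re (cinner a b)\<bar> + \<bar>Im (cinner a b)\<bar>" by (rule cmod_le)
    also have "\<dots> \<le> norm a * norm b + norm a * norm (\<i> *\<^sub>C b)"
      unfolding Im_cinner by (intro add_mono Re_cinner_le)
    finally show "cmod (cinner a b) \<le> norm a * norm b * 2" by (simp add: norm_scaleC)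
  qed
qed (simp_all add: cinner_add_left cinner_add_right cinner_scaleR_left cinner_scaleR_right scaleR_conv_of_real)

lemmas cinner_zero_left [simp] = bounded_bilinear.zero_left[OF bounded_bilinear_cinner]
  and cinner_zero_right [simp] = bounded_bilinear.zero_right[OF bounded_bilinear_cinner]
  and cinner_minus_left [simp] = bounded_bilinear.minus_left[OF bounded_bilinear_cinner]
  and cinner_minus_right [simp] = bounded_bilinear.minus_right[OF bounded_bilinear_cinner]
  and cinner_diff_left = bounded_bilinear.diff_left[OF bounded_bilinear_cinner]
  and cinner_diff_right = bounded_bilinear.diff_right[OF bounded_bilinear_cinner]
  and cinner_sum_left = bounded_bilinear.sum_left[OF bounded_bilinear_cinner]
  and cinner_sum_right = bounded_bilinear.sum_right[OF bounded_bilinear_cinner]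
  and tendsto_cinner [tendsto_intros] = bounded_bilinear.tendsto[OF bounded_bilinear_cinner]
  and continuous_on_cinner [continuous_intros] = bounded_bilinear.continuous_on[OF bounded_bilinear_cinner]

lemmas cinner_simps = cinner_add_left cinner_add_right cinner_diff_left cinner_diff_right
  cinner_scaleC_left cinner_scaleC_right cinner_scaleR_left cinner_scaleR_right

lemma cinner_eq_zero_iff [simp]: "cinner x x = 0 \<longleftrightarrow> x = (0::'a::complex_inner)"
  by (simp add: cinner_self)

lemma cinner_zero_commute: "cinner x y = 0 \<longleftrightarrow> cinner y (x::'a::complex_inner) = 0"
  by (metis cinner_commute complex_cnj_zero)

lemma norm_diff_sq: "(norm (x - y))\<^sup>2 = (norm x)\<^sup>2 - 2 * Re (cinner x y) + (norm (y::'a::complex_inner))\<^sup>2"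
  using norm_add_sq[of x "- y"] by simp

lemma pythagoras: "cinner x y = 0 \<Longrightarrow> (norm (x + y))\<^sup>2 = (norm x)\<^sup>2 + (norm (y::'a::complex_inner))\<^sup>2"
  by (simp add: norm_add_sq)

lemma bounded_linear_scaleC: "bounded_linear (\<lambda>x::'a::complex_inner. a *\<^sub>C x)"
  by (intro bounded_linear_intro[where K = "cmod a"])
     (simp_all add: scaleC_add_right scaleC_scaleR_commute norm_scaleC mult.commute)

lemmas tendsto_scaleC = bounded_linear.tendsto[OF bounded_linear_scaleC]

lemma csubspace_scaleR: "csubspace M \<Longrightarrow> x \<in> M \<Longrightarrow> r *\<^sub>R x \<in> (M::'a::complex_inner set)"
  by (metis complex_vector.subspace_scale scaleC_of_real)

lemmas csubspace_ops = complex_vector.subspace_add complex_vector.subspace_diff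
  complex_vector.subspace_scale csubspace_scaleR complex_vector.subspace_neg complex_vector.subspace_0

lemma closed_csubspaceD:
  assumes "closed_csubspace M"
  shows "csubspace M" "closed M"
  using assms by (auto simp: closed_csubspace_def)

lemma closed_csubspace_UNIV: "closed_csubspace (UNIV :: 'a::complex_inner set)"
  by (simp add: closed_csubspace_def complex_vector.subspace_UNIV)

lemma closed_csubspace_Int:
  "closed_csubspace M \<Longrightarrow> closed_csubspace N \<Longrightarrow> closed_csubspace (M \<inter> N)"
  by (simp add: closed_csubspace_def complex_vector.subspace_inter closed_Int)

definition ortho :: "'a::complex_inner set \<Rightarrow> 'a set" where
  "ortho S = {x. \<forall>y\<in>S. cinner x y = 0}"

lemma orthoD: "x \<in> ortho S \<Longrightarrow> y \<in> S \<Longrightarrow> cinner x y = 0" "x \<in> ortho S \<Longrightarrow> y \<in> S \<Longrightarrow> cinner y x = 0"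
  by (auto simp: ortho_def cinner_zero_commute)

lemma closed_csubspace_ortho: "closed_csubspace (ortho S)"
proof -
  have "closed {x. cinner x y = 0}" for y :: 'a
    by (intro closed_Collect_eq continuous_intros)
  then have "closed (\<Inter>y\<in>S. {x. cinner x y = 0})" by auto
  moreover have "ortho S = (\<Inter>y\<in>S. {x. cinner x y = 0})" by (auto simp: ortho_def)
  ultimately show ?thesis
    by (auto simp: closed_csubspace_def complex_vector.subspace_def ortho_def cinner_simps)
qed

lemma cinner_zero_span:
  assumes "x \<in> cspan S" "\<And>s. s \<in> S \<Longrightarrow> cinner s y = 0"
  shows "cinner x y = 0"
  using assms(1)
  by (induction rule: complex_vector.span_induct_alt) (auto simp: cinner_simps assms(2))

lemma closed_csubspace_closure_span: "closed_csubspace (closure (cspan (S::'a::complex_inner set)))"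
proof -
  let ?V = "cspan S"
  have "csubspace (closure ?V)"
    unfolding complex_vector.subspace_def
  proof (intro conjI ballI allI)
    show "0 \<in> closure ?V"
      using closure_subset complex_vector.span_zero by blast
  next
    fix x y assume "x \<in> closure ?V" "y \<in> closure ?V"
    then obtain f g where "\<And>n. f n \<in> ?V" "f \<longlonglongrightarrow> x" "\<And>n. g n \<in> ?V" "g \<longlonglongrightarrow> y"
      unfolding closure_sequential by blast
    then show "x + y \<in> closure ?V"
      unfolding closure_sequential
      by (intro exI[of _ "\<lambda>n. f n + g n"]) (auto intro: tendsto_add complex_vector.span_add)
  next
    fix x c assume "x \<in> closure ?V"
    then obtain f where "\<And>n. f n \<in> ?V" "f \<longlonglongrightarrow> x"
      unfolding closure_sequential by blast
    then show "c *\<^sub>C x \<in> closure ?V"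
      unfolding closure_sequential
      by (intro exI[of _ "\<lambda>n. c *\<^sub>C f n"]) (auto intro: tendsto_scaleC complex_vector.span_scale)
  qed
  then show ?thesis by (simp add: closed_csubspace_def)
qed

section \<open>The projection theorem\<close>

lemma cinner_zero_of_minimal:
  assumes "\<And>t::real. (norm x)\<^sup>2 \<le> (norm (x + t *\<^sub>R z))\<^sup>2"
  shows "Re (cinner x z) = 0"
proof -
  have "0 \<le> 0 + 2 * t * Re (cinner x z) + t\<^sup>2 * (norm z)\<^sup>2" for t
    using assms[of t] by (simp add: norm_add_sq cinner_scaleR_right power_mult_distrib algebra_simps)
  then have "(Re (cinner x z))\<^sup>2 \<le> 0 * (norm z)\<^sup>2"
    by (rule sq_le_of_quadratic_nonneg)
  then show ?thesis by simp
qed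

text \<open>A sequence minimizing the distance to \<open>x\<close> is Cauchy by the parallelogram
  law, and its limit is stationary in every direction of \<open>M\<close>.\<close>

lemma projection_exists:
  fixes M :: "'a::chilbert_space set"
  assumes M: "closed_csubspace M"
  shows "\<exists>y\<in>M. \<forall>z\<in>M. cinner (x - y) z = 0"
proof -
  note sub = closed_csubspaceD(1)[OF M]
  note ops = csubspace_ops[OF sub]
  have "0 \<in> M" using sub by (rule complex_vector.subspace_0)
  define d where "d = (INF m\<in>M. (norm (x - m))\<^sup>2)"
  have bdd: "bdd_below ((\<lambda>m. (norm (x - m))\<^sup>2) ` M)"
    by (intro bdd_belowI2[of _ 0]) simp
  have d_le: "d \<le> (norm (x - m))\<^sup>2" if "m \<in> M" for m
    unfolding d_def using that bdd by (intro cINF_lower)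
  have "\<exists>m\<in>M. (norm (x - m))\<^sup>2 < d + inverse (real (Suc n))" for n
  proof -
    have "Inf ((\<lambda>m. (norm (x - m))\<^sup>2) ` M) < d + inverse (real (Suc n))"
      unfolding d_def by simp
    then obtain r where "r \<in> (\<lambda>m. (norm (x - m))\<^sup>2) ` M" "r < d + inverse (real (Suc n))"
      using cInf_lessD[of "(\<lambda>m. (norm (x - m))\<^sup>2) ` M"] \<open>0 \<in> M\<close> by blast
    then show ?thesis by blast
  qed
  then obtain m where m: "\<And>n. m n \<in> M" "\<And>n. (norm (x - m n))\<^sup>2 < d + inverse (real (Suc n))"
    by metis
  \<comment> \<open>The midpoint stays in \<open>M\<close>, so the sum term of the parallelogram law
    is at least \<open>4 * d\<close>; only the excesses over \<open>d\<close> remain.\<close>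
  have par: "(norm (m i - m j))\<^sup>2 \<le> 2 * inverse (real (Suc i)) + 2 * inverse (real (Suc j))" for i j
  proof -
    have mid: "(1/2) *\<^sub>R (m i + m j) \<in> M" by (intro ops m(1))
    have "(norm (m i - m j))\<^sup>2 + (norm ((x - m i) + (x - m j)))\<^sup>2
        = 2 * (norm (x - m i))\<^sup>2 + 2 * (norm (x - m j))\<^sup>2"
      using norm_diff_sq[of "x - m j" "x - m i"] by (simp add: norm_add_sq Re_cinner_commute)
    moreover have "(x - m i) + (x - m j) = 2 *\<^sub>R (x - (1/2) *\<^sub>R (m i + m j))"
      by (simp add: scaleR_2 algebra_simps)
    then have "(norm ((x - m i) + (x - m j)))\<^sup>2 \<ge> 4 * d"
      using d_le[OF mid] by (simp add: power_mult_distrib)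
    ultimately show ?thesis using m(2)[of i] m(2)[of j] by linarith
  qed
  have "Cauchy m"
  proof (rule metric_CauchyI)
    fix e :: real assume "e > 0"
    then obtain N where N: "inverse (real (Suc N)) < e\<^sup>2 / 4"
      using reals_Archimedean[of "e\<^sup>2/4"] by auto
    show "\<exists>N. \<forall>i\<ge>N. \<forall>j\<ge>N. dist (m i) (m j) < e"
    proof (intro exI allI impI)
      fix i j assume "N \<le> i" "N \<le> j"
      then have "inverse (real (Suc i)) \<le> inverse (real (Suc N))" "inverse (real (Suc j)) \<le> inverse (real (Suc N))"
        by (simp_all add: le_imp_inverse_le)
      then have "(norm (m i - m j))\<^sup>2 < e\<^sup>2" using par[of i j] N by linarith
      then show "dist (m i) (m j) < e" using \<open>e > 0\<close> by (simp add: dist_norm power_less_imp_less_base)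
    qed
  qed
  then obtain y where y: "m \<longlonglongrightarrow> y" using Cauchy_convergent convergent_def by blast
  have "y \<in> M" using closed_csubspaceD(2)[OF M] m(1) y closed_sequentially by blast
  have "(norm (x - y))\<^sup>2 \<le> d"
  proof (rule LIMSEQ_le)
    show "(\<lambda>n. (norm (x - m n))\<^sup>2) \<longlonglongrightarrow> (norm (x - y))\<^sup>2" by (intro tendsto_intros y)
    show "(\<lambda>n. d + inverse (real (Suc n))) \<longlonglongrightarrow> d"
      using tendsto_add[OF tendsto_const LIMSEQ_inverse_real_of_nat, of d] by simp
    show "\<exists>N. \<forall>n\<ge>N. (norm (x - m n))\<^sup>2 \<le> d + inverse (real (Suc n))"
      using m(2) less_imp_le by blast
  qed
  then have min: "(norm (x - y))\<^sup>2 \<le> (norm (x - w))\<^sup>2" if "w \<in> M" for w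
    using d_le[OF that] by linarith
  have Re0: "Re (cinner (x - y) z) = 0" if "z \<in> M" for z
  proof (rule cinner_zero_of_minimal)
    fix t :: real
    have "y - t *\<^sub>R z \<in> M" by (intro ops \<open>y \<in> M\<close> that)
    from min[OF this] show "(norm (x - y))\<^sup>2 \<le> (norm (x - y + t *\<^sub>R z))\<^sup>2"
      by (simp add: algebra_simps)
  qed
  \<comment> \<open>Minimality along real multiples yields real parts only; the direction
    \<open>\<i> *\<^sub>C z\<close> supplies the imaginary part.\<close>
  have "cinner (x - y) z = 0" if "z \<in> M" for z
    using Re0[OF that] Re0[of "\<i> *\<^sub>C z"] Im_cinner[of "x - y" z] ops(3)[OF that] by (simp add: complex_eq_iff)
  then show ?thesis using \<open>y \<in> M\<close> by blast
qed

lemma orth_proj_eqI: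
  assumes "csubspace M" "y \<in> M" "\<And>z. z \<in> M \<Longrightarrow> cinner (x - y) z = 0"
  shows "orth_proj M x = y"
  unfolding orth_proj_def
proof (rule the_equality)
  fix y' assume y': "y' \<in> M \<and> (\<forall>z\<in>M. cinner (x - y') z = 0)"
  have "y - y' \<in> M" using assms y' by (auto intro: csubspace_ops)
  then have "cinner ((x - y') - (x - y)) (y - y') = 0"
    using assms(3) y' by (simp only: cinner_diff_left) simp
  then show "y' = y" by simp
qed (use assms in auto)

context
  fixes M :: "'a::chilbert_space set"
  assumes M: "closed_csubspace M"
begin

lemma orth_proj_in_orth: "orth_proj M x \<in> M \<and> (\<forall>z\<in>M. cinner (x - orth_proj M x) z = 0)"
  using projection_exists[OF M, of x] orth_proj_eqI[OF closed_csubspaceD(1)[OF M]] by metis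

lemma orth_proj_in: "orth_proj M x \<in> M"
  using orth_proj_in_orth by blast

lemma orth_proj_orth: "z \<in> M \<Longrightarrow> cinner (x - orth_proj M x) z = 0"
  using orth_proj_in_orth by blast

lemma orth_proj_resid: "x - orth_proj M x \<in> ortho M"
  using orth_proj_in_orth by (auto simp: ortho_def)

lemma cinner_orth_proj_right: "z \<in> M \<Longrightarrow> cinner z (orth_proj M x) = cinner z x"
  using orth_proj_orth[of z x] by (metis cinner_diff_left cinner_commute eq_iff_diff_eq_0)

lemma cinner_orth_proj_left: "z \<in> M \<Longrightarrow> cinner (orth_proj M x) z = cinner x z"
  using orth_proj_orth[of z x] by (simp add: cinner_diff_left)

lemma orth_proj_id: "x \<in> M \<Longrightarrow> orth_proj M x = x"
  by (rule orth_proj_eqI[OF closed_csubspaceD(1)[OF M]]) auto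

lemma orth_proj_zero: "x \<in> ortho M \<Longrightarrow> orth_proj M x = 0"
  by (rule orth_proj_eqI[OF closed_csubspaceD(1)[OF M]])
     (auto simp: ortho_def complex_vector.subspace_0[OF closed_csubspaceD(1)[OF M]])

lemma orth_proj_add: "orth_proj M (x + y) = orth_proj M x + orth_proj M y"
proof (rule orth_proj_eqI[OF closed_csubspaceD(1)[OF M]])
  show "orth_proj M x + orth_proj M y \<in> M"
    by (intro csubspace_ops closed_csubspaceD(1)[OF M] orth_proj_in)
qed (simp add: cinner_simps cinner_orth_proj_left)

lemma orth_proj_scaleC: "orth_proj M (c *\<^sub>C x) = c *\<^sub>C orth_proj M x"
proof (rule orth_proj_eqI[OF closed_csubspaceD(1)[OF M]])
  show "c *\<^sub>C orth_proj M x \<in> M"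
    by (intro csubspace_ops closed_csubspaceD(1)[OF M] orth_proj_in)
qed (simp add: cinner_simps cinner_orth_proj_left)

lemma norm_orth_proj_sq: "(norm x)\<^sup>2 = (norm (orth_proj M x))\<^sup>2 + (norm (x - orth_proj M x))\<^sup>2"
proof -
  have "cinner (orth_proj M x) (x - orth_proj M x) = 0"
    using orth_proj_orth[OF orth_proj_in] cinner_zero_commute by blast
  from pythagoras[OF this] show ?thesis by simp
qed

lemma norm_orth_proj_le: "norm (orth_proj M x) \<le> norm x"
  using norm_orth_proj_sq[of x] power2_le_imp_le[of "norm (orth_proj M x)" "norm x"] by simp

end

text \<open>The residual of \<open>x\<close> is orthogonal to \<open>x\<close> and to its
  projection, hence to itself.\<close>

lemma ortho_ortho_closed:
  assumes "closed_csubspace M" "\<And>y. y \<in> ortho M \<Longrightarrow> cinner x y = 0"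
  shows "x \<in> (M :: 'a::chilbert_space set)"
proof -
  let ?r = "x - orth_proj M x"
  have "cinner x ?r = 0" using assms(2) orth_proj_resid[OF assms(1)] by blast
  moreover have "cinner (orth_proj M x) ?r = 0"
    using orth_proj_orth[OF assms(1) orth_proj_in[OF assms(1)]] cinner_zero_commute by blast
  ultimately have "cinner ?r ?r = 0" by (simp only: cinner_diff_left) simp
  then show ?thesis using orth_proj_in[OF assms(1), of x] by simp
qed

section \<open>Operators on a carrier\<close>

lemma bounded_opI:
  assumes "\<And>x. x \<in> M \<Longrightarrow> T x \<in> N" "\<And>x y. x \<in> M \<Longrightarrow> y \<in> M \<Longrightarrow> T (x + y) = T x + T y"
    "\<And>c x. x \<in> M \<Longrightarrow> T (c *\<^sub>C x) = c *\<^sub>C T x" "\<And>x. x \<in> M \<Longrightarrow> norm (T x) \<le> C * norm x"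
  shows "bounded_op M N T"
  using assms unfolding bounded_op_def by blast

lemma bounded_opD:
  assumes "bounded_op M N T"
  shows "x \<in> M \<Longrightarrow> T x \<in> N" "x \<in> M \<Longrightarrow> y \<in> M \<Longrightarrow> T (x + y) = T x + T y"
    "x \<in> M \<Longrightarrow> T (c *\<^sub>C x) = c *\<^sub>C T x"
  using assms unfolding bounded_op_def by (auto simp: Pi_def)

lemma bounded_op_scaleR: "bounded_op M N T \<Longrightarrow> x \<in> M \<Longrightarrow> T (r *\<^sub>R x) = r *\<^sub>R T x"
  by (metis bounded_opD(3) scaleC_of_real)

lemma bounded_op_bound:
  assumes "bounded_op M N T"
  obtains C where "C > 0" "\<And>x. x \<in> M \<Longrightarrow> norm (T x) \<le> C * norm x"
proof -
  obtain C where C: "\<And>x. x \<in> M \<Longrightarrow> norm (T x) \<le> C * norm x"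
    using assms unfolding bounded_op_def by blast
  have "norm (T x) \<le> (\<bar>C\<bar> + 1) * norm x" if "x \<in> M" for x
    using C[OF that] by (rule order_trans) (intro mult_right_mono, auto)
  then show ?thesis using that[of "\<bar>C\<bar> + 1"] by simp
qed

lemma bounded_op_mono:
  "bounded_op M N T \<Longrightarrow> M' \<subseteq> M \<Longrightarrow> N \<subseteq> N' \<Longrightarrow> bounded_op M' N' T"
  unfolding bounded_op_def by (auto simp: Pi_def; meson subset_iff)

lemma bounded_op_diff:
  assumes "csubspace M" "bounded_op M N T" "x \<in> M" "y \<in> M"
  shows "T (x - y) = T x - T y"
proof -
  have "T ((x - y) + y) = T (x - y) + T y"
    using assms by (intro bounded_opD(2)) (auto intro: csubspace_ops)
  then show ?thesis by simp
qed

lemma bounded_op_0: "csubspace M \<Longrightarrow> bounded_op M N T \<Longrightarrow> T 0 = 0"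
  using bounded_op_diff[of M N T 0 0] by (auto intro: csubspace_ops)

lemma bounded_op_sum:
  assumes "csubspace M" "bounded_op M N T" "finite I" "\<And>i. i \<in> I \<Longrightarrow> f i \<in> M"
  shows "T (\<Sum>i\<in>I. f i) = (\<Sum>i\<in>I. T (f i))"
  using assms(3,4)
proof (induction rule: finite_induct)
  case (insert i I)
  moreover have "(\<Sum>i\<in>I. f i) \<in> M" using insert by (intro complex_vector.subspace_sum[OF assms(1)]) auto
  ultimately show ?case
    using bounded_opD(2)[OF assms(2), of "f i" "\<Sum>i\<in>I. f i"] by simp
qed (simp add: bounded_op_0[OF assms(1,2)])

lemma bounded_op_tendsto:
  assumes M: "csubspace M" and T: "bounded_op M N T"
    and x: "\<And>n. x n \<in> M" "l \<in> M" "x \<longlonglongrightarrow> l"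
  shows "(\<lambda>n. T (x n)) \<longlonglongrightarrow> T l"
proof -
  obtain C where C: "C > 0" "\<And>x. x \<in> M \<Longrightarrow> norm (T x) \<le> C * norm x"
    using bounded_op_bound[OF T] by blast
  have "(\<lambda>n. norm (x n - l)) \<longlonglongrightarrow> 0" by (intro tendsto_norm_zero LIM_zero x(3))
  then have lim: "(\<lambda>n. C * norm (x n - l)) \<longlonglongrightarrow> 0" by (rule tendsto_mult_right_zero)
  have "(\<lambda>n. T (x n) - T l) \<longlonglongrightarrow> 0"
  proof (rule Lim_null_comparison[OF _ lim])
    have "norm (T (x n) - T l) \<le> C * norm (x n - l)" for n
      using C(2)[of "x n - l"] x bounded_op_diff[OF M T] csubspace_ops(2)[OF M] by simp
    then show "\<forall>\<^sub>F n in sequentially. norm (T (x n) - T l) \<le> C * norm (x n - l)" by simp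
  qed
  then show ?thesis by (rule LIM_zero_cancel)
qed

lemma bounded_op_continuous_on:
  assumes "csubspace M" "bounded_op M N T"
  shows "continuous_on M T"
  by (rule continuous_on_sequentiallyI) (auto intro: bounded_op_tendsto[OF assms])

lemma bounded_op_id: "bounded_op M M (\<lambda>x. x)"
  by (rule bounded_opI[where C = 1]) auto

lemma bounded_op_combine:
  assumes M: "csubspace N" and A: "bounded_op M N A" and B: "bounded_op M N B"
  shows "bounded_op M N (\<lambda>x. a *\<^sub>R A x + b *\<^sub>R B x)"
proof -
  obtain C where C: "\<And>x. x \<in> M \<Longrightarrow> norm (A x) \<le> C * norm x" using bounded_op_bound[OF A] by blast
  obtain D where D: "\<And>x. x \<in> M \<Longrightarrow> norm (B x) \<le> D * norm x" using bounded_op_bound[OF B] by blast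
  have "norm (a *\<^sub>R A x + b *\<^sub>R B x) \<le> (\<bar>a\<bar> * C + \<bar>b\<bar> * D) * norm x" if "x \<in> M" for x
  proof -
    have "norm (a *\<^sub>R A x + b *\<^sub>R B x) \<le> \<bar>a\<bar> * norm (A x) + \<bar>b\<bar> * norm (B x)"
      by (rule norm_triangle_le) simp
    also have "\<dots> \<le> \<bar>a\<bar> * (C * norm x) + \<bar>b\<bar> * (D * norm x)"
      using C D that by (intro add_mono mult_left_mono) auto
    finally show ?thesis by (simp add: algebra_simps)
  qed
  then show ?thesis
    using bounded_opD[OF A] bounded_opD[OF B]
    by (intro bounded_opI[where C = "\<bar>a\<bar> * C + \<bar>b\<bar> * D"])
       (auto simp: scaleC_add_right scaleC_scaleR_commute scaleR_add_right intro!: csubspace_ops[OF M])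
qed

lemma bounded_op_comp:
  assumes A: "bounded_op N L A" and B: "bounded_op M N B"
  shows "bounded_op M L (\<lambda>x. A (B x))"
proof -
  obtain C where C: "C > 0" "\<And>x. x \<in> N \<Longrightarrow> norm (A x) \<le> C * norm x" using bounded_op_bound[OF A] by blast
  obtain D where D: "\<And>x. x \<in> M \<Longrightarrow> norm (B x) \<le> D * norm x" using bounded_op_bound[OF B] by blast
  have "norm (A (B x)) \<le> (C * D) * norm x" if "x \<in> M" for x
  proof -
    have "norm (A (B x)) \<le> C * norm (B x)" using C bounded_opD(1)[OF B that] by blast
    also have "\<dots> \<le> C * (D * norm x)" using C D that by (intro mult_left_mono) auto
    finally show ?thesis by simp
  qed
  then show ?thesis
    using bounded_opD[OF A] bounded_opD[OF B] by (intro bounded_opI[where C = "C * D"]) auto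
qed

lemma bounded_op_orth_proj:
  "closed_csubspace M \<Longrightarrow> bounded_op UNIV M (orth_proj (M::'a::chilbert_space set))"
  by (intro bounded_opI[where C = 1])
     (auto simp: orth_proj_in orth_proj_add orth_proj_scaleC norm_orth_proj_le)

text \<open>Self-adjointness on a carrier, phrased through the inner product so that the description
  operator in \<open>adjoint_op\<close> is avoided; \<open>sym_op_self_adjoint\<close> translates it
  for the whole space.\<close>

definition sym_op :: "'a::complex_inner set \<Rightarrow> ('a \<Rightarrow> 'a) \<Rightarrow> bool" where
  "sym_op M A \<longleftrightarrow> bounded_op M M A \<and> (\<forall>x\<in>M. \<forall>y\<in>M. cinner (A x) y = cinner x (A y))"

lemma sym_opD:
  assumes "sym_op M A"
  shows "bounded_op M M A" "x \<in> M \<Longrightarrow> y \<in> M \<Longrightarrow> cinner (A x) y = cinner x (A y)"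
  using assms by (auto simp: sym_op_def)

lemma sym_op_Im: "sym_op M A \<Longrightarrow> x \<in> M \<Longrightarrow> Im (cinner (A x) x) = 0"
  by (metis sym_opD(2) cinner_commute Im_complex_of_real Reals_cases Reals_cnj_iff)

lemma sym_op_id: "sym_op M (\<lambda>x. x)"
  by (simp add: sym_op_def bounded_op_id)

lemma sym_op_combine:
  assumes "csubspace M" "sym_op M A" "sym_op M B"
  shows "sym_op M (\<lambda>x. a *\<^sub>R A x + b *\<^sub>R B x)"
  using assms bounded_op_combine[of M M A B] unfolding sym_op_def by (auto simp: cinner_simps)

lemma sym_op_square: "sym_op M A \<Longrightarrow> sym_op M (\<lambda>x. A (A x))"
  using bounded_op_comp[of M M A M A] bounded_opD(1)[of M M A] unfolding sym_op_def by auto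

text \<open>Complex polarization: the sesquilinear defect \<open>f\<close> vanishes on the diagonal,
  and expanding it at x + y and at x + \<i> y gives \<open>f x y = - f y x\<close> and
  \<open>f x y = f y x\<close>.\<close>

lemma positive_op_sym:
  assumes M: "csubspace M" and A: "positive_op M A"
  shows "sym_op M A"
proof -
  have bA: "bounded_op M M A" using A by (simp add: positive_op_def)
  note lin = bounded_opD[OF bA] and ops = csubspace_ops[OF M]
  define f where "f x y = cinner (A x) y - cinner x (A y)" for x y
  have f0: "f x x = 0" if "x \<in> M" for x
  proof -
    have "cinner (A x) x \<in> \<real>" using A that unfolding positive_op_def by (auto simp: nonneg_Reals_def)
    then have "cinner (A x) x = cinner x (A x)" by (metis Reals_cnj_iff cinner_commute)
    then show ?thesis by (simp add: f_def)
  qed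
  have "f x y = 0" if xy: "x \<in> M" "y \<in> M" for x y
  proof -
    have "f (x + y) (x + y) = f x x + f x y + f y x + f y y"
      using xy by (simp add: f_def lin cinner_simps)
    then have 1: "f x y + f y x = 0" using f0 xy ops by simp
    have "f (x + \<i> *\<^sub>C y) (x + \<i> *\<^sub>C y) = f x x - \<i> * f x y + \<i> * f y x + f y y"
      using xy ops by (simp add: f_def lin cinner_simps algebra_simps)
    then have "\<i> * (f y x - f x y) = 0" using f0 xy ops by (simp add: algebra_simps)
    then have "f y x = f x y" by simp
    with 1 show ?thesis by simp
  qed
  then show ?thesis using bA by (simp add: sym_op_def f_def)
qed

lemma positive_op_iff:
  assumes M: "csubspace M"
  shows "positive_op M A \<longleftrightarrow> sym_op M A \<and> (\<forall>x\<in>M. 0 \<le> Re (cinner (A x) x))"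
proof
  show "positive_op M A \<Longrightarrow> sym_op M A \<and> (\<forall>x\<in>M. 0 \<le> Re (cinner (A x) x))"
    using positive_op_sym[OF M] by (auto simp: positive_op_def complex_nonneg_Reals_iff)
  show "sym_op M A \<and> (\<forall>x\<in>M. 0 \<le> Re (cinner (A x) x)) \<Longrightarrow> positive_op M A"
    using sym_op_Im[of M A] by (auto simp: positive_op_def complex_nonneg_Reals_iff sym_op_def)
qed

lemma positive_op_Cauchy_Schwarz:
  assumes M: "csubspace M" and A: "positive_op M A" and xy: "x \<in> M" "y \<in> M"
  shows "(Re (cinner (A x) y))\<^sup>2 \<le> Re (cinner (A x) x) * Re (cinner (A y) y)"
proof (rule sq_le_of_quadratic_nonneg)
  fix t :: real
  have s: "sym_op M A" and p: "\<And>x. x \<in> M \<Longrightarrow> 0 \<le> Re (cinner (A x) x)"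
    using A positive_op_iff[OF M] by auto
  have "Re (cinner (A y) x) = Re (cinner (A x) y)"
    using sym_opD(2)[OF s] xy Re_cinner_commute by metis
  moreover have "x + t *\<^sub>R y \<in> M" by (intro csubspace_ops[OF M] xy)
  then have "0 \<le> Re (cinner (A (x + t *\<^sub>R y)) (x + t *\<^sub>R y))" by (rule p)
  moreover have "A (x + t *\<^sub>R y) = A x + t *\<^sub>R A y"
    using bounded_opD(2) bounded_op_scaleR sym_opD(1)[OF s] xy csubspace_ops(4)[OF M] by metis
  ultimately show "0 \<le> Re (cinner (A x) x) + 2 * t * Re (cinner (A x) y) + t\<^sup>2 * Re (cinner (A y) y)"
    by (simp add: cinner_simps algebra_simps power2_eq_square)
qed

text \<open>This is the operator inequality A^2 \<le> b A. Cauchy-Schwarz for the form of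
  \<open>A\<close>, taken at \<open>x\<close> and \<open>A x\<close>, leaves a common factor
  \<open>(norm (A x))\<^sup>2\<close> to cancel.\<close>

lemma positive_op_norm_sq_le:
  assumes M: "csubspace M" and A: "positive_op M A"
    and b: "\<And>y. y \<in> M \<Longrightarrow> Re (cinner (A y) y) \<le> b * (norm y)\<^sup>2" and x: "x \<in> M"
  shows "(norm (A x))\<^sup>2 \<le> b * Re (cinner (A x) x)"
proof (cases "A x = 0")
  case False
  have Ax: "A x \<in> M" using A x bounded_opD(1) unfolding positive_op_def by blast
  have "((norm (A x))\<^sup>2)\<^sup>2 \<le> Re (cinner (A x) x) * Re (cinner (A (A x)) (A x))"
    using positive_op_Cauchy_Schwarz[OF M A x Ax] by (simp add: Re_cinner_self)
  also have "\<dots> \<le> Re (cinner (A x) x) * (b * (norm (A x))\<^sup>2)"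
    using b[OF Ax] A x positive_op_iff[OF M] by (intro mult_left_mono) auto
  finally show ?thesis using False by (simp add: power2_eq_square mult.commute)
qed simp

text \<open>For positive operators the quadratic form controls the norm: the bound \<open>b\<close>
  enters once through A^2 \<le> b A and once more for the form itself.\<close>

lemma positive_op_norm_le:
  assumes M: "csubspace M" and A: "positive_op M A"
    and b: "\<And>y. y \<in> M \<Longrightarrow> Re (cinner (A y) y) \<le> b * (norm y)\<^sup>2" and x: "x \<in> M" and "b \<ge> 0"
  shows "norm (A x) \<le> b * norm x"
proof -
  have "(norm (A x))\<^sup>2 \<le> b * Re (cinner (A x) x)"
    by (rule positive_op_norm_sq_le[OF M A b x])
  also have "\<dots> \<le> b * (b * (norm x)\<^sup>2)" using b[OF x] \<open>b \<ge> 0\<close> by (intro mult_left_mono)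
  also have "\<dots> = (b * norm x)\<^sup>2" by (simp add: power2_eq_square)
  finally show ?thesis using \<open>b \<ge> 0\<close> power2_le_imp_le[of "norm (A x)" "b * norm x"] by simp
qed

lemma positive_op_Re_le:
  assumes M: "csubspace M" and A: "positive_op M A" and x: "x \<in> M"
    and b: "norm (A x) \<le> b * norm x"
  shows "Re (cinner (A x) x) \<le> b * (norm x)\<^sup>2"
proof -
  have "Re (cinner (A x) x) \<le> norm (A x) * norm x" using Re_cinner_le[of "A x" x] by linarith
  also have "\<dots> \<le> b * norm x * norm x" using b by (intro mult_right_mono) auto
  finally show ?thesis by (simp add: power2_eq_square mult.assoc)
qed

lemma positive_op_ker:
  assumes M: "csubspace M" and A: "positive_op M A" and x: "x \<in> M"
    and "Re (cinner (A x) x) = 0"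
  shows "A x = 0"
proof -
  obtain C where C: "C > 0" "\<And>x. x \<in> M \<Longrightarrow> norm (A x) \<le> C * norm x"
    using bounded_op_bound A unfolding positive_op_def by metis
  have "(norm (A x))\<^sup>2 \<le> C * Re (cinner (A x) x)"
    by (rule positive_op_norm_sq_le[OF M A _ x]) (intro positive_op_Re_le[OF M A] C)
  then show ?thesis using assms(4) by simp
qed

section \<open>Square roots of positive operators\<close>

text \<open>The root of \<open>1 - C\<close> for \<open>0 \<le> C \<le> 1\<close> is \<open>1 - B\<close> where \<open>B = (C + B\<^sup>2) / 2\<close>. The same iteration for
the scalar \<open>C = 1\<close> dominates the increments of the operator iteration.\<close>

fun sqrt_iter :: "('a::complex_inner \<Rightarrow> 'a) \<Rightarrow> nat \<Rightarrow> 'a \<Rightarrow> 'a" where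
  "sqrt_iter C 0 x = 0"
| "sqrt_iter C (Suc n) x = (1/2) *\<^sub>R C x + (1/2) *\<^sub>R sqrt_iter C n (sqrt_iter C n x)"

fun sqrt_bound :: "nat \<Rightarrow> real" where
  "sqrt_bound 0 = 0"
| "sqrt_bound (Suc n) = (1 + (sqrt_bound n)\<^sup>2) / 2"

lemma sqrt_bound_range: "0 \<le> sqrt_bound n" "sqrt_bound n \<le> 1"
proof -
  have "0 \<le> sqrt_bound n \<and> sqrt_bound n \<le> 1"
    by (induction n) (auto simp: power_le_one add_nonneg_nonneg)
  then show "0 \<le> sqrt_bound n" "sqrt_bound n \<le> 1" by auto
qed

lemma sqrt_bound_incseq: "incseq sqrt_bound"
proof (rule incseq_SucI)
  fix n
  have "sqrt_bound (Suc n) - sqrt_bound n = (1 - sqrt_bound n)\<^sup>2 / 2"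
    by (simp add: power2_eq_square field_simps)
  then show "sqrt_bound n \<le> sqrt_bound (Suc n)" by (smt (verit) divide_nonneg_nonneg zero_le_power2)
qed

lemma sqrt_bound_Cauchy: "Cauchy sqrt_bound"
  using incseq_convergent[OF sqrt_bound_incseq] sqrt_bound_range(2)
  by (metis convergent_Cauchy convergent_def)

context
  fixes M :: "'a::chilbert_space set" and C :: "'a \<Rightarrow> 'a"
  assumes M: "closed_csubspace M" and C: "sym_op M C" and norm_C: "\<And>x. x \<in> M \<Longrightarrow> norm (C x) \<le> norm x"
begin

lemmas csubM = closed_csubspaceD(1)[OF M]

lemma sqrt_iter_sym: "sym_op M (sqrt_iter C n)"
proof (induction n)
  case 0
  then show ?case
    by (auto simp: sym_op_def bounded_op_def csubspace_ops[OF csubM] intro!: exI[of _ 0])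
next
  case (Suc n)
  show ?case
    using sym_op_combine[OF csubM C sym_op_square[OF Suc], of "1/2" "1/2"]
    by (simp add: fun_eq_iff[symmetric] sqrt_iter.simps(2)[abs_def])
qed

lemmas sqrt_iter_lin = sym_opD(1)[OF sqrt_iter_sym]

lemma sqrt_iter_norm: "x \<in> M \<Longrightarrow> norm (sqrt_iter C n x) \<le> sqrt_bound n * norm x"
proof (induction n arbitrary: x)
  case (Suc n)
  have "norm (sqrt_iter C n (sqrt_iter C n x)) \<le> sqrt_bound n * norm (sqrt_iter C n x)"
    using Suc bounded_opD(1)[OF sqrt_iter_lin] by blast
  also have "\<dots> \<le> sqrt_bound n * (sqrt_bound n * norm x)"
    using Suc sqrt_bound_range by (intro mult_left_mono) auto
  finally have 1: "norm (sqrt_iter C n (sqrt_iter C n x)) \<le> (sqrt_bound n)\<^sup>2 * norm x"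
    by (simp add: power2_eq_square)
  have "norm (sqrt_iter C (Suc n) x) \<le> (1/2) * norm (C x) + (1/2) * norm (sqrt_iter C n (sqrt_iter C n x))"
    unfolding sqrt_iter.simps by (rule norm_triangle_le) simp
  with 1 norm_C[OF Suc.prems] show ?case by (simp add: field_simps)
qed simp

text \<open>The difference of squares is split as (B' - B) B' + B (B' - B), with B' the next
  iterate, so no commutation is involved; for the scalars the same splitting is an equality, which
  closes the induction.\<close>

lemma sqrt_iter_increment:
  "x \<in> M \<Longrightarrow> norm (sqrt_iter C (Suc n) x - sqrt_iter C n x) \<le> (sqrt_bound (Suc n) - sqrt_bound n) * norm x"
proof (induction n arbitrary: x)
  case 0
  then show ?case using norm_C[of x] by simp
next
  case (Suc n)
  let ?B = "sqrt_iter C" and ?t = sqrt_bound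
  have mem: "?B k x \<in> M" for k using Suc.prems bounded_opD(1)[OF sqrt_iter_lin] by blast
  have sub: "?B (Suc n) x - ?B n x \<in> M"
    by (intro csubspace_ops[OF csubM] mem)
  have "?B (Suc (Suc n)) x - ?B (Suc n) x = (1/2) *\<^sub>R (?B (Suc n) (?B (Suc n) x) - ?B n (?B n x))"
    by (simp add: sqrt_iter.simps(2)[of C "Suc n"] sqrt_iter.simps(2)[of C n x] scaleR_diff_right del: sqrt_iter.simps(2))
  also have "?B (Suc n) (?B (Suc n) x) - ?B n (?B n x)
     = (?B (Suc n) (?B (Suc n) x) - ?B n (?B (Suc n) x)) + ?B n (?B (Suc n) x - ?B n x)"
    using bounded_op_diff[OF csubM sqrt_iter_lin mem mem, of n "Suc n" n]
    by (simp del: sqrt_iter.simps)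
  finally have "norm (?B (Suc (Suc n)) x - ?B (Suc n) x) = (1/2) * norm \<dots>"
    by simp
  also have "norm ((?B (Suc n) (?B (Suc n) x) - ?B n (?B (Suc n) x)) + ?B n (?B (Suc n) x - ?B n x))
     \<le> (?t (Suc n) - ?t n) * (?t (Suc n) * norm x) + ?t n * ((?t (Suc n) - ?t n) * norm x)"
  proof (rule norm_triangle_mono)
    have "norm (?B (Suc n) (?B (Suc n) x) - ?B n (?B (Suc n) x)) \<le> (?t (Suc n) - ?t n) * norm (?B (Suc n) x)"
      by (rule Suc.IH[OF mem])
    also have "\<dots> \<le> (?t (Suc n) - ?t n) * (?t (Suc n) * norm x)"
      using sqrt_bound_incseq by (intro mult_left_mono sqrt_iter_norm Suc.prems) (simp add: incseq_SucD del: sqrt_bound.simps)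
    finally show "norm (?B (Suc n) (?B (Suc n) x) - ?B n (?B (Suc n) x)) \<le> (?t (Suc n) - ?t n) * (?t (Suc n) * norm x)" .
    have "norm (?B n (?B (Suc n) x - ?B n x)) \<le> ?t n * norm (?B (Suc n) x - ?B n x)"
      by (rule sqrt_iter_norm[OF sub])
    also have "\<dots> \<le> ?t n * ((?t (Suc n) - ?t n) * norm x)"
      using sqrt_bound_range Suc by (intro mult_left_mono) auto
    finally show "norm (?B n (?B (Suc n) x - ?B n x)) \<le> ?t n * ((?t (Suc n) - ?t n) * norm x)" .
  qed
  also have "(1/2) * \<dots> = (?t (Suc (Suc n)) - ?t (Suc n)) * norm x"
    unfolding sqrt_bound.simps(2)[of "Suc n"] sqrt_bound.simps(2)[of n]
    by (simp add: field_simps power2_eq_square)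
  finally show ?case by simp
qed

lemma sqrt_iter_diff:
  assumes "x \<in> M" "m \<le> n"
  shows "norm (sqrt_iter C n x - sqrt_iter C m x) \<le> (sqrt_bound n - sqrt_bound m) * norm x"
  using \<open>m \<le> n\<close>
proof (induction rule: dec_induct)
  case (step k)
  have "norm (sqrt_iter C (Suc k) x - sqrt_iter C m x)
    \<le> norm (sqrt_iter C (Suc k) x - sqrt_iter C k x) + norm (sqrt_iter C k x - sqrt_iter C m x)"
    using norm_triangle_ineq[of "sqrt_iter C (Suc k) x - sqrt_iter C k x" "sqrt_iter C k x - sqrt_iter C m x"]
    by (simp del: sqrt_iter.simps)
  also have "\<dots> \<le> (sqrt_bound (Suc k) - sqrt_bound k) * norm x + (sqrt_bound k - sqrt_bound m) * norm x"
    by (intro add_mono sqrt_iter_increment assms step)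
  finally show ?case by (simp add: algebra_simps del: sqrt_iter.simps sqrt_bound.simps)
qed simp

lemma sqrt_iter_Cauchy:
  assumes "x \<in> M" shows "Cauchy (\<lambda>n. sqrt_iter C n x)"
proof (rule metric_CauchyI)
  fix e :: real assume "e > 0"
  define d where "d = e / (norm x + 1)"
  have "d > 0" unfolding d_def using \<open>e > 0\<close> by (simp add: add_nonneg_pos)
  then obtain N where N: "\<And>m n. m \<ge> N \<Longrightarrow> n \<ge> N \<Longrightarrow> dist (sqrt_bound m) (sqrt_bound n) < d"
    using metric_CauchyD[OF sqrt_bound_Cauchy] by metis
  have main: "dist (sqrt_iter C n x) (sqrt_iter C m x) < e" if "N \<le> m" "m \<le> n" for m n
  proof -
    have "norm (sqrt_iter C n x - sqrt_iter C m x) \<le> (sqrt_bound n - sqrt_bound m) * norm x"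
      using sqrt_iter_diff assms that by blast
    also have "\<dots> \<le> d * norm x"
      using N[of n m] that by (intro mult_right_mono) (auto simp: dist_real_def)
    also have "\<dots> < d * (norm x + 1)" using \<open>d > 0\<close> by simp
    also have "\<dots> = e" unfolding d_def using norm_ge_zero[of x] by (simp add: add_nonneg_eq_0_iff)
    finally show ?thesis by (simp add: dist_norm)
  qed
  show "\<exists>N. \<forall>m\<ge>N. \<forall>n\<ge>N. dist (sqrt_iter C m x) (sqrt_iter C n x) < e"
  proof (intro exI allI impI)
    fix m n assume "N \<le> m" "N \<le> n"
    then show "dist (sqrt_iter C m x) (sqrt_iter C n x) < e"
      using main[of m n] main[of n m] by (cases "m \<le> n") (auto simp: dist_commute)
  qed
qed

definition sqrt_lim :: "'a \<Rightarrow> 'a" where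
  "sqrt_lim x = lim (\<lambda>n. sqrt_iter C n x)"

lemma sqrt_lim: "x \<in> M \<Longrightarrow> (\<lambda>n. sqrt_iter C n x) \<longlonglongrightarrow> sqrt_lim x"
  unfolding sqrt_lim_def using Cauchy_convergent[OF sqrt_iter_Cauchy] convergent_LIMSEQ_iff by blast

lemma sqrt_lim_in: "x \<in> M \<Longrightarrow> sqrt_lim x \<in> M"
  by (rule closed_sequentially[OF closed_csubspaceD(2)[OF M] _ sqrt_lim]) (rule bounded_opD(1)[OF sqrt_iter_lin])

lemma sqrt_lim_norm:
  assumes "x \<in> M" shows "norm (sqrt_lim x) \<le> norm x"
proof (rule LIMSEQ_le_const2)
  show "(\<lambda>n. norm (sqrt_iter C n x)) \<longlonglongrightarrow> norm (sqrt_lim x)" by (intro tendsto_intros sqrt_lim assms)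
  have "norm (sqrt_iter C n x) \<le> norm x" for n
    using sqrt_iter_norm[OF assms, of n] sqrt_bound_range[of n] mult_left_le_one_le[of "norm x" "sqrt_bound n"] by simp
  then show "\<exists>N. \<forall>n\<ge>N. norm (sqrt_iter C n x) \<le> norm x" by blast
qed

lemma sqrt_lim_sym: "sym_op M sqrt_lim"
proof -
  note sub = csubM
  have "sqrt_lim (x + y) = sqrt_lim x + sqrt_lim y" if "x \<in> M" "y \<in> M" for x y
    using sqrt_lim[of "x + y"] tendsto_add[OF sqrt_lim sqrt_lim, of x y] that csubspace_ops(1)[OF sub]
    by (simp add: bounded_opD(2)[OF sqrt_iter_lin] LIMSEQ_unique)
  moreover have "sqrt_lim (c *\<^sub>C x) = c *\<^sub>C sqrt_lim x" if "x \<in> M" for c x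
    using sqrt_lim[of "c *\<^sub>C x"] tendsto_scaleC[OF sqrt_lim, of x c] that csubspace_ops(3)[OF sub]
    by (simp add: bounded_opD(3)[OF sqrt_iter_lin] LIMSEQ_unique)
  moreover have "cinner (sqrt_lim x) y = cinner x (sqrt_lim y)" if "x \<in> M" "y \<in> M" for x y
    using tendsto_cinner[OF sqrt_lim tendsto_const, of x y] tendsto_cinner[OF tendsto_const sqrt_lim, of y x] that
    by (simp add: sym_opD(2)[OF sqrt_iter_sym] LIMSEQ_unique)
  ultimately show ?thesis
    unfolding sym_op_def
    by (auto simp: sqrt_lim_in sqrt_lim_norm intro!: bounded_opI[where C = 1])
qed

text \<open>In \<open>sqrt_iter C n (sqrt_iter C n x)\<close> both the operator and its argument
  move; since the iterates are contractions, the change of argument costs no more than its own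
  norm.\<close>

lemma sqrt_lim_fixpoint:
  assumes "x \<in> M"
  shows "sqrt_lim x = (1/2) *\<^sub>R C x + (1/2) *\<^sub>R sqrt_lim (sqrt_lim x)"
proof -
  let ?B = "sqrt_iter C"
  have lim0: "(\<lambda>n. norm (?B n x - sqrt_lim x) + norm (?B n (sqrt_lim x) - sqrt_lim (sqrt_lim x))) \<longlonglongrightarrow> 0"
    using sqrt_lim[OF assms] sqrt_lim[OF sqrt_lim_in[OF assms]]
    by (intro tendsto_add_zero tendsto_norm_zero LIM_zero)
  have "(\<lambda>n. ?B n (?B n x) - sqrt_lim (sqrt_lim x)) \<longlonglongrightarrow> 0"
  proof (rule Lim_null_comparison[OF _ lim0])
    have "norm (?B n (?B n x) - sqrt_lim (sqrt_lim x))
      \<le> norm (?B n x - sqrt_lim x) + norm (?B n (sqrt_lim x) - sqrt_lim (sqrt_lim x))" for n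
    proof -
      have mem: "?B n x \<in> M" using assms bounded_opD(1)[OF sqrt_iter_lin] by blast
      have mem2: "?B n x - sqrt_lim x \<in> M"
        by (intro csubspace_ops[OF csubM] mem sqrt_lim_in assms)
      have e: "?B n (?B n x) - sqrt_lim (sqrt_lim x)
        = ?B n (?B n x - sqrt_lim x) + (?B n (sqrt_lim x) - sqrt_lim (sqrt_lim x))"
        using bounded_op_diff[OF csubM sqrt_iter_lin mem sqrt_lim_in[OF assms], of n] by simp
      have "norm (?B n (?B n x - sqrt_lim x)) \<le> norm (?B n x - sqrt_lim x)"
        using sqrt_iter_norm[OF mem2, of n] sqrt_bound_range[of n]
          mult_left_le_one_le[of "norm (?B n x - sqrt_lim x)" "sqrt_bound n"] by simp
      moreover have "norm (?B n (?B n x) - sqrt_lim (sqrt_lim x))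
        \<le> norm (?B n (?B n x - sqrt_lim x)) + norm (?B n (sqrt_lim x) - sqrt_lim (sqrt_lim x))"
        unfolding e by (rule norm_triangle_ineq)
      ultimately show ?thesis by linarith
    qed
    then show "\<forall>\<^sub>F n in sequentially. norm (?B n (?B n x) - sqrt_lim (sqrt_lim x))
      \<le> norm (?B n x - sqrt_lim x) + norm (?B n (sqrt_lim x) - sqrt_lim (sqrt_lim x))" by simp
  qed
  then have "(\<lambda>n. ?B n (?B n x)) \<longlonglongrightarrow> sqrt_lim (sqrt_lim x)" by (rule LIM_zero_cancel)
  then have "(\<lambda>n. ?B (Suc n) x) \<longlonglongrightarrow> (1/2) *\<^sub>R C x + (1/2) *\<^sub>R sqrt_lim (sqrt_lim x)"
    unfolding sqrt_iter.simps by (intro tendsto_intros)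
  moreover have "(\<lambda>n. ?B (Suc n) x) \<longlonglongrightarrow> sqrt_lim x"
    by (rule LIMSEQ_Suc) (rule sqrt_lim[OF assms])
  ultimately show ?thesis by (intro LIMSEQ_unique)
qed

text \<open>The iterates are polynomials in \<open>C\<close>, so they commute with whatever commutes
  with \<open>C\<close>. Uniqueness of the positive root rests on this.\<close>

lemma sqrt_lim_commute:
  assumes T: "bounded_op M M T" and comm: "\<And>x. x \<in> M \<Longrightarrow> T (C x) = C (T x)" and x: "x \<in> M"
  shows "T (sqrt_lim x) = sqrt_lim (T x)"
proof -
  have iter: "T (sqrt_iter C n x) = sqrt_iter C n (T x)" if "x \<in> M" for n x
    using that
  proof (induction n arbitrary: x)
    case (Suc n)
    have mem: "C x \<in> M" "sqrt_iter C n x \<in> M" "sqrt_iter C n (sqrt_iter C n x) \<in> M"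
      using Suc.prems bounded_opD(1)[OF sqrt_iter_lin] bounded_opD(1)[OF sym_opD(1)[OF C]] by blast+
    then show ?case
      using csubspace_ops(4)[OF csubM] comm[OF Suc.prems] Suc.IH[OF Suc.prems] Suc.IH[OF mem(2)]
      by (simp add: bounded_opD(2)[OF T] bounded_op_scaleR[OF T])
  qed (simp add: bounded_op_0[OF csubM T])
  have "(\<lambda>n. T (sqrt_iter C n x)) \<longlonglongrightarrow> T (sqrt_lim x)"
    using bounded_opD(1)[OF sqrt_iter_lin x]
    by (intro bounded_op_tendsto[OF csubM T] sqrt_lim sqrt_lim_in x)
  moreover have "(\<lambda>n. sqrt_iter C n (T x)) \<longlonglongrightarrow> sqrt_lim (T x)"
    using bounded_opD(1)[OF T x] by (rule sqrt_lim)
  ultimately show ?thesis unfolding iter[OF x] by (rule LIMSEQ_unique)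
qed

end

text \<open>Dividing by a norm bound \<open>c\<close> brings \<open>Q\<close> into the range of the
  iteration: C = 1 - Q/c lies between 0 and 1, and the root is sqrt c (1 - B). The commutation
  clause is carried along for the proof of uniqueness.\<close>

lemma positive_sqrt_exists:
  fixes M :: "'a::chilbert_space set"
  assumes M: "closed_csubspace M" and Q: "positive_op M Q"
  shows "\<exists>S. positive_op M S \<and> (\<forall>x\<in>M. S (S x) = Q x) \<and>
    (\<forall>T. bounded_op M M T \<longrightarrow> (\<forall>x\<in>M. T (Q x) = Q (T x)) \<longrightarrow> (\<forall>x\<in>M. T (S x) = S (T x)))"
proof -
  note sub = closed_csubspaceD(1)[OF M]
  have sQ: "sym_op M Q" and pQ: "\<And>x. x \<in> M \<Longrightarrow> 0 \<le> Re (cinner (Q x) x)"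
    using Q positive_op_iff[OF sub] by auto
  obtain c where c: "c > 0" "\<And>x. x \<in> M \<Longrightarrow> norm (Q x) \<le> c * norm x"
    using bounded_op_bound[OF sym_opD(1)[OF sQ]] by blast
  define C where "C = (\<lambda>x. 1 *\<^sub>R x + (- 1 / c) *\<^sub>R Q x)"
  have sC: "sym_op M C" unfolding C_def by (intro sym_op_combine sub sym_op_id sQ)
  have CR: "Re (cinner (C x) x) = (norm x)\<^sup>2 - Re (cinner (Q x) x) / c" for x
    by (simp add: C_def cinner_simps Re_cinner_self)
  have "positive_op M C"
    unfolding positive_op_iff[OF sub]
  proof (intro conjI ballI sC)
    fix x assume "x \<in> M"
    then have "Re (cinner (Q x) x) \<le> c * (norm x)\<^sup>2" by (intro positive_op_Re_le[OF sub Q] c)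
    then show "0 \<le> Re (cinner (C x) x)" using c(1) unfolding CR by (simp add: field_simps)
  qed
  then have nC: "norm (C x) \<le> norm x" if "x \<in> M" for x
    using positive_op_norm_le[OF sub, of C 1 x] that pQ c(1) unfolding CR by simp
  define B where "B = sqrt_lim C"
  have sB: "sym_op M B" unfolding B_def by (rule sqrt_lim_sym[OF M sC nC])
  note linB = sym_opD(1)[OF sB]
  have fixB: "B x = (1/2) *\<^sub>R C x + (1/2) *\<^sub>R B (B x)" if "x \<in> M" for x
    unfolding B_def by (rule sqrt_lim_fixpoint[OF M sC nC that])
  define S where "S = (\<lambda>x. sqrt c *\<^sub>R x + (- sqrt c) *\<^sub>R B x)"
  have sS: "sym_op M S" unfolding S_def by (intro sym_op_combine sub sym_op_id sB)
  have S_eq: "S x = sqrt c *\<^sub>R (x - B x)" for x by (simp add: S_def algebra_simps)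
  have BM: "B x \<in> M" if "x \<in> M" for x using bounded_opD(1)[OF linB that] .
  have "positive_op M S"
    unfolding positive_op_iff[OF sub]
  proof (intro conjI ballI sS)
    fix x assume x: "x \<in> M"
    have "Re (cinner (B x) x) \<le> norm (B x) * norm x" using Re_cinner_le[of "B x" x] by linarith
    also have "\<dots> \<le> norm x * norm x"
      using sqrt_lim_norm[OF M sC nC x] unfolding B_def by (intro mult_right_mono) auto
    finally have "Re (cinner (B x) x) \<le> (norm x)\<^sup>2" by (simp add: power2_eq_square)
    then show "0 \<le> Re (cinner (S x) x)"
      using c(1) by (simp add: S_eq cinner_simps Re_cinner_self)
  qed
  moreover have "S (S x) = Q x" if x: "x \<in> M" for x
  proof -
    have xB: "x - B x \<in> M" by (intro csubspace_ops[OF sub] x BM)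
    have "S (S x) = sqrt c *\<^sub>R sqrt c *\<^sub>R ((x - B x) - B (x - B x))"
      using bounded_op_scaleR[OF linB xB] by (simp add: S_eq algebra_simps)
    also have "\<dots> = c *\<^sub>R (x - B x - B x + B (B x))"
      using bounded_op_diff[OF sub linB x BM[OF x]] c(1) by simp
    also have "x - B x - B x + B (B x) = x - 2 *\<^sub>R B x + B (B x)" by (simp add: scaleR_2)
    also have "\<dots> = x - C x" using arg_cong[OF fixB[OF x], of "\<lambda>y. 2 *\<^sub>R y"] by (simp add: algebra_simps)
    also have "c *\<^sub>R (x - C x) = Q x" using c(1) by (simp add: C_def)
    finally show ?thesis .
  qed
  moreover have "T (S x) = S (T x)"
    if T: "bounded_op M M T" and comm: "\<forall>x\<in>M. T (Q x) = Q (T x)" and x: "x \<in> M" for T x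
  proof -
    have "T (C y) = C (T y)" if "y \<in> M" for y
    proof -
      have "Q y \<in> M" using bounded_opD(1)[OF sym_opD(1)[OF sQ] that] .
      then show ?thesis
        using that comm csubspace_ops(4)[OF sub] unfolding C_def
        by (simp add: bounded_opD(2)[OF T] bounded_op_scaleR[OF T] bounded_op_diff[OF sub T])
    qed
    then have "T (B x) = B (T x)" unfolding B_def by (intro sqrt_lim_commute[OF M sC nC T _ x])
    moreover have "x - B x \<in> M" by (intro csubspace_ops[OF sub] x BM)
    ultimately show ?thesis
      by (simp add: S_eq bounded_op_scaleR[OF T] bounded_op_diff[OF sub T x BM[OF x]])
  qed
  ultimately show ?thesis by blast
qed

text \<open>For commuting roots (R + S)(R - S) = 0. Positivity forces both \<open>R\<close> and
  \<open>S\<close> to vanish at y = (R - S) x, so \<open>y\<close> is orthogonal to their ranges and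
  therefore to itself.\<close>

lemma positive_sqrt_unique:
  fixes M :: "'a::chilbert_space set"
  assumes M: "closed_csubspace M" and R: "positive_op M R" and S: "positive_op M S"
    and eq: "\<And>x. x \<in> M \<Longrightarrow> R (R x) = S (S x)"
    and comm: "\<And>x. x \<in> M \<Longrightarrow> R (S x) = S (R x)" and x: "x \<in> M"
  shows "R x = S x"
proof -
  note sub = closed_csubspaceD(1)[OF M]
  have R': "sym_op M R" "\<And>x. x \<in> M \<Longrightarrow> 0 \<le> Re (cinner (R x) x)"
    and S': "sym_op M S" "\<And>x. x \<in> M \<Longrightarrow> 0 \<le> Re (cinner (S x) x)"
    using R S positive_op_iff[OF sub] by auto
  note linR = sym_opD(1)[OF R'(1)] and linS = sym_opD(1)[OF S'(1)]
  have RM: "R z \<in> M" and SM: "S z \<in> M" if "z \<in> M" for z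
    using bounded_opD(1)[OF linR that] bounded_opD(1)[OF linS that] by auto
  define y where "y = R x - S x"
  have y: "y \<in> M" unfolding y_def by (intro csubspace_ops[OF sub] RM SM x)
  have "R y + S y = 0"
    unfolding y_def using x RM SM
    by (simp add: bounded_op_diff[OF sub linR] bounded_op_diff[OF sub linS] eq comm)
  then have "cinner (R y) y + cinner (S y) y = 0" by (metis cinner_add_left cinner_zero_left)
  then have "Re (cinner (R y) y) + Re (cinner (S y) y) = 0" by (metis plus_complex.sel(1) zero_complex.sel(1))
  then have "R y = 0" "S y = 0"
    using positive_op_ker[OF sub R y] positive_op_ker[OF sub S y] R'(2)[OF y] S'(2)[OF y] by linarith+
  then have "cinner y (R x) = 0" "cinner y (S x) = 0"
    using sym_opD(2)[OF R'(1) y x] sym_opD(2)[OF S'(1) y x] by auto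
  then have "cinner y y = 0" by (subst (2) y_def) (simp add: cinner_diff_right)
  then show ?thesis by (simp add: y_def)
qed

text \<open>Any positive root commutes with its square \<open>Q\<close>, hence with the constructed
  root \<open>R\<close>, so uniqueness among commuting roots is enough. Restricting \<open>R\<close>
  to \<open>M\<close> meets the extensionality condition.\<close>

lemma sqrt_op_properties:
  fixes M :: "'a::chilbert_space set"
  assumes M: "closed_csubspace M" and Q: "positive_op M Q"
  shows "positive_op M (sqrt_op M Q)" "x \<in> M \<Longrightarrow> sqrt_op M Q (sqrt_op M Q x) = Q x"
proof -
  obtain R where R: "positive_op M R" "\<forall>x\<in>M. R (R x) = Q x"
    "\<And>T. bounded_op M M T \<Longrightarrow> \<forall>x\<in>M. T (Q x) = Q (T x) \<Longrightarrow> \<forall>x\<in>M. T (R x) = R (T x)"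
    using positive_sqrt_exists[OF M Q] by blast
  let ?R = "restrict R M"
  have RM: "R x \<in> M" if "x \<in> M" for x using R(1) that bounded_opD(1) unfolding positive_op_def by blast
  note sub = closed_csubspaceD(1)[OF M]
  have "positive_op M ?R"
    using R(1) csubspace_ops[OF sub] unfolding positive_op_def bounded_op_def by (auto simp: Pi_def)
  then have 1: "?R \<in> extensional M \<and> positive_op M ?R \<and> (\<forall>x\<in>M. ?R (?R x) = Q x)"
    using R(2) RM by auto
  have "S = ?R" if S: "S \<in> extensional M \<and> positive_op M S \<and> (\<forall>x\<in>M. S (S x) = Q x)" for S
  proof (rule extensionalityI[of _ M])
    fix x assume x: "x \<in> M"
    have pS: "positive_op M S" and lin: "bounded_op M M S" using S by (auto simp: positive_op_def)
    have "\<forall>x\<in>M. S (Q x) = Q (S x)" using S bounded_opD(1)[OF lin] by metis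
    then have "R (S x) = S (R x)" if "x \<in> M" for x using R(3)[OF lin] that by auto
    then have "R x = S x" using R S by (intro positive_sqrt_unique[OF M R(1) pS _ _ x]) auto
    then show "S x = ?R x" using x by simp
  qed (use S in auto)
  then have "sqrt_op M Q = ?R" unfolding sqrt_op_def using 1 by (intro the_equality) blast+
  with 1 show "positive_op M (sqrt_op M Q)" "x \<in> M \<Longrightarrow> sqrt_op M Q (sqrt_op M Q x) = Q x" by auto
qed

section \<open>The modulus of a positive operator restricted to a closed subspace\<close>

context
  fixes M :: "'a::chilbert_space set" and P :: "'a \<Rightarrow> 'a"
  assumes M: "closed_csubspace M" and P: "positive_op UNIV P"
begin

text \<open>The adjoint of the restriction, as an operator from \<open>M\<close> into the whole
  space, is \<open>P\<close> followed by the projection onto \<open>M\<close>.\<close>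

lemma abs_op_eq_sqrt: "abs_op M P = sqrt_op M (\<lambda>x. orth_proj M (P (P x)))"
proof -
  have sP: "sym_op UNIV P" using P positive_op_iff[OF complex_vector.subspace_UNIV] by auto
  have "adjoint_op M P y = orth_proj M (P y)" for y
    unfolding adjoint_op_def
  proof (rule the_equality)
    show "orth_proj M (P y) \<in> M \<and> (\<forall>z\<in>M. cinner (P z) y = cinner z (orth_proj M (P y)))"
      using sym_opD(2)[OF sP] by (auto simp: orth_proj_in[OF M] cinner_orth_proj_right[OF M])
    fix x assume x: "x \<in> M \<and> (\<forall>z\<in>M. cinner (P z) y = cinner z x)"
    have "cinner (P y - x) z = 0" if "z \<in> M" for z
    proof -
      have "cinner z (P y) = cinner z x" using x that sym_opD(2)[OF sP, of z y] by auto
      then have "cinner z (P y - x) = 0" by (simp add: cinner_diff_right)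
      then show ?thesis using cinner_zero_commute by blast
    qed
    then show "x = orth_proj M (P y)"
      using x orth_proj_eqI[OF closed_csubspaceD(1)[OF M]] by metis
  qed
  then show ?thesis by (simp add: abs_op_def)
qed

lemma positive_op_compression_square: "positive_op M (\<lambda>x. orth_proj M (P (P x)))"
proof -
  have sP: "sym_op UNIV P" using P positive_op_iff[OF complex_vector.subspace_UNIV] by auto
  have "bounded_op M M (\<lambda>x. orth_proj M (P (P x)))"
    by (rule bounded_op_comp[OF bounded_op_orth_proj[OF M]],
        rule bounded_op_mono[OF sym_opD(1)[OF sym_op_square[OF sP]]]) auto
  moreover have "cinner (orth_proj M (P (P x))) x = complex_of_real ((norm (P x))\<^sup>2)" if "x \<in> M" for x
    using sym_opD(2)[OF sP, of "P x" x] by (simp add: cinner_orth_proj_left[OF M that] cinner_self)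
  ultimately show ?thesis by (auto simp: positive_op_def)
qed

lemma abs_op_positive: "positive_op M (abs_op M P)"
  unfolding abs_op_eq_sqrt by (rule sqrt_op_properties(1)[OF M positive_op_compression_square])

lemma abs_op_square: "x \<in> M \<Longrightarrow> abs_op M P (abs_op M P x) = orth_proj M (P (P x))"
  unfolding abs_op_eq_sqrt by (rule sqrt_op_properties(2)[OF M positive_op_compression_square])

text \<open>The link between the s-numbers, defined by the modulus, and the vectors
  \<open>P x\<close> in the norming condition: questions of attainment may be settled for either
  operator.\<close>

lemma norm_abs_op:
  assumes x: "x \<in> M" shows "norm (abs_op M P x) = norm (P x)"
proof -
  have sP: "sym_op UNIV P" using P positive_op_iff[OF complex_vector.subspace_UNIV] by auto
  have sA: "sym_op M (abs_op M P)" using abs_op_positive positive_op_sym closed_csubspaceD(1)[OF M] by blast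
  have "abs_op M P x \<in> M" using bounded_opD(1)[OF sym_opD(1)[OF sA] x] .
  then have "cinner (abs_op M P x) (abs_op M P x) = cinner (abs_op M P (abs_op M P x)) x"
    using sym_opD(2)[OF sA] x by simp
  also have "\<dots> = cinner (P x) (P x)"
    using sym_opD(2)[OF sP, of "P x" x] by (simp add: abs_op_square[OF x] cinner_orth_proj_left[OF M x])
  finally have "(norm (abs_op M P x))\<^sup>2 = (norm (P x))\<^sup>2" by (metis Re_cinner_self)
  then show ?thesis by simp
qed

end

section \<open>Orthonormal families and dimension\<close>

definition orthonormal :: "'i set \<Rightarrow> ('i \<Rightarrow> 'a::complex_inner) \<Rightarrow> bool" where
  "orthonormal I x \<longleftrightarrow> (\<forall>i\<in>I. \<forall>j\<in>I. cinner (x i) (x j) = (if i = j then 1 else 0))"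

lemma orthonormalD: "orthonormal I x \<Longrightarrow> i \<in> I \<Longrightarrow> j \<in> I \<Longrightarrow> cinner (x i) (x j) = (if i = j then 1 else 0)"
  by (simp add: orthonormal_def)

lemma orthonormal_subset: "orthonormal I x \<Longrightarrow> J \<subseteq> I \<Longrightarrow> orthonormal J x"
  unfolding orthonormal_def by blast

lemma orthonormal_norm: "orthonormal I x \<Longrightarrow> i \<in> I \<Longrightarrow> norm (x i) = 1"
  using orthonormalD[of I x i i] Re_cinner_self[of "x i"] norm_ge_zero[of "x i"]
  by (simp add: power2_eq_1_iff)

lemma cinner_unit: "norm x = 1 \<Longrightarrow> cinner x x = 1"
  by (simp add: cinner_self)

lemma cinner_orthonormal_sum:
  assumes "orthonormal I x" "finite I" "i \<in> I"
  shows "cinner (\<Sum>j\<in>I. c j *\<^sub>C x j) (x i) = c i"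
proof -
  have "cinner (\<Sum>j\<in>I. c j *\<^sub>C x j) (x i) = (\<Sum>j\<in>I. if j = i then c j else 0)"
    unfolding cinner_sum_left
    by (intro sum.cong) (auto simp: cinner_scaleC_left orthonormalD[OF assms(1) _ assms(3)])
  then show ?thesis using assms by simp
qed

lemma orthonormal_inj: "orthonormal I x \<Longrightarrow> inj_on x I"
  by (rule inj_onI) (metis orthonormal_def zero_neq_one)

lemma orthonormal_independent:
  assumes x: "orthonormal I x"
  shows "complex_vector.independent (x ` I)"
  unfolding complex_vector.dependent_def
proof (safe)
  fix i assume i: "i \<in> I" and span: "x i \<in> cspan (x ` I - {x i})"
  have "cinner (x i) (x i) = 0"
  proof (rule cinner_zero_span[OF span])
    fix s assume "s \<in> x ` I - {x i}"
    then show "cinner s (x i) = 0" using orthonormalD[OF x _ i] by auto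
  qed
  then show False using orthonormalD[OF x i i] by simp
qed

lemma orthonormal_snoc:
  assumes "orthonormal {..<n} x" "norm v = 1" "\<And>i. i < n \<Longrightarrow> cinner v (x i) = 0"
  shows "orthonormal {..<Suc n} (x(n := v))"
  using assms cinner_unit[of v]
  by (auto simp: orthonormal_def less_Suc_eq cinner_zero_commute[of _ v])

text \<open>One Gram-Schmidt step, applied to a vector of \<open>V\<close> outside the span.\<close>

lemma orthonormal_extend:
  assumes V: "csubspace V" and x: "orthonormal {..<n::nat} x" "x ` {..<n} \<subseteq> V"
    and nspan: "\<not> V \<subseteq> cspan (x ` {..<n})"
  shows "\<exists>v\<in>V. norm v = 1 \<and> (\<forall>i<n. cinner v (x i) = 0)"
proof -
  obtain w where w: "w \<in> V" "w \<notin> cspan (x ` {..<n})" using nspan by blast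
  define s where "s = (\<Sum>i<n. cinner w (x i) *\<^sub>C x i)"
  define u where "u = w - s"
  have "s \<in> cspan (x ` {..<n})"
    unfolding s_def by (intro complex_vector.span_sum complex_vector.span_scale complex_vector.span_base) auto
  then have "u \<noteq> 0" using w by (auto simp: u_def)
  have "s \<in> V"
    unfolding s_def using x by (intro complex_vector.subspace_sum[OF V] csubspace_ops(3)[OF V]) auto
  then have "u \<in> V" unfolding u_def by (intro csubspace_ops(2)[OF V] w)
  have "cinner u (x i) = 0" if "i < n" for i
    using cinner_orthonormal_sum[OF x(1), of i "\<lambda>i. cinner w (x i)"] that
    by (simp add: u_def s_def cinner_diff_left)
  then have "cinner ((1 / norm u) *\<^sub>R u) (x i) = 0" if "i < n" for i
    using that by (simp add: cinner_scaleR_left)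
  moreover have "norm ((1 / norm u) *\<^sub>R u) = 1" using \<open>u \<noteq> 0\<close> by simp
  ultimately show ?thesis using csubspace_ops(4)[OF V \<open>u \<in> V\<close>] by blast
qed

lemma orthonormal_or_spanning:
  assumes V: "csubspace V"
  shows "\<exists>m\<le>n::nat. \<exists>x. orthonormal {..<m} x \<and> x ` {..<m} \<subseteq> V \<and>
    (m = n \<or> V \<subseteq> cspan (x ` {..<m}))"
proof (induction n)
  case 0
  show ?case by (auto simp: orthonormal_def)
next
  case (Suc n)
  then obtain m x where mx: "m \<le> n" "orthonormal {..<m} x" "x ` {..<m} \<subseteq> V"
    "m = n \<or> V \<subseteq> cspan (x ` {..<m})" by blast
  show ?case
  proof (cases "V \<subseteq> cspan (x ` {..<m})")
    case True
    then show ?thesis using mx by (intro exI[of _ m]) auto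
  next
    case False
    then have "m = n" using mx by blast
    obtain v where v: "v \<in> V" "norm v = 1" "\<forall>i<m. cinner v (x i) = 0"
      using orthonormal_extend[OF V mx(2,3) False] by blast
    have "orthonormal {..<Suc m} (x(m := v))" using v by (intro orthonormal_snoc mx(2)) auto
    moreover have "(x(m := v)) ` {..<Suc m} \<subseteq> V" using v(1) mx(3) by (auto simp: less_Suc_eq)
    ultimately show ?thesis unfolding \<open>m = n\<close> by blast
  qed
qed

lemma cdim_le_card:
  assumes "finite B" "V \<subseteq> cspan B"
  shows "cdim V \<le> enat (card B)"
  using assms complex_vector.dim_le_card by (auto simp: cdim_def)

lemma cdim_finite_span: "cdim V \<noteq> \<infinity> \<Longrightarrow> \<exists>B. finite B \<and> V \<subseteq> cspan B"
  unfolding cdim_def by (metis (no_types, lifting))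

text \<open>Turns dimension counts into the existence of finite orthonormal families. Quantifying
  over \<open>n\<close> treats finite and infinite dimension alike.\<close>

lemma le_cdim_iff:
  assumes V: "csubspace V"
  shows "enat n \<le> cdim V \<longleftrightarrow> (\<exists>x. orthonormal {..<n} x \<and> x ` {..<n} \<subseteq> V)"
proof
  assume n: "enat n \<le> cdim V"
  obtain m x where mx: "m \<le> n" "orthonormal {..<m} x" "x ` {..<m} \<subseteq> V"
    "m = n \<or> V \<subseteq> cspan (x ` {..<m})" using orthonormal_or_spanning[OF V] by blast
  have "m = n" if "V \<subseteq> cspan (x ` {..<m})"
  proof -
    have "enat n \<le> enat (card (x ` {..<m}))" using n cdim_le_card[OF _ that] by (meson finite_imageI finite_lessThan order_trans)
    then show ?thesis using card_image_le[of "{..<m}" x] \<open>m \<le> n\<close> by simp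
  qed
  then show "\<exists>x. orthonormal {..<n} x \<and> x ` {..<n} \<subseteq> V" using mx by blast
next
  assume "\<exists>x. orthonormal {..<n} x \<and> x ` {..<n} \<subseteq> V"
  then obtain x where x: "orthonormal {..<n} x" "x ` {..<n} \<subseteq> V" by blast
  show "enat n \<le> cdim V"
  proof (cases "cdim V = \<infinity>")
    case False
    then obtain B where B: "finite B" "V \<subseteq> cspan B" using cdim_finite_span by blast
    obtain C where C: "C \<subseteq> V" "complex_vector.independent C" "V \<subseteq> cspan C"
      "card C = complex_vector.dim V" using complex_vector.basis_exists by blast
    have "finite C" using complex_vector.independent_span_bound[OF B(1) C(2)] B(2) C(1) by blast
    moreover have "x ` {..<n} \<subseteq> cspan C" using x C by blast
    ultimately have "card (x ` {..<n}) \<le> card C"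
      using complex_vector.independent_span_bound[OF _ orthonormal_independent[OF x(1)]] by blast
    then have "n \<le> complex_vector.dim V" using card_image[OF orthonormal_inj[OF x(1)]] C(4) by simp
    then show ?thesis using B by (auto simp: cdim_def)
  qed simp
qed

lemma cdim_infinite_iff:
  "csubspace V \<Longrightarrow> cdim V = \<infinity> \<longleftrightarrow> (\<forall>n. enat n \<le> cdim V)"
  by (metis Suc_n_not_le_n enat.exhaust enat_ord_simps(1) enat_ord_simps(3))

lemma cdim_mono:
  assumes "csubspace V" "csubspace W" "V \<subseteq> W"
  shows "cdim V \<le> cdim W"
proof (cases "cdim V")
  case (enat n)
  then show ?thesis using le_cdim_iff[OF assms(1), of n] le_cdim_iff[OF assms(2), of n] assms(3) by auto
next
  case infinity
  then have "\<forall>n. enat n \<le> cdim W"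
    using le_cdim_iff[OF assms(1)] le_cdim_iff[OF assms(2)] assms(3) by (metis enat_ord_simps(3) subset_trans)
  then show ?thesis using cdim_infinite_iff[OF assms(2)] by simp
qed

lemma finite_cdim_basis:
  assumes V: "csubspace V" and d: "cdim V = enat d"
  obtains x where "orthonormal {..<d} x" "x ` {..<d} \<subseteq> V" "V \<subseteq> cspan (x ` {..<d})"
proof -
  obtain m x where mx: "m \<le> Suc d" "orthonormal {..<m} x" "x ` {..<m} \<subseteq> V"
    "m = Suc d \<or> V \<subseteq> cspan (x ` {..<m})" using orthonormal_or_spanning[OF V] by blast
  have "enat m \<le> enat d" using le_cdim_iff[OF V, of m] mx d by auto
  then have s: "V \<subseteq> cspan (x ` {..<m})" using mx by auto
  then have "enat d \<le> enat (card (x ` {..<m}))" using cdim_le_card[OF _ s] d by simp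
  then have "m = d" using \<open>enat m \<le> enat d\<close> card_image_le[of "{..<m}" x] by simp
  then show ?thesis using that mx s by blast
qed

text \<open>Additivity of dimension in a form that avoids subtraction of extended numbers and allows
  \<open>V\<close> to be infinite-dimensional. It serves both for the rank after an eigenspace is
  split off and for the space that is left.\<close>

lemma le_cdim_orth_sum_iff:
  assumes E: "csubspace E" "cdim E = enat m" and V: "csubspace V"
    and W: "csubspace W" and sub: "E \<subseteq> W" "V \<subseteq> W" and orth: "V \<subseteq> ortho E"
    and sum: "\<And>w. w \<in> W \<Longrightarrow> \<exists>e\<in>E. \<exists>v\<in>V. w = e + v"
  shows "enat (m + n) \<le> cdim W \<longleftrightarrow> enat n \<le> cdim V"
proof
  assume n: "enat n \<le> cdim V"
  obtain e where e: "orthonormal {..<m} e" "e ` {..<m} \<subseteq> E" "E \<subseteq> cspan (e ` {..<m})"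
    by (rule finite_cdim_basis[OF E])
  obtain v where v: "orthonormal {..<n} v" "v ` {..<n} \<subseteq> V" using n le_cdim_iff[OF V] by blast
  define x where "x i = (if i < m then e i else v (i - m))" for i
  have 1: "cinner (e i) (v j) = 0" "cinner (v j) (e i) = 0" if "i < m" "j < n" for i j
    using that e(2) v(2) orth orthoD by blast+
  have "orthonormal {..<m + n} x"
    using e(1) v(1) 1 by (auto simp: orthonormal_def x_def)
  moreover have "x ` {..<m + n} \<subseteq> W"
    using e(2) v(2) sub by (auto simp: x_def image_subset_iff)
  ultimately show "enat (m + n) \<le> cdim W" using le_cdim_iff[OF W] by blast
next
  assume mn: "enat (m + n) \<le> cdim W"
  show "enat n \<le> cdim V"
  proof (rule ccontr)
    assume "\<not> enat n \<le> cdim V"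
    then obtain d where d: "cdim V = enat d" "d < n" by (cases "cdim V") auto
    obtain e where e: "orthonormal {..<m} e" "e ` {..<m} \<subseteq> E" "E \<subseteq> cspan (e ` {..<m})"
      by (rule finite_cdim_basis[OF E])
    obtain v where v: "orthonormal {..<d} v" "v ` {..<d} \<subseteq> V" "V \<subseteq> cspan (v ` {..<d})"
      by (rule finite_cdim_basis[OF V d(1)])
    let ?B = "e ` {..<m} \<union> v ` {..<d}"
    have "W \<subseteq> cspan ?B"
    proof
      fix w assume "w \<in> W"
      then obtain a b where "a \<in> E" "b \<in> V" "w = a + b" using sum by blast
      then show "w \<in> cspan ?B"
        using e(3) v(3) complex_vector.span_mono[of "e ` {..<m}" ?B] complex_vector.span_mono[of "v ` {..<d}" ?B]
        by (auto intro!: complex_vector.span_add)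
    qed
    then have "cdim W \<le> enat (card ?B)" by (intro cdim_le_card) auto
    moreover have "card ?B \<le> m + d"
      using card_Un_le[of "e ` {..<m}" "v ` {..<d}"] card_image_le[of "{..<m}" e] card_image_le[of "{..<d}" v] by simp
    ultimately have "enat (m + n) \<le> enat (m + d)" using mn by (meson enat_ord_simps(1) order_trans)
    then show False using d by simp
  qed
qed

section \<open>Compactness in finite dimension\<close>

lemma bounded_linear_scaleC_left: "bounded_linear (\<lambda>c. c *\<^sub>C (x::'a::complex_inner))"
  by (intro bounded_linear_intro[where K = "norm x"])
     (auto simp: scaleC_add_left norm_scaleC scaleR_conv_of_real simp flip: scaleC_scaleC scaleC_of_real)

text \<open>A continuous image of a product of closed discs, built one coordinate at a time. Such
  sets replace closed balls in finite dimension and later approximate the image of the unit ball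
  under the compact part.\<close>

lemma compact_bounded_combinations:
  fixes x :: "nat \<Rightarrow> 'a::complex_inner"
  shows "compact {\<Sum>i<d. c i *\<^sub>C x i | c. \<forall>i<d. cmod (c i) \<le> C}"
proof (induction d)
  case (Suc d)
  let ?S = "\<lambda>d. {\<Sum>i<d. c i *\<^sub>C x i | c. \<forall>i<d. cmod (c i) \<le> C}"
  have "continuous_on (?S d \<times> cball 0 C) (\<lambda>p. fst p + snd p *\<^sub>C x d)"
    by (intro continuous_intros bounded_linear.continuous_on[OF bounded_linear_scaleC_left])
  then have "compact ((\<lambda>p. fst p + snd p *\<^sub>C x d) ` (?S d \<times> cball 0 C))"
    using Suc by (intro compact_continuous_image compact_Times) auto
  moreover have "(\<lambda>p. fst p + snd p *\<^sub>C x d) ` (?S d \<times> cball 0 C) = ?S (Suc d)"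
  proof (intro equalityI subsetI)
    fix y assume "y \<in> (\<lambda>p. fst p + snd p *\<^sub>C x d) ` (?S d \<times> cball 0 C)"
    then obtain c a where "\<forall>i<d. cmod (c i) \<le> C" "cmod a \<le> C" "y = (\<Sum>i<d. c i *\<^sub>C x i) + a *\<^sub>C x d"
      by auto
    then show "y \<in> ?S (Suc d)"
      by (intro CollectI exI[of _ "c(d := a)"]) (auto simp: less_Suc_eq)
  next
    fix y assume "y \<in> ?S (Suc d)"
    then obtain c where c: "\<forall>i<Suc d. cmod (c i) \<le> C" "y = (\<Sum>i<Suc d. c i *\<^sub>C x i)" by blast
    then have "((\<Sum>i<d. c i *\<^sub>C x i), c d) \<in> ?S d \<times> cball 0 C" by auto
    then show "y \<in> (\<lambda>p. fst p + snd p *\<^sub>C x d) ` (?S d \<times> cball 0 C)"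
      by (rule rev_image_eqI) (simp add: c)
  qed
  ultimately show ?case by simp
qed simp

lemma orthonormal_expansion:
  assumes x: "orthonormal I x" "finite I" and v: "v \<in> cspan (x ` I)"
  shows "v = (\<Sum>i\<in>I. cinner v (x i) *\<^sub>C x i)"
proof -
  let ?r = "v - (\<Sum>i\<in>I. cinner v (x i) *\<^sub>C x i)"
  have r: "?r \<in> cspan (x ` I)"
    by (intro complex_vector.span_diff v complex_vector.span_sum complex_vector.span_scale
        complex_vector.span_base) auto
  have "cinner ?r (x i) = 0" if "i \<in> I" for i
    using cinner_orthonormal_sum[OF x that, of "\<lambda>i. cinner v (x i)"] by (simp add: cinner_diff_left)
  then have "cinner ?r ?r = 0"
    by (intro cinner_zero_span[OF r]) (auto simp: cinner_zero_commute[of _ ?r])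
  then show ?thesis by simp
qed

lemma cmod_cinner_unit_le: "norm y = 1 \<Longrightarrow> cmod (cinner x y) \<le> 2 * norm x"
proof -
  assume "norm y = 1"
  have "cmod (cinner x y) \<le> \<bar>Re (cinner x y)\<bar> + \<bar>Im (cinner x y)\<bar>" by (rule cmod_le)
  also have "\<dots> \<le> norm x * norm y + norm x * norm (\<i> *\<^sub>C y)"
    unfolding Im_cinner by (intro add_mono Re_cinner_le)
  finally show ?thesis using \<open>norm y = 1\<close> by (simp add: norm_scaleC)
qed

lemma finite_cdim_ball_subset_compact:
  assumes V: "csubspace V" and fin: "cdim V \<noteq> \<infinity>"
  obtains S where "compact S" "S \<subseteq> V" "V \<inter> cball 0 C \<subseteq> S"
proof -
  obtain d where d: "cdim V = enat d" using fin by (cases "cdim V") auto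
  obtain x where x: "orthonormal {..<d} x" "x ` {..<d} \<subseteq> V" "V \<subseteq> cspan (x ` {..<d})"
    by (rule finite_cdim_basis[OF V d])
  let ?S = "{\<Sum>i<d. c i *\<^sub>C x i | c. \<forall>i<d. cmod (c i) \<le> 2 * C}"
  have a: "?S \<subseteq> V"
    using x(2) by (auto intro!: complex_vector.subspace_sum[OF V] csubspace_ops(3)[OF V])
  have "v \<in> ?S" if "v \<in> V" "norm v \<le> C" for v
  proof -
    have "v = (\<Sum>i<d. cinner v (x i) *\<^sub>C x i)" using orthonormal_expansion[OF x(1)] x(3) that by auto
    moreover have "cmod (cinner v (x i)) \<le> 2 * C" if "i < d" for i
      using cmod_cinner_unit_le[OF orthonormal_norm[OF x(1)], of i v] that \<open>norm v \<le> C\<close> by simp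
    ultimately show ?thesis by (intro CollectI exI[of _ "\<lambda>i. cinner v (x i)"]) simp
  qed
  then have b: "V \<inter> cball 0 C \<subseteq> ?S" by (intro subsetI) simp
  show ?thesis by (rule that[OF compact_bounded_combinations a b])
qed

lemma finite_cdim_convergent_subseq:
  assumes V: "csubspace V" and fin: "cdim V \<noteq> \<infinity>"
    and f: "\<And>n::nat. f n \<in> V" "\<And>n. norm (f n) \<le> C"
  shows "\<exists>l\<in>V. \<exists>r::nat\<Rightarrow>nat. strict_mono r \<and> (\<lambda>n. f (r n)) \<longlonglongrightarrow> l"
proof -
  obtain S where S: "compact S" "S \<subseteq> V" "V \<inter> cball 0 C \<subseteq> S"
    by (rule finite_cdim_ball_subset_compact[OF V fin])
  have "\<forall>n. f n \<in> S" using S(3) f by auto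
  then obtain l r where "l \<in> S" "strict_mono r" "(f \<circ> r) \<longlonglongrightarrow> l"
    using S(1) unfolding compact_def by blast
  then show ?thesis using S(2) by (auto simp: o_def)
qed

section \<open>Norm attainment and the spectrum\<close>

lemma closed_csubspace_limit:
  "closed_csubspace M \<Longrightarrow> (\<And>n::nat. x n \<in> M) \<Longrightarrow> x \<longlonglongrightarrow> l \<Longrightarrow> l \<in> M"
  by (rule closed_sequentially[OF closed_csubspaceD(2)])

lemma subspace_image:
  assumes M: "csubspace M" and A: "bounded_op M N A"
  shows "csubspace (A ` M)"
  unfolding complex_vector.subspace_def
proof (intro conjI ballI allI)
  show "0 \<in> A ` M" using bounded_op_0[OF M A] csubspace_ops(6)[OF M] by force
  show "u + v \<in> A ` M" if "u \<in> A ` M" "v \<in> A ` M" for u v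
    using that csubspace_ops(1)[OF M] by (auto simp flip: bounded_opD(2)[OF A])
  show "c *\<^sub>C u \<in> A ` M" if "u \<in> A ` M" for c u
    using that csubspace_ops(3)[OF M] by (auto simp flip: bounded_opD(3)[OF A])
qed

text \<open>The value \<open>norm (A x)\<close> at the unit vector is itself the bound, so no
  supremum appears. The trivial subspace, having no unit vector, never qualifies.\<close>

definition attains_norm :: "'a::complex_inner set \<Rightarrow> ('a \<Rightarrow> 'b::complex_inner) \<Rightarrow> bool" where
  "attains_norm M A \<longleftrightarrow> (\<exists>x\<in>M. norm x = 1 \<and> (\<forall>y\<in>M. norm (A y) \<le> norm (A x) * norm y))"

lemma attains_norm_cong: "(\<And>x. x \<in> M \<Longrightarrow> norm (A x) = norm (B x)) \<Longrightarrow> attains_norm M A \<longleftrightarrow> attains_norm M B"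
  by (auto simp: attains_norm_def)

lemma unit_vector_exists:
  assumes "csubspace M" "M \<noteq> {0}"
  shows "\<exists>x\<in>M. norm x = 1"
proof -
  obtain x where x: "x \<in> M" "x \<noteq> 0" using assms complex_vector.subspace_0 by blast
  then show ?thesis
    using csubspace_ops(4)[OF assms(1) x(1), of "1 / norm x"] by (intro bexI[of _ "(1 / norm x) *\<^sub>R x"]) auto
qed

lemma maximizing_sequence:
  assumes M: "csubspace M" "M \<noteq> {0}" and A: "bounded_op M N A"
  obtains \<mu> x where "\<And>n::nat. x n \<in> M" "\<And>n. norm (x n) = 1" "(\<lambda>n. norm (A (x n))) \<longlonglongrightarrow> \<mu>"
    "\<And>y. y \<in> M \<Longrightarrow> norm (A y) \<le> \<mu> * norm y" "0 \<le> \<mu>"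
proof -
  obtain C where C: "\<And>x. x \<in> M \<Longrightarrow> norm (A x) \<le> C * norm x" using bounded_op_bound[OF A] by blast
  define S where "S = (\<lambda>x. norm (A x)) ` {x \<in> M. norm x = 1}"
  have "bdd_above S" unfolding S_def using C by (intro bdd_aboveI2[of _ _ C]) fastforce
  have "S \<noteq> {}" unfolding S_def using unit_vector_exists[OF M] by blast
  define \<mu> where "\<mu> = Sup S"
  have "\<mu> \<in> closure S" unfolding \<mu>_def by (rule closure_contains_Sup[OF \<open>S \<noteq> {}\<close> \<open>bdd_above S\<close>])
  then obtain f where f: "\<And>n. f n \<in> S" "f \<longlonglongrightarrow> \<mu>" unfolding closure_sequential by blast
  have "\<exists>x. x \<in> M \<and> norm x = 1 \<and> norm (A x) = f n" for n using f(1)[of n] by (auto simp: S_def)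
  then obtain x where x: "\<And>n. x n \<in> M" "\<And>n. norm (x n) = 1" "\<And>n. norm (A (x n)) = f n" by metis
  have unit: "norm (A y) \<le> \<mu>" if "y \<in> M" "norm y = 1" for y
    unfolding \<mu>_def using that \<open>bdd_above S\<close> by (intro cSup_upper) (auto simp: S_def)
  have le: "norm (A y) \<le> \<mu> * norm y" if "y \<in> M" for y
  proof (cases "y = 0")
    case True then show ?thesis by (simp add: bounded_op_0[OF M(1) A])
  next
    case False
    then show ?thesis
      using unit[of "(1 / norm y) *\<^sub>R y"] csubspace_ops(4)[OF M(1) that] bounded_op_scaleR[OF A that]
      by (simp add: field_simps)
  qed
  have "(\<lambda>n. norm (A (x n))) \<longlonglongrightarrow> \<mu>" unfolding x(3) by (rule f(2))
  moreover have "0 \<le> \<mu>" using unit[OF x(1,2)] norm_ge_zero order_trans by blast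
  ultimately show ?thesis using that[of x \<mu>] x le by blast
qed

text \<open>By symmetry the cross term in the expansion is \<open>(norm (A x))\<^sup>2\<close>, so
  the defect is governed by how far \<open>x\<close> is from being a maximizer.\<close>

lemma sym_op_square_defect:
  assumes A: "sym_op M A" and \<mu>: "\<And>y. y \<in> M \<Longrightarrow> norm (A y) \<le> \<mu> * norm y" and x: "x \<in> M" "norm x = 1"
  shows "(norm (A (A x) - (\<mu>\<^sup>2) *\<^sub>R x))\<^sup>2 \<le> \<mu>\<^sup>2 * (\<mu>\<^sup>2 - (norm (A x))\<^sup>2)"
proof -
  have Ax: "A x \<in> M" using bounded_opD(1)[OF sym_opD(1)[OF A] x(1)] .
  have "Re (cinner (A (A x)) x) = (norm (A x))\<^sup>2"
    using sym_opD(2)[OF A Ax x(1)] by (simp add: Re_cinner_self)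
  then have "(norm (A (A x) - (\<mu>\<^sup>2) *\<^sub>R x))\<^sup>2 = (norm (A (A x)))\<^sup>2 - 2 * \<mu>\<^sup>2 * (norm (A x))\<^sup>2 + \<mu>\<^sup>2 * \<mu>\<^sup>2"
    using x(2) by (simp add: norm_diff_sq cinner_scaleR_right power_mult_distrib power2_eq_square[of "\<mu>\<^sup>2"])
  moreover have "(norm (A (A x)))\<^sup>2 \<le> \<mu>\<^sup>2 * (norm (A x))\<^sup>2"
    using power_mono[OF \<mu>[OF Ax], of 2] by (simp add: power_mult_distrib)
  ultimately show ?thesis by (simp add: algebra_simps)
qed

lemma approximate_eigenvector_square:
  assumes A: "sym_op M A" and \<mu>: "\<And>y. y \<in> M \<Longrightarrow> norm (A y) \<le> \<mu> * norm y"
    and x: "\<And>n::nat. x n \<in> M" "\<And>n. norm (x n) = 1" "(\<lambda>n. norm (A (x n))) \<longlonglongrightarrow> \<mu>"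
  shows "(\<lambda>n. A (A (x n)) - (\<mu>\<^sup>2) *\<^sub>R x n) \<longlonglongrightarrow> 0"
proof -
  have "(\<lambda>n. \<mu>\<^sup>2 * (\<mu>\<^sup>2 - (norm (A (x n)))\<^sup>2)) \<longlonglongrightarrow> \<mu>\<^sup>2 * (\<mu>\<^sup>2 - \<mu>\<^sup>2)"
    by (intro tendsto_intros x)
  then have lim: "(\<lambda>n. sqrt (\<mu>\<^sup>2 * (\<mu>\<^sup>2 - (norm (A (x n)))\<^sup>2))) \<longlonglongrightarrow> 0"
    using tendsto_real_sqrt by fastforce
  have "norm (A (A (x n)) - (\<mu>\<^sup>2) *\<^sub>R x n) \<le> sqrt (\<mu>\<^sup>2 * (\<mu>\<^sup>2 - (norm (A (x n)))\<^sup>2))" for n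
    by (rule real_le_rsqrt) (rule sym_op_square_defect[OF A \<mu> x(1,2)])
  then show ?thesis by (intro Lim_null_comparison[OF _ lim] always_eventually allI)
qed

text \<open>A maximizer satisfies A^2 x = \<nu>^2 x with \<nu> the norm of \<open>A x\<close>. Then
  y = (A - \<nu>) x satisfies A y = - \<nu> y, which positivity permits only if \<nu> or
  \<open>y\<close> is zero.\<close>

lemma attains_norm_eigenvector:
  assumes M: "csubspace M" and A: "positive_op M A"
    and x: "x \<in> M" "norm x = 1" and max: "\<And>y. y \<in> M \<Longrightarrow> norm (A y) \<le> norm (A x) * norm y"
  shows "A x = norm (A x) *\<^sub>R x"
proof -
  let ?\<nu> = "norm (A x)"
  have s: "sym_op M A" and p: "\<And>x. x \<in> M \<Longrightarrow> 0 \<le> Re (cinner (A x) x)"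
    using A positive_op_iff[OF M] by auto
  have Ax: "A x \<in> M" using bounded_opD(1)[OF sym_opD(1)[OF s] x(1)] .
  have AAx: "A (A x) = (?\<nu>\<^sup>2) *\<^sub>R x" using sym_op_square_defect[OF s max x] by simp
  define y where "y = A x - ?\<nu> *\<^sub>R x"
  have \<nu>x: "?\<nu> *\<^sub>R x \<in> M" by (intro csubspace_ops[OF M] x)
  have y: "y \<in> M" unfolding y_def by (intro csubspace_ops[OF M] Ax \<nu>x)
  have "A y = - ?\<nu> *\<^sub>R y"
    unfolding y_def bounded_op_diff[OF M sym_opD(1)[OF s] Ax \<nu>x] bounded_op_scaleR[OF sym_opD(1)[OF s] x(1)] AAx
    by (simp add: algebra_simps power2_eq_square)
  then have "0 \<le> - ?\<nu> * (norm y)\<^sup>2" using p[OF y] by (simp add: Re_cinner_self cinner_scaleR_left)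
  then have "?\<nu> = 0 \<or> y = 0"
    by (metis less_eq_real_def mult_minus_left neg_0_le_iff_le mult_nonneg_nonneg norm_ge_zero zero_le_power2
        antisym mult_eq_0_iff power_eq_0_iff norm_eq_zero)
  then show ?thesis by (auto simp: y_def)
qed

text \<open>For a maximizing sequence (A^2 - \<mu>^2) x_n tends to 0. If (A^2 - \<beta>) x_n
  converges along a subsequence with \<beta> different from \<mu>^2, subtraction makes x_n itself
  converge there, and the limit is a maximizer. Non-attainment is offered as a premise so that
  degenerate cases can be dismissed.\<close>

lemma attains_norm_if_subsequence:
  assumes M: "closed_csubspace M" "M \<noteq> {0}" and A: "sym_op M A"
    and sub: "\<And>\<mu> x. (\<And>y. y \<in> M \<Longrightarrow> norm (A y) \<le> \<mu> * norm y) \<Longrightarrow> (\<And>n::nat. x n \<in> M) \<Longrightarrow>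
      (\<And>n. norm (x n) = 1) \<Longrightarrow> (\<lambda>n. norm (A (x n))) \<longlonglongrightarrow> \<mu> \<Longrightarrow> \<not> attains_norm M A \<Longrightarrow>
      \<exists>\<beta> l r. \<beta> \<noteq> \<mu>\<^sup>2 \<and> strict_mono (r::nat\<Rightarrow>nat) \<and> (\<lambda>n. A (A (x (r n))) - \<beta> *\<^sub>R x (r n)) \<longlonglongrightarrow> l"
  shows "attains_norm M A"
proof (rule ccontr)
  assume not: "\<not> attains_norm M A"
  note csub = closed_csubspaceD(1)[OF M(1)]
  obtain \<mu> x where x: "\<And>n::nat. x n \<in> M" "\<And>n. norm (x n) = 1" "(\<lambda>n. norm (A (x n))) \<longlonglongrightarrow> \<mu>"
    and \<mu>: "\<And>y. y \<in> M \<Longrightarrow> norm (A y) \<le> \<mu> * norm y" "0 \<le> \<mu>"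
    by (rule maximizing_sequence[OF csub M(2) sym_opD(1)[OF A]]) (rule that)
  obtain \<beta> l r where r: "\<beta> \<noteq> \<mu>\<^sup>2" "strict_mono (r::nat\<Rightarrow>nat)" "(\<lambda>n. A (A (x (r n))) - \<beta> *\<^sub>R x (r n)) \<longlonglongrightarrow> l"
    using sub[OF \<mu>(1) x not] by blast
  have "(\<lambda>n. A (A (x n)) - (\<mu>\<^sup>2) *\<^sub>R x n) \<longlonglongrightarrow> 0"
    by (rule approximate_eigenvector_square[OF A \<mu>(1) x])
  from LIMSEQ_subseq_LIMSEQ[OF this r(2)]
  have "(\<lambda>n. A (A (x (r n))) - (\<mu>\<^sup>2) *\<^sub>R x (r n)) \<longlonglongrightarrow> 0" by (simp add: o_def)
  from tendsto_diff[OF r(3) this]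
  have "(\<lambda>n. (1 / (\<mu>\<^sup>2 - \<beta>)) *\<^sub>R ((\<mu>\<^sup>2 - \<beta>) *\<^sub>R x (r n))) \<longlonglongrightarrow> (1 / (\<mu>\<^sup>2 - \<beta>)) *\<^sub>R l"
    by (intro tendsto_intros) (simp add: algebra_simps)
  then obtain l' where l': "(\<lambda>n. x (r n)) \<longlonglongrightarrow> l'" using r(1) by auto
  then have "l' \<in> M" by (intro closed_csubspace_limit[OF M(1) x(1)])
  have "(\<lambda>n. norm (x (r n))) \<longlonglongrightarrow> norm l'" by (intro tendsto_intros l')
  then have "norm l' = 1" using x(2) LIMSEQ_unique[OF tendsto_const] by fastforce
  have "(\<lambda>n. norm (A (x (r n)))) \<longlonglongrightarrow> norm (A l')"
    by (intro tendsto_norm bounded_op_tendsto[OF csub sym_opD(1)[OF A]] x \<open>l' \<in> M\<close> l')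
  moreover have "(\<lambda>n. norm (A (x (r n)))) \<longlonglongrightarrow> \<mu>"
    using LIMSEQ_subseq_LIMSEQ[OF x(3) r(2)] by (simp add: o_def)
  ultimately have "norm (A l') = \<mu>" by (rule LIMSEQ_unique)
  then show False using not \<mu>(1) \<open>l' \<in> M\<close> \<open>norm l' = 1\<close> unfolding attains_norm_def by blast
qed

text \<open>If \<open>M\<close> is finite-dimensional, the maximizing sequence has a convergent
  subsequence and \<beta> = \<mu>^2 + 1 merely differs from \<mu>^2. If the range is
  finite-dimensional, the images converge and \<beta> = 0 works, as \<mu> = 0 would make every unit
  vector a maximizer.\<close>

lemma attains_norm_finite_rank:
  assumes M: "closed_csubspace M" "M \<noteq> {0}" and A: "sym_op M A" and fin: "cdim M \<noteq> \<infinity> \<or> cdim (A ` M) \<noteq> \<infinity>"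
  shows "attains_norm M A"
proof (rule attains_norm_if_subsequence[OF M A])
  fix \<mu> and x :: "nat \<Rightarrow> 'a"
  assume \<mu>: "\<And>y. y \<in> M \<Longrightarrow> norm (A y) \<le> \<mu> * norm y" and x: "\<And>n. x n \<in> M" "\<And>n. norm (x n) = 1"
    and not: "\<not> attains_norm M A"
  note csub = closed_csubspaceD(1)[OF M(1)]
  note linA = sym_opD(1)[OF A]
  have AM: "A y \<in> M" if "y \<in> M" for y using bounded_opD(1)[OF linA that] .
  show "\<exists>\<beta> l r. \<beta> \<noteq> \<mu>\<^sup>2 \<and> strict_mono (r::nat\<Rightarrow>nat) \<and> (\<lambda>n. A (A (x (r n))) - \<beta> *\<^sub>R x (r n)) \<longlonglongrightarrow> l"
  proof (cases "cdim M = \<infinity>")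
    case False
    have "\<exists>l\<in>M. \<exists>r::nat\<Rightarrow>nat. strict_mono r \<and> (\<lambda>n. x (r n)) \<longlonglongrightarrow> l"
      using x by (intro finite_cdim_convergent_subseq[OF csub False, of x 1]) auto
    then obtain l r where lr: "l \<in> M" "strict_mono (r::nat\<Rightarrow>nat)" "(\<lambda>n. x (r n)) \<longlonglongrightarrow> l" by blast
    have "(\<lambda>n. A (A (x (r n))) - (\<mu>\<^sup>2 + 1) *\<^sub>R x (r n)) \<longlonglongrightarrow> A (A l) - (\<mu>\<^sup>2 + 1) *\<^sub>R l"
      by (intro tendsto_intros bounded_op_tendsto[OF csub linA] AM x lr)
    then show ?thesis using lr(2) by (intro exI[of _ "\<mu>\<^sup>2 + 1"]) auto
  next
    case True
    then have fin': "cdim (A ` M) \<noteq> \<infinity>" using fin by blast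
    have sA: "csubspace (A ` M)" by (rule subspace_image[OF csub linA])
    have "\<mu> \<noteq> 0"
    proof
      assume "\<mu> = 0"
      then have "attains_norm M A"
        using \<mu> x(1)[of 0] x(2)[of 0] unfolding attains_norm_def by (intro bexI[of _ "x 0"]) fastforce+
      then show False using not by blast
    qed
    have "\<exists>l\<in>A ` M. \<exists>r::nat\<Rightarrow>nat. strict_mono r \<and> (\<lambda>n. A (x (r n))) \<longlonglongrightarrow> l"
    proof (rule finite_cdim_convergent_subseq[OF sA fin'])
      show "norm (A (x n)) \<le> \<mu>" for n using \<mu>[OF x(1), of n] x(2) by simp
    qed (use x in auto)
    then obtain l r where lr: "l \<in> A ` M" "strict_mono (r::nat\<Rightarrow>nat)" "(\<lambda>n. A (x (r n))) \<longlonglongrightarrow> l" by blast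
    have "l \<in> M" using lr(1) AM by blast
    have "(\<lambda>n. A (A (x (r n))) - 0 *\<^sub>R x (r n)) \<longlonglongrightarrow> A l"
      unfolding scaleR_zero_left diff_zero
      by (intro bounded_op_tendsto[OF csub linA] AM x lr \<open>l \<in> M\<close>)
    then show ?thesis using lr(2) \<open>\<mu> \<noteq> 0\<close> by (intro exI[of _ 0] exI[of _ "A l"] exI[of _ r]) simp
  qed
qed

section \<open>Points inside and outside the spectrum of a symmetric operator\<close>

lemma spectrum_opI:
  assumes M: "csubspace M" and x: "\<And>n::nat. x n \<in> M" "\<And>n. norm (x n) = 1"
    and lim: "(\<lambda>n. A (x n) - z *\<^sub>C x n) \<longlonglongrightarrow> 0" and A: "bounded_op M M A"
  shows "z \<in> spectrum_op M A"
  unfolding spectrum_op_def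
proof (intro CollectI notI)
  assume "\<exists>B. bounded_op M M B \<and> (\<forall>x\<in>M. B (A x - z *\<^sub>C x) = x \<and> A (B x) - z *\<^sub>C B x = x)"
  then obtain B where B: "bounded_op M M B" "\<And>x. x \<in> M \<Longrightarrow> B (A x - z *\<^sub>C x) = x" by blast
  have "A (x n) - z *\<^sub>C x n \<in> M" for n
    by (intro csubspace_ops[OF M] x bounded_opD(1)[OF A])
  then have "(\<lambda>n. B (A (x n) - z *\<^sub>C x n)) \<longlonglongrightarrow> B 0"
    using lim csubspace_ops(6)[OF M] by (intro bounded_op_tendsto[OF M B(1)])
  then have "x \<longlonglongrightarrow> 0" using B(2)[OF x(1)] bounded_op_0[OF M B(1)] by simp
  from tendsto_norm[OF this] show False using x(2) LIMSEQ_unique[OF tendsto_const, of "1::real" 0] by simp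
qed

lemma eigenvalue_in_spectrum:
  assumes "csubspace M" "bounded_op M M A" "x \<in> M" "norm x = 1" "A x = z *\<^sub>C x"
  shows "z \<in> spectrum_op M A"
  by (rule spectrum_opI[of M "\<lambda>_. x"]) (use assms in auto)

text \<open>Normality of A - z for symmetric \<open>A\<close>: a lower bound for A - z also rules
  out a kernel of its adjoint.\<close>

lemma sym_op_norm_cnj:
  assumes A: "sym_op M A" and x: "x \<in> M"
  shows "norm (A x - cnj z *\<^sub>C x) = norm (A x - z *\<^sub>C x)"
proof -
  have "Re (cinner (A x) (w *\<^sub>C x)) = Re w * Re (cinner (A x) x)" for w
    using sym_op_Im[OF A x] by (simp add: cinner_scaleC_right)
  then have "(norm (A x - w *\<^sub>C x))\<^sup>2 = (norm (A x))\<^sup>2 - 2 * Re w * Re (cinner (A x) x) + (cmod w * norm x)\<^sup>2" for w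
    by (simp add: norm_diff_sq norm_scaleC)
  then have "(norm (A x - cnj z *\<^sub>C x))\<^sup>2 = (norm (A x - z *\<^sub>C x))\<^sup>2" by simp
  then show ?thesis by (simp add: power2_eq_iff_nonneg)
qed

text \<open>A lower bound makes A - z injective with closed range. A vector of \<open>M\<close>
  orthogonal to the range lies in the kernel of the adjoint, which is trivial by the same bound, so
  the range is all of \<open>M\<close>.\<close>

lemma not_in_spectrum_if_bounded_below:
  fixes M :: "'a::chilbert_space set"
  assumes M: "closed_csubspace M" and A: "sym_op M A" and "c > 0"
    and below: "\<And>x. x \<in> M \<Longrightarrow> c * norm x \<le> norm (A x - z *\<^sub>C x)"
  shows "z \<notin> spectrum_op M A"
proof -
  note csub = closed_csubspaceD(1)[OF M]
  note linA = sym_opD(1)[OF A]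
  define G where "G = (\<lambda>x. A x - z *\<^sub>C x)"
  have AM: "A x \<in> M" if "x \<in> M" for x using bounded_opD(1)[OF linA that] .
  have GM: "G x \<in> M" if "x \<in> M" for x unfolding G_def by (intro csubspace_ops[OF csub] AM that)
  have G_add: "G (x + y) = G x + G y" if "x \<in> M" "y \<in> M" for x y
    unfolding G_def using that by (simp add: bounded_opD(2)[OF linA] scaleC_add_right)
  have G_scale: "G (a *\<^sub>C x) = a *\<^sub>C G x" if "x \<in> M" for a x
    unfolding G_def using that
    by (simp add: bounded_opD(3)[OF linA] complex_vector.scale_right_diff_distrib scaleC_scaleC mult.commute)
  obtain C where C: "C > 0" "\<And>x. x \<in> M \<Longrightarrow> norm (A x) \<le> C * norm x" using bounded_op_bound[OF linA] by blast
  have G: "bounded_op M M G"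
  proof (rule bounded_opI)
    fix x assume "x \<in> M"
    then show "norm (G x) \<le> (C + cmod z) * norm x"
      unfolding G_def using C(2)[of x] norm_triangle_ineq4[of "A x" "z *\<^sub>C x"] by (simp add: norm_scaleC algebra_simps)
  qed (use GM G_add G_scale in auto)
  have G_diff: "G (x - y) = G x - G y" if "x \<in> M" "y \<in> M" for x y
    using bounded_op_diff[OF csub G] that .
  have below': "c * norm x \<le> norm (G x)" if "x \<in> M" for x using below[OF that] by (simp add: G_def)
  have inj: "x = y" if "x \<in> M" "y \<in> M" "G x = G y" for x y
    using below'[OF csubspace_ops(2)[OF csub that(1,2)]] G_diff that \<open>c > 0\<close>
    by (simp add: mult_le_0_iff)
  have "closed (G ` M)"
    unfolding closed_sequential_limits
  proof (intro allI impI)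
    fix y l assume "(\<forall>n. y n \<in> G ` M) \<and> y \<longlonglongrightarrow> l"
    then have lim: "y \<longlonglongrightarrow> l" and "\<forall>n. \<exists>x. x \<in> M \<and> y n = G x" by auto
    then obtain x where x: "\<And>n. x n \<in> M" "\<And>n. y n = G (x n)" by metis
    have "Cauchy x"
    proof (rule metric_CauchyI)
      fix e :: real assume "e > 0"
      then obtain N where N: "\<And>m n. m \<ge> N \<Longrightarrow> n \<ge> N \<Longrightarrow> dist (y m) (y n) < c * e"
        using metric_CauchyD[OF LIMSEQ_imp_Cauchy[OF lim], of "c * e"] \<open>c > 0\<close> by auto
      have "dist (x m) (x n) < e" if "m \<ge> N" "n \<ge> N" for m n
      proof -
        have "c * norm (x m - x n) \<le> norm (y m - y n)"
          using below'[OF csubspace_ops(2)[OF csub x(1) x(1)]] G_diff[OF x(1) x(1)] x(2) by metis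
        then have "c * norm (x m - x n) < c * e" using N[OF that] by (simp add: dist_norm)
        then show ?thesis using \<open>c > 0\<close> by (simp add: dist_norm)
      qed
      then show "\<exists>N. \<forall>m\<ge>N. \<forall>n\<ge>N. dist (x m) (x n) < e" by blast
    qed
    then obtain k where k: "x \<longlonglongrightarrow> k" using Cauchy_convergent convergent_def by blast
    then have "k \<in> M" by (intro closed_csubspace_limit[OF M x(1)])
    have "(\<lambda>n. G (x n)) \<longlonglongrightarrow> G k" by (intro bounded_op_tendsto[OF csub G] x k \<open>k \<in> M\<close>)
    moreover have "(\<lambda>n. G (x n)) \<longlonglongrightarrow> l" using lim by (simp flip: x(2))
    ultimately have "l = G k" using LIMSEQ_unique by blast
    then show "l \<in> G ` M" using \<open>k \<in> M\<close> by blast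
  qed
  moreover have "csubspace (G ` M)" by (rule subspace_image[OF csub G])
  ultimately have cR: "closed_csubspace (G ` M)" by (simp add: closed_csubspace_def)
  have surj: "y \<in> G ` M" if y: "y \<in> M" for y
  proof -
    define v where "v = y - orth_proj (G ` M) y"
    have "G ` M \<subseteq> M" using GM by auto
    then have pM: "orth_proj (G ` M) y \<in> M" by (rule subsetD) (rule orth_proj_in[OF cR])
    have v: "v \<in> M" unfolding v_def by (intro csubspace_ops[OF csub] y pM)
    define w where "w = A v - cnj z *\<^sub>C v"
    have w: "w \<in> M" unfolding w_def by (intro csubspace_ops[OF csub] AM v)
    have "cinner w w = cinner v (A w) - cinner v (z *\<^sub>C w)"
      using sym_opD(2)[OF A v w] by (subst (1) w_def) (simp add: cinner_diff_left cinner_scaleC_left cinner_scaleC_right)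
    also have "\<dots> = cinner v (G w)" by (simp add: G_def cinner_diff_right)
    also have "\<dots> = 0" unfolding v_def by (rule orth_proj_orth[OF cR]) (use w in blast)
    finally have "A v - cnj z *\<^sub>C v = 0" by (simp add: w_def)
    then have "norm (A v - z *\<^sub>C v) = 0" using sym_op_norm_cnj[OF A v] by (metis norm_zero)
    then have "v = 0" using below[OF v] \<open>c > 0\<close> by (simp add: mult_le_0_iff)
    then show ?thesis using orth_proj_in[OF cR, of y] by (simp add: v_def)
  qed
  define B where "B = inv_into M G"
  have BM: "B y \<in> M" and GB: "G (B y) = y" if "y \<in> M" for y
    unfolding B_def using surj[OF that] inv_into_into f_inv_into_f by metis+
  have BG: "B (G x) = x" if "x \<in> M" for x by (rule inj) (auto simp: BM GB GM that)
  have "bounded_op M M B"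
  proof (rule bounded_opI)
    show "B (x + y) = B x + B y" if "x \<in> M" "y \<in> M" for x y
      by (rule inj) (use that csubspace_ops(1)[OF csub] in \<open>auto simp: BM GB G_add\<close>)
    show "B (a *\<^sub>C x) = a *\<^sub>C B x" if "x \<in> M" for a x
      by (rule inj) (use that csubspace_ops(3)[OF csub] in \<open>auto simp: BM GB G_scale\<close>)
    show "norm (B x) \<le> (1 / c) * norm x" if "x \<in> M" for x
      using below'[OF BM[OF that]] GB[OF that] \<open>c > 0\<close> by (simp add: field_simps)
  qed (rule BM)
  then show ?thesis unfolding spectrum_op_def using BG GB by (auto simp: G_def)
qed

lemma spectrum_bound:
  fixes M :: "'a::chilbert_space set"
  assumes M: "closed_csubspace M" and A: "sym_op M A" and \<mu>: "\<And>y. y \<in> M \<Longrightarrow> norm (A y) \<le> \<mu> * norm y"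
    and z: "z \<in> spectrum_op M A"
  shows "cmod z \<le> \<mu>"
proof (rule ccontr)
  assume "\<not> cmod z \<le> \<mu>"
  then have "cmod z - \<mu> > 0" by simp
  moreover have "(cmod z - \<mu>) * norm x \<le> norm (A x - z *\<^sub>C x)" if "x \<in> M" for x
    using \<mu>[OF that] norm_triangle_ineq2[of "z *\<^sub>C x" "A x"] by (simp add: norm_scaleC norm_minus_commute algebra_simps)
  ultimately show False using not_in_spectrum_if_bounded_below[OF M A] z by blast
qed

lemma sup_spectrum_eq:
  fixes M :: "'a::chilbert_space set"
  assumes M: "closed_csubspace M" and A: "sym_op M A" and \<mu>: "\<And>y. y \<in> M \<Longrightarrow> norm (A y) \<le> \<mu> * norm y"
    and "complex_of_real \<mu> \<in> spectrum_op M A"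
  shows "sup_spectrum_op M A = \<mu>"
  unfolding sup_spectrum_op_def
proof (rule cSup_eq_maximum)
  fix r assume "r \<in> {r. complex_of_real r \<in> spectrum_op M A}"
  then show "r \<le> \<mu>" using spectrum_bound[OF M A \<mu>] by fastforce
qed (use assms in auto)

lemma minimizing_sequence:
  assumes M: "csubspace M" "M \<noteq> {0}" and A: "bounded_op M N A"
  obtains c x where "\<And>n::nat. x n \<in> M" "\<And>n. norm (x n) = 1" "(\<lambda>n. norm (A (x n))) \<longlonglongrightarrow> c"
    "\<And>y. y \<in> M \<Longrightarrow> c * norm y \<le> norm (A y)" "0 \<le> c"
proof -
  define S where "S = (\<lambda>x. norm (A x)) ` {x \<in> M. norm x = 1}"
  have "bdd_below S" unfolding S_def by (intro bdd_belowI2[of _ 0]) simp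
  have "S \<noteq> {}" unfolding S_def using unit_vector_exists[OF M] by blast
  define c where "c = Inf S"
  have "c \<in> closure S" unfolding c_def by (rule closure_contains_Inf[OF \<open>S \<noteq> {}\<close> \<open>bdd_below S\<close>])
  then obtain f where f: "\<And>n. f n \<in> S" "f \<longlonglongrightarrow> c" unfolding closure_sequential by blast
  have "\<exists>x. x \<in> M \<and> norm x = 1 \<and> norm (A x) = f n" for n using f(1)[of n] by (auto simp: S_def)
  then obtain x where x: "\<And>n. x n \<in> M" "\<And>n. norm (x n) = 1" "\<And>n. norm (A (x n)) = f n" by metis
  have unit: "c \<le> norm (A y)" if "y \<in> M" "norm y = 1" for y
    unfolding c_def using that \<open>bdd_below S\<close> by (intro cInf_lower) (auto simp: S_def)
  have le: "c * norm y \<le> norm (A y)" if "y \<in> M" for y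
  proof (cases "y = 0")
    case False
    then show ?thesis
      using unit[of "(1 / norm y) *\<^sub>R y"] csubspace_ops(4)[OF M(1) that] bounded_op_scaleR[OF A that]
      by (simp add: field_simps)
  qed simp
  have "(\<lambda>n. norm (A (x n))) \<longlonglongrightarrow> c" unfolding x(3) by (rule f(2))
  moreover have "0 \<le> c"
    unfolding c_def using \<open>S \<noteq> {}\<close> by (intro cInf_greatest) (auto simp: S_def)
  ultimately show ?thesis using that[of x c] x le by blast
qed

lemma bounded_below_if_not_in_spectrum:
  assumes "z \<notin> spectrum_op M A" and M: "csubspace M" and A: "bounded_op M M A"
  obtains k where "k > 0" "\<And>x. x \<in> M \<Longrightarrow> k * norm x \<le> norm (A x - z *\<^sub>C x)"
proof -
  obtain B where B: "bounded_op M M B" "\<And>x. x \<in> M \<Longrightarrow> B (A x - z *\<^sub>C x) = x"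
    using assms(1) unfolding spectrum_op_def by blast
  obtain C where C: "C > 0" "\<And>x. x \<in> M \<Longrightarrow> norm (B x) \<le> C * norm x"
    by (rule bounded_op_bound[OF B(1)]) (rule that)
  have "(1 / C) * norm x \<le> norm (A x - z *\<^sub>C x)" if x: "x \<in> M" for x
  proof -
    have "A x - z *\<^sub>C x \<in> M" by (intro csubspace_ops[OF M] bounded_opD(1)[OF A] x)
    then show ?thesis using C(2)[of "A x - z *\<^sub>C x"] B(2)[OF x] C(1) by (simp add: field_simps)
  qed
  then show ?thesis using that[of "1 / C"] C(1) by simp
qed

text \<open>Distance to the spectrum bounds \<open>A - t\<close> from below: if \<open>c\<close> is the best lower bound, then \<open>c\<^sup>2\<close> is an
approximate eigenvalue of \<open>(A - t)\<^sup>2\<close>, so \<open>t + c\<close> or \<open>t - c\<close> is in the spectrum.\<close>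

lemma spectral_gap:
  assumes M: "closed_csubspace M" and A: "sym_op M A"
    and gap: "\<And>s. \<bar>s - t\<bar> < \<delta> \<Longrightarrow> complex_of_real s \<notin> spectrum_op M A" and v: "v \<in> M"
  shows "\<delta> * norm v \<le> norm (A v - t *\<^sub>R v)"
proof (cases "M = {0}")
  case True
  then show ?thesis using v by simp
next
  case False
  note csub = closed_csubspaceD(1)[OF M]
  note linA = sym_opD(1)[OF A]
  define G where "G = (\<lambda>x. 1 *\<^sub>R A x + (- t) *\<^sub>R x)"
  have G_eq: "G y = A y - t *\<^sub>R y" for y by (simp add: G_def)
  have G: "sym_op M G" unfolding G_def by (rule sym_op_combine[OF csub A sym_op_id])
  note linG = sym_opD(1)[OF G]
  have GM: "G y \<in> M" if "y \<in> M" for y using bounded_opD(1)[OF linG that] .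
  obtain c x where xs: "\<And>n::nat. x n \<in> M" "\<And>n. norm (x n) = 1" "(\<lambda>n. norm (G (x n))) \<longlonglongrightarrow> c"
    and c: "\<And>y. y \<in> M \<Longrightarrow> c * norm y \<le> norm (G y)" "0 \<le> c"
    by (rule minimizing_sequence[OF csub False linG]) (rule that)
  have "\<delta> \<le> c"
  proof (rule ccontr)
    assume "\<not> \<delta> \<le> c"
    then have ns: "complex_of_real (t + c) \<notin> spectrum_op M A" "complex_of_real (t - c) \<notin> spectrum_op M A"
      using gap[of "t + c"] gap[of "t - c"] \<open>0 \<le> c\<close> by auto
    obtain k1 where k1: "k1 > 0" "\<And>x. x \<in> M \<Longrightarrow> k1 * norm x \<le> norm (A x - complex_of_real (t + c) *\<^sub>C x)"
      by (rule bounded_below_if_not_in_spectrum[OF ns(1) csub linA]) (rule that)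
    obtain k2 where k2: "k2 > 0" "\<And>x. x \<in> M \<Longrightarrow> k2 * norm x \<le> norm (A x - complex_of_real (t - c) *\<^sub>C x)"
      by (rule bounded_below_if_not_in_spectrum[OF ns(2) csub linA]) (rule that)
    \<comment> \<open>\<open>H\<close> factors as (G + c)(G - c), with lower bounds
      \<open>k2\<close> and \<open>k1\<close> for the factors, so \<open>H (x n)\<close> stays away
      from 0. But \<open>H\<close> is positive and its form tends to 0 along the sequence, which the
      inequality H^2 \<le> C H forbids.\<close>
    define H where "H = (\<lambda>x. 1 *\<^sub>R G (G x) + (- (c\<^sup>2)) *\<^sub>R x)"
    have sH: "sym_op M H" unfolding H_def by (rule sym_op_combine[OF csub sym_op_square[OF G] sym_op_id])
    have ReH: "Re (cinner (H y) y) = (norm (G y))\<^sup>2 - c\<^sup>2 * (norm y)\<^sup>2" if "y \<in> M" for y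
      using sym_opD(2)[OF G GM[OF that] that] by (simp add: H_def cinner_diff_left cinner_scaleR_left Re_cinner_self)
    have "positive_op M H"
      unfolding positive_op_iff[OF csub]
    proof (intro conjI ballI sH)
      fix y assume y: "y \<in> M"
      have "(c * norm y)\<^sup>2 \<le> (norm (G y))\<^sup>2" using c y by (intro power_mono) auto
      then show "0 \<le> Re (cinner (H y) y)" unfolding ReH[OF y] by (simp add: power_mult_distrib)
    qed
    obtain C where C: "C > 0" "\<And>x. x \<in> M \<Longrightarrow> norm (H x) \<le> C * norm x"
      by (rule bounded_op_bound[OF sym_opD(1)[OF sH]]) (rule that)
    have low: "k1 * k2 \<le> norm (H (x n))" for n
    proof -
      define y where "y = G (x n) - c *\<^sub>R x n"
      have cx: "c *\<^sub>R x n \<in> M" by (intro csubspace_ops[OF csub] xs)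
      have y: "y \<in> M" unfolding y_def by (intro csubspace_ops[OF csub] GM xs cx)
      have "k2 * norm y \<le> norm (G y + c *\<^sub>R y)"
        using k2(2)[OF y] unfolding scaleC_of_real G_eq by (simp add: algebra_simps)
      moreover have "G y + c *\<^sub>R y = H (x n)"
        unfolding y_def bounded_op_diff[OF csub linG GM[OF xs(1)] cx] bounded_op_scaleR[OF linG xs(1)] H_def
        by (simp add: algebra_simps power2_eq_square)
      moreover have "k1 \<le> norm y"
        using k1(2)[OF xs(1), of n] xs(2) unfolding scaleC_of_real y_def G_eq by (simp add: algebra_simps)
      then have "k2 * k1 \<le> k2 * norm y" using k2(1) by simp
      ultimately show ?thesis by (simp add: mult.commute)
    qed
    have "(k1 * k2)\<^sup>2 \<le> C * ((norm (G (x n)))\<^sup>2 - c\<^sup>2)" for n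
    proof -
      have "(k1 * k2)\<^sup>2 \<le> (norm (H (x n)))\<^sup>2" using low k1(1) k2(1) by (intro power_mono) auto
      also have "\<dots> \<le> C * Re (cinner (H (x n)) (x n))"
        by (intro positive_op_norm_sq_le[OF csub \<open>positive_op M H\<close>] positive_op_Re_le[OF csub \<open>positive_op M H\<close>] C xs)
      finally show ?thesis using ReH[OF xs(1), of n] xs(2)[of n] by simp
    qed
    moreover have "(\<lambda>n. C * ((norm (G (x n)))\<^sup>2 - c\<^sup>2)) \<longlonglongrightarrow> C * (c\<^sup>2 - c\<^sup>2)"
      by (intro tendsto_intros xs)
    ultimately have "(k1 * k2)\<^sup>2 \<le> C * (c\<^sup>2 - c\<^sup>2)" by (intro LIMSEQ_le_const) auto
    then show False using k1(1) k2(1) by simp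
  qed
  then have "\<delta> * norm v \<le> c * norm v" by (intro mult_right_mono) auto
  also have "\<dots> \<le> norm (A v - t *\<^sub>R v)" using c(1)[OF v] by (simp add: G_eq)
  finally show ?thesis .
qed

text \<open>A^2 - \<mu>^2 = (A + \<mu>)(A - \<mu>), and positivity bounds the first factor below by
  \<mu>, so the convergence for squares descends to \<open>A\<close>.\<close>

lemma approximate_eigenvector:
  assumes M: "csubspace M" and A: "positive_op M A" and "\<mu> > 0"
    and \<mu>: "\<And>y. y \<in> M \<Longrightarrow> norm (A y) \<le> \<mu> * norm y"
    and x: "\<And>n::nat. x n \<in> M" "\<And>n. norm (x n) = 1" "(\<lambda>n. norm (A (x n))) \<longlonglongrightarrow> \<mu>"
  shows "(\<lambda>n. A (x n) - \<mu> *\<^sub>R x n) \<longlonglongrightarrow> 0"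
proof -
  have s: "sym_op M A" and p: "\<And>x. x \<in> M \<Longrightarrow> 0 \<le> Re (cinner (A x) x)"
    using A positive_op_iff[OF M] by auto
  note linA = sym_opD(1)[OF s]
  have AM: "A y \<in> M" if "y \<in> M" for y using bounded_opD(1)[OF linA that] .
  have "(\<lambda>n. norm (A (A (x n)) - (\<mu>\<^sup>2) *\<^sub>R x n) / \<mu>) \<longlonglongrightarrow> norm (0::'a) / \<mu>"
    by (intro tendsto_intros approximate_eigenvector_square[OF s \<mu> x]) (use \<open>\<mu> > 0\<close> in auto)
  then have lim: "(\<lambda>n. norm (A (A (x n)) - (\<mu>\<^sup>2) *\<^sub>R x n) / \<mu>) \<longlonglongrightarrow> 0" by simp
  have low: "\<mu> * norm y \<le> norm (A y + \<mu> *\<^sub>R y)" if "y \<in> M" for y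
  proof (rule power2_le_imp_le)
    have "(norm (A y + \<mu> *\<^sub>R y))\<^sup>2 = (norm (A y))\<^sup>2 + 2 * \<mu> * Re (cinner (A y) y) + (\<mu> * norm y)\<^sup>2"
      using \<open>\<mu> > 0\<close> by (simp add: norm_add_sq cinner_scaleR_right)
    then show "(\<mu> * norm y)\<^sup>2 \<le> (norm (A y + \<mu> *\<^sub>R y))\<^sup>2" using p[OF that] \<open>\<mu> > 0\<close> by simp
  qed simp
  have "norm (A (x n) - \<mu> *\<^sub>R x n) \<le> norm (A (A (x n)) - (\<mu>\<^sup>2) *\<^sub>R x n) / \<mu>" for n
  proof -
    define y where "y = A (x n) - \<mu> *\<^sub>R x n"
    have mx: "\<mu> *\<^sub>R x n \<in> M" by (intro csubspace_ops[OF M] x)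
    have "y \<in> M" unfolding y_def by (intro csubspace_ops[OF M] AM x mx)
    have eq: "A y + \<mu> *\<^sub>R y = A (A (x n)) - (\<mu>\<^sup>2) *\<^sub>R x n"
      unfolding y_def bounded_op_diff[OF M linA AM[OF x(1)] mx] bounded_op_scaleR[OF linA x(1)]
      by (simp add: algebra_simps power2_eq_square)
    show ?thesis
      using low[OF \<open>y \<in> M\<close>] \<open>\<mu> > 0\<close> unfolding eq unfolding y_def by (simp add: pos_le_divide_eq mult.commute)
  qed
  then show ?thesis by (intro Lim_null_comparison[OF _ lim] always_eventually allI)
qed

text \<open>An isolated top of the spectrum is an eigenvalue. A gap of length \<open>e\<close> below it makes \<open>D = \<mu> - A\<close>
satisfy \<open>D\<^sup>2 \<ge> e D\<close>, so \<open>D\<close> is bounded below on its range, which is dense if \<open>D\<close> is injective.\<close>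

lemma norm_is_limit_point_of_spectrum:
  fixes M :: "'a::chilbert_space set"
  assumes M: "closed_csubspace M" and A: "positive_op M A" and "\<mu> > 0"
    and \<mu>: "\<And>y. y \<in> M \<Longrightarrow> norm (A y) \<le> \<mu> * norm y"
    and x: "\<And>n::nat. x n \<in> M" "\<And>n. norm (x n) = 1" "(\<lambda>n. norm (A (x n))) \<longlonglongrightarrow> \<mu>"
    and not: "\<not> attains_norm M A"
  shows "complex_of_real \<mu> islimpt spectrum_op M A"
proof (rule ccontr)
  note csub = closed_csubspaceD(1)[OF M]
  have s: "sym_op M A" using A positive_op_iff[OF csub] by auto
  assume "\<not> complex_of_real \<mu> islimpt spectrum_op M A"
  then obtain e where e: "e > 0" "\<And>z. z \<in> spectrum_op M A \<Longrightarrow> dist z (complex_of_real \<mu>) < e \<Longrightarrow> z = complex_of_real \<mu>"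
    unfolding islimpt_approachable by metis
  \<comment> \<open>The interval from \<mu> - e to \<mu>, written around its midpoint: squaring the
    lower bound at the midpoint makes the terms in \<open>(norm y)\<^sup>2\<close> cancel and leaves
    D^2 \<ge> e D.\<close>
  have gap: "complex_of_real r \<notin> spectrum_op M A" if "\<bar>r - (\<mu> - e / 2)\<bar> < e / 2" for r
  proof
    assume r: "complex_of_real r \<in> spectrum_op M A"
    have "dist (complex_of_real r) (complex_of_real \<mu>) < e"
      using that unfolding dist_of_real dist_real_def by linarith
    then have "r = \<mu>" using e(2)[OF r] by simp
    then show False using that by simp
  qed
  define D where "D = (\<lambda>x. \<mu> *\<^sub>R x + (- 1) *\<^sub>R A x)"
  have D_eq: "D y = \<mu> *\<^sub>R y - A y" for y by (simp add: D_def)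
  have sD: "sym_op M D" unfolding D_def by (rule sym_op_combine[OF csub sym_op_id s])
  note linD = sym_opD(1)[OF sD]
  have DM: "D y \<in> M" if "y \<in> M" for y using bounded_opD(1)[OF linD that] .
  have pD: "positive_op M D"
    unfolding positive_op_iff[OF csub]
  proof (intro conjI ballI sD)
    fix y assume y: "y \<in> M"
    show "0 \<le> Re (cinner (D y) y)"
      using positive_op_Re_le[OF csub A y \<mu>[OF y]] by (simp add: D_eq cinner_diff_left cinner_scaleR_left Re_cinner_self)
  qed
  have D2: "e * Re (cinner (D y) y) \<le> (norm (D y))\<^sup>2" if y: "y \<in> M" for y
  proof -
    have "(e / 2) * norm y \<le> norm (A y - (\<mu> - e / 2) *\<^sub>R y)" by (rule spectral_gap[OF M s gap y])
    also have "\<dots> = norm (D y - (e / 2) *\<^sub>R y)"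
      unfolding D_eq by (subst norm_minus_commute) (simp add: algebra_simps)
    finally have "((e / 2) * norm y)\<^sup>2 \<le> (norm (D y - (e / 2) *\<^sub>R y))\<^sup>2" using e(1) by (intro power_mono) auto
    also have "\<dots> = (norm (D y))\<^sup>2 - e * Re (cinner (D y) y) + ((e / 2) * norm y)\<^sup>2"
      using e(1) by (simp add: norm_diff_sq cinner_scaleR_right)
    finally show ?thesis by simp
  qed
  \<comment> \<open>For u = D y, Cauchy-Schwarz for the form of \<open>D\<close> at \<open>y\<close>
    and \<open>u\<close> bounds the fourth power of the norm of \<open>u\<close>; D^2 \<ge> e D
    bounds the form at \<open>y\<close>, and \<open>(norm u)^3\<close> cancels.\<close>
  have range: "e * norm u \<le> norm (D u)" if u': "u \<in> D ` M" for u
  proof (cases "u = 0")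
    case False
    obtain y where y: "y \<in> M" "u = D y" using u' by blast
    have u: "u \<in> M" using DM y by blast
    have "((norm u)\<^sup>2)\<^sup>2 \<le> Re (cinner (D y) y) * Re (cinner (D u) u)"
      using positive_op_Cauchy_Schwarz[OF csub pD y(1) u] unfolding y(2)[symmetric] Re_cinner_self .
    also have "\<dots> \<le> ((norm u)\<^sup>2 / e) * (norm (D u) * norm u)"
    proof (rule mult_mono)
      show "Re (cinner (D y) y) \<le> (norm u)\<^sup>2 / e" using D2[OF y(1)] e(1) y(2) by (simp add: field_simps)
      show "Re (cinner (D u) u) \<le> norm (D u) * norm u" using Re_cinner_le[of "D u" u] by linarith
      show "0 \<le> Re (cinner (D u) u)" using pD positive_op_iff[OF csub] u by blast
    qed (use e(1) in auto)
    also have "\<dots> = (norm u)^3 * (norm (D u) / e)" by (simp add: power2_eq_square power3_eq_cube)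
    finally have "(norm u)^3 * norm u \<le> (norm u)^3 * (norm (D u) / e)"
      by (simp add: power2_eq_square power3_eq_cube mult.assoc)
    then have "norm u \<le> norm (D u) / e" by (rule mult_left_le_imp_le) (use False in simp)
    then show ?thesis using e(1) by (simp add: field_simps)
  qed (simp)
  define C where "C = closure (cspan (D ` M))"
  have span: "cspan (D ` M) = D ` M"
    using subspace_image[OF csub linD] complex_vector.span_eq_iff by blast
  have cC: "closed_csubspace C" unfolding C_def by (rule closed_csubspace_closure_span)
  have "C \<subseteq> M"
    unfolding C_def span using DM closed_csubspaceD(2)[OF M] by (intro closure_minimal) auto
  \<comment> \<open>A residual \<open>v\<close> off the closed range is orthogonal to
    \<open>D (D v)\<close>, so \<open>D v = 0\<close>; a nonzero \<open>v\<close> would then be an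
    eigenvector for \<mu> and yield a maximizer.\<close>
  have MC: "y \<in> C" if y: "y \<in> M" for y
  proof -
    define v where "v = y - orth_proj C y"
    have "orth_proj C y \<in> M" using \<open>C \<subseteq> M\<close> orth_proj_in[OF cC] by auto
    then have v: "v \<in> M" unfolding v_def by (intro csubspace_ops[OF csub] y)
    have "D (D v) \<in> C" unfolding C_def span using DM[OF v] closure_subset[of "D ` M"] by blast
    then have "cinner v (D (D v)) = 0" unfolding v_def by (rule orth_proj_orth[OF cC])
    then have "D v = 0" using sym_opD(2)[OF sD v DM[OF v]] by simp
    then have Av: "A v = \<mu> *\<^sub>R v" by (simp add: D_eq)
    have "v = 0"
    proof (rule ccontr)
      assume "v \<noteq> 0"
      define w where "w = (1 / norm v) *\<^sub>R v"
      have w: "w \<in> M" "norm w = 1" unfolding w_def using \<open>v \<noteq> 0\<close> csubspace_ops(4)[OF csub v] by auto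
      have "A w = \<mu> *\<^sub>R w" unfolding w_def bounded_op_scaleR[OF sym_opD(1)[OF s] v] Av by simp
      then have "norm (A w) = \<mu>" using w(2) \<open>\<mu> > 0\<close> by simp
      then show False using not w \<mu> unfolding attains_norm_def by blast
    qed
    then show ?thesis using orth_proj_in[OF cC, of y] by (simp add: v_def)
  qed
  have below: "e * norm y \<le> norm (D y)" if y: "y \<in> M" for y
  proof -
    obtain u where u: "\<forall>n. u n \<in> D ` M" "u \<longlonglongrightarrow> y"
      using MC[OF y] unfolding C_def span closure_sequential by blast
    have "D ` M \<subseteq> M" using DM by auto
    then have uM: "u n \<in> M" for n using u(1) by blast
    have l1: "(\<lambda>n. e * norm (u n)) \<longlonglongrightarrow> e * norm y" by (intro tendsto_intros u)
    have l2: "(\<lambda>n. norm (D (u n))) \<longlonglongrightarrow> norm (D y)"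
      by (intro tendsto_norm bounded_op_tendsto[OF csub linD] uM y u)
    show ?thesis by (rule LIMSEQ_le[OF l1 l2]) (use range u(1) in auto)
  qed
  \<comment> \<open>The lower bound for \<open>D\<close> on all of \<open>M\<close> is incompatible
    with a maximizing sequence, whose members are approximate eigenvectors for \<mu>.\<close>
  have "(\<lambda>n. norm (A (x n) - \<mu> *\<^sub>R x n)) \<longlonglongrightarrow> norm (0::'a)"
    by (intro tendsto_norm approximate_eigenvector[OF csub A \<open>\<mu> > 0\<close> \<mu> x])
  moreover have "e \<le> norm (A (x n) - \<mu> *\<^sub>R x n)" for n
    using below[OF x(1), of n] x(2) by (simp add: D_eq norm_minus_commute)
  ultimately have "e \<le> norm (0::'a)" by (intro LIMSEQ_le_const) auto
  then show False using e(1) by simp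
qed

section \<open>The sequence \<open>\<lambda>\<^sub>j\<close>\<close>

lemma lambda_op_above_rank: "rank_op M A < enat j \<Longrightarrow> lambda_op M A j = 0"
  by (subst lambda_op.simps) simp

lemma lambda_op_essential:
  assumes "1 \<le> j" "enat j \<le> rank_op M A" "complex_of_real (sup_spectrum_op M A) \<in> ess_spectrum_op M A"
  shows "lambda_op M A j = sup_spectrum_op M A"
  using assms by (subst lambda_op.simps) (simp add: Let_def)

lemma abs_k_norming_imp_attains_norm:
  fixes P :: "'a::chilbert_space \<Rightarrow> 'a"
  assumes P: "positive_op UNIV P" and k: "1 \<le> k" "abs_k_norming k P"
    and M: "closed_csubspace M" "M \<noteq> {0}"
  shows "attains_norm M P"
proof (rule ccontr)
  assume "\<not> attains_norm M P"
  define A where "A = abs_op M P"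
  note csub = closed_csubspaceD(1)[OF M(1)]
  have A: "positive_op M A" unfolding A_def by (rule abs_op_positive[OF M(1) P])
  have nA: "norm (A x) = norm (P x)" if "x \<in> M" for x
    unfolding A_def by (rule norm_abs_op[OF M(1) P that])
  have s: "sym_op M A" using positive_op_sym[OF csub A] .
  have not: "\<not> attains_norm M A" using \<open>\<not> attains_norm M P\<close> attains_norm_cong[of M A P] nA by blast
  \<comment> \<open>Infinite dimension and rank ensure that neither the cutoff at the rank in
    \<open>lambda_op\<close> nor the reduced number of vectors in \<open>k_norming\<close> takes
    effect.\<close>
  have inf: "cdim M = \<infinity>" "rank_op M A = \<infinity>"
    using attains_norm_finite_rank[OF M s] not unfolding rank_op_def by blast+
  obtain \<mu> x where x: "\<And>n::nat. x n \<in> M" "\<And>n. norm (x n) = 1" "(\<lambda>n. norm (A (x n))) \<longlonglongrightarrow> \<mu>"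
    and \<mu>: "\<And>y. y \<in> M \<Longrightarrow> norm (A y) \<le> \<mu> * norm y" "0 \<le> \<mu>"
    by (rule maximizing_sequence[OF csub M(2) sym_opD(1)[OF s]]) (rule that)
  have strict: "norm (A y) < \<mu>" if "y \<in> M" "norm y = 1" for y
  proof (rule ccontr)
    assume "\<not> norm (A y) < \<mu>"
    then have "norm (A y) = \<mu>" using \<mu>(1)[OF that(1)] that(2) by simp
    then show False using not \<mu>(1) that unfolding attains_norm_def by blast
  qed
  have "\<mu> > 0" using strict[OF x(1,2)] norm_ge_zero le_less_trans by blast
  have "(\<lambda>n. A (x n) - complex_of_real \<mu> *\<^sub>C x n) \<longlonglongrightarrow> 0"
    unfolding scaleC_of_real by (rule approximate_eigenvector[OF csub A \<open>\<mu> > 0\<close> \<mu>(1) x])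
  then have spec: "complex_of_real \<mu> \<in> spectrum_op M A"
    by (rule spectrum_opI[OF csub x(1,2) _ sym_opD(1)[OF s]])
  have sup: "sup_spectrum_op M A = \<mu>" by (rule sup_spectrum_eq[OF M(1) s \<mu>(1) spec])
  have "complex_of_real \<mu> islimpt spectrum_op M A"
    by (rule norm_is_limit_point_of_spectrum[OF M(1) A \<open>\<mu> > 0\<close> \<mu>(1) x not])
  then have ess: "complex_of_real (sup_spectrum_op M A) \<in> ess_spectrum_op M A"
    unfolding sup ess_spectrum_op_def using spec by blast
  have "ky_fan_norm M k P = (\<Sum>j=1..k. \<mu>)"
    unfolding ky_fan_norm_def s_number_def A_def[symmetric]
    by (intro sum.cong) (auto simp: lambda_op_essential[OF _ _ ess] inf sup)
  moreover have "k_norming M k P" using k(2) M unfolding abs_k_norming_def by blast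
  then obtain v where v: "\<forall>i\<in>{1..k}. v i \<in> M"
    "\<forall>i\<in>{1..k}. \<forall>j\<in>{1..k}. cinner (v i) (v j) = (if i = j then 1 else 0)"
    "ky_fan_norm M k P = (\<Sum>j=1..k. norm (P (v j)))"
    unfolding k_norming_def using inf by auto
  have "(\<Sum>j=1..k. norm (P (v j))) < (\<Sum>j=1..k. \<mu>)"
  proof (rule sum_strict_mono)
    fix j assume j: "j \<in> {1..k}"
    have "orthonormal {1..k} v" using v(2) by (simp add: orthonormal_def)
    then have "norm (v j) = 1" using j by (rule orthonormal_norm)
    then show "norm (P (v j)) < \<mu>" using strict v(1) j nA by metis
  qed (use k(1) in auto)
  ultimately show False using v(3) by simp
qed

text \<open>B - z is multiplication by \<mu> - z on \<open>E\<close> and is bounded below by |z| -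
  \<nu> on the complement, which it preserves. In the punctured disc both constants are positive,
  and Pythagoras combines them.\<close>

lemma eigenvalue_isolated_by_bound_on_complement:
  fixes M :: "'a::chilbert_space set"
  assumes M: "closed_csubspace M" and sB: "sym_op M B"
    and cE: "closed_csubspace E" and EM: "E \<subseteq> M" and eig: "\<And>e. e \<in> E \<Longrightarrow> B e = \<mu> *\<^sub>R e"
    and \<nu>: "\<And>f. f \<in> M \<Longrightarrow> f \<in> ortho E \<Longrightarrow> norm (B f) \<le> \<nu> * norm f" and "0 \<le> \<mu>"
    and z: "z \<noteq> complex_of_real \<mu>" "dist z (complex_of_real \<mu>) < \<mu> - \<nu>"
  shows "z \<notin> spectrum_op M B"
proof -
  note linB = sym_opD(1)[OF sB]
  have B_orth: "B f \<in> ortho E" if f: "f \<in> M" "f \<in> ortho E" for f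
  proof -
    have "cinner (B f) e = 0" if "e \<in> E" for e
      using sym_opD(2)[OF sB f(1), of e] orthoD(1)[OF f(2) that] that EM by (auto simp: eig cinner_scaleR_right)
    then show ?thesis by (simp add: ortho_def)
  qed
  have "cmod (complex_of_real \<mu>) \<le> cmod z + dist z (complex_of_real \<mu>)"
    using norm_triangle_ineq4[of z "z - complex_of_real \<mu>"] by (simp add: dist_norm)
  then have "cmod z > \<nu>" using z(2) \<open>0 \<le> \<mu>\<close> by simp
  define c where "c = min (cmod (complex_of_real \<mu> - z)) (cmod z - \<nu>)"
  have "c > 0" unfolding c_def using z(1) \<open>cmod z > \<nu>\<close> by simp
  show ?thesis
  proof (rule not_in_spectrum_if_bounded_below[OF M sB \<open>c > 0\<close>])
    fix y assume y: "y \<in> M"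
    define e f where "e = orth_proj E y" and "f = y - e"
    have e: "e \<in> E" "e \<in> M" and f: "f \<in> ortho E" "f \<in> M" and y_eq: "y = e + f"
      using orth_proj_in[OF cE, of y] EM orth_proj_resid[OF cE] csubspace_ops(2)[OF closed_csubspaceD(1)[OF M] y]
        by (auto simp: e_def f_def)
    have "B f - z *\<^sub>C f \<in> ortho E"
      by (intro csubspace_ops[OF closed_csubspaceD(1)[OF closed_csubspace_ortho]] B_orth f)
    then have orth0: "cinner ((complex_of_real \<mu> - z) *\<^sub>C e) (B f - z *\<^sub>C f) = 0"
      using orthoD(2)[OF _ e(1)] by (simp add: cinner_scaleC_left)
    have By: "B y - z *\<^sub>C y = (complex_of_real \<mu> - z) *\<^sub>C e + (B f - z *\<^sub>C f)"
      using e unfolding y_eq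
      by (simp add: bounded_opD(2)[OF linB e(2) f(2)] eig scaleC_add_right
          complex_vector.scale_left_diff_distrib scaleC_of_real)
    have eq: "(norm (B y - z *\<^sub>C y))\<^sup>2
      = (cmod (complex_of_real \<mu> - z) * norm e)\<^sup>2 + (norm (B f - z *\<^sub>C f))\<^sup>2"
      unfolding By pythagoras[OF orth0] by (simp add: norm_scaleC)
    have "c * norm e \<le> cmod (complex_of_real \<mu> - z) * norm e"
      unfolding c_def by (intro mult_right_mono) auto
    moreover have "c * norm f \<le> norm (B f - z *\<^sub>C f)"
    proof -
      have "c * norm f \<le> (cmod z - \<nu>) * norm f" unfolding c_def by (intro mult_right_mono) auto
      also have "\<dots> \<le> norm (z *\<^sub>C f) - norm (B f)" using \<nu>[OF f(2,1)] by (simp add: norm_scaleC algebra_simps)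
      also have "\<dots> \<le> norm (B f - z *\<^sub>C f)"
        using norm_triangle_ineq2[of "z *\<^sub>C f" "B f"] by (simp add: norm_minus_commute)
      finally show ?thesis .
    qed
    ultimately have "(c * norm e)\<^sup>2 + (c * norm f)\<^sup>2 \<le> (norm (B y - z *\<^sub>C y))\<^sup>2"
      unfolding eq using \<open>c > 0\<close> by (intro add_mono power_mono) auto
    moreover have "(norm y)\<^sup>2 = (norm e)\<^sup>2 + (norm f)\<^sup>2"
      unfolding y_eq by (rule pythagoras) (rule orthoD(2)[OF f(1) e(1)])
    ultimately have "(c * norm y)\<^sup>2 \<le> (norm (B y - z *\<^sub>C y))\<^sup>2"
      by (simp add: power_mult_distrib algebra_simps)
    then show "c * norm y \<le> norm (B y - z *\<^sub>C y)" by (rule power2_le_imp_le) simp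
  qed
qed

lemma orthonormal_shift:
  assumes e: "orthonormal {..<n::nat} e"
  shows "orthonormal {1..n} (\<lambda>i. e (i - 1))"
  unfolding orthonormal_def
proof (intro ballI)
  fix i j assume ij: "i \<in> {1..n}" "j \<in> {1..n}"
  then have "i - 1 \<in> {..<n}" "j - 1 \<in> {..<n}" "i - 1 = j - 1 \<longleftrightarrow> i = j" by auto
  then show "cinner (e (i - 1)) (e (j - 1)) = (if i = j then 1 else 0)" using orthonormalD[OF e] by metis
qed

lemma orthonormal_vectors:
  assumes V: "csubspace V" and n: "enat n \<le> cdim V"
  obtains x where "orthonormal {1..n} x" "\<And>i. i \<in> {1..n} \<Longrightarrow> x i \<in> V"
proof -
  obtain e where e: "orthonormal {..<n} e" "e ` {..<n} \<subseteq> V" using n le_cdim_iff[OF V] by blast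
  have "e (i - 1) \<in> V" if "i \<in> {1..n}" for i
  proof -
    have "i - 1 \<in> {..<n}" using that by auto
    then show ?thesis using e(2) by blast
  qed
  then show ?thesis using that[OF orthonormal_shift[OF e(1)]] by blast
qed

lemma eigenspace_closed_csubspace:
  assumes M: "closed_csubspace M" and A: "bounded_op M M A"
  shows "closed_csubspace (eigenspace_op M A z)"
  unfolding closed_csubspace_def
proof
  note csub = closed_csubspaceD(1)[OF M]
  show "csubspace (eigenspace_op M A z)"
    unfolding complex_vector.subspace_def eigenspace_op_def
    using csubspace_ops(1,3,6)[OF csub] bounded_op_0[OF csub A]
    by (auto simp: bounded_opD(2,3)[OF A] scaleC_add_right scaleC_scaleC mult.commute)
  show "closed (eigenspace_op M A z)"
    unfolding closed_sequential_limits
  proof (intro allI impI, elim conjE)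
    fix x l assume x: "\<forall>n. x n \<in> eigenspace_op M A z" and lim: "x \<longlonglongrightarrow> l"
    have xM: "x n \<in> M" and Ax: "A (x n) = z *\<^sub>C x n" for n using x by (auto simp: eigenspace_op_def)
    have l: "l \<in> M" by (rule closed_csubspace_limit[OF M xM lim])
    have "(\<lambda>n. A (x n)) \<longlonglongrightarrow> A l" by (rule bounded_op_tendsto[OF csub A xM l lim])
    moreover have "(\<lambda>n. A (x n)) \<longlonglongrightarrow> z *\<^sub>C l" unfolding Ax by (rule tendsto_scaleC[OF lim])
    ultimately have "A l = z *\<^sub>C l" by (rule LIMSEQ_unique)
    then show "l \<in> eigenspace_op M A z" using l by (simp add: eigenspace_op_def)
  qed
qed

text \<open>\<open>B\<close> lives on \<open>N\<close> and vanishes on its complement in \<open>M\<close>; \<open>N\<close> shrinks as eigenspaces are split off.\<close>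

lemma lambda_op_eigenvectors:
  fixes M :: "'a::chilbert_space set"
  assumes M: "closed_csubspace M"
  shows "positive_op M B \<Longrightarrow> closed_csubspace N \<Longrightarrow> N \<subseteq> M \<Longrightarrow>
    (\<And>x. x \<in> M \<Longrightarrow> x \<in> ortho N \<Longrightarrow> B x = 0) \<Longrightarrow>
    (\<And>W. closed_csubspace W \<Longrightarrow> W \<subseteq> N \<Longrightarrow> W \<noteq> {0} \<Longrightarrow> attains_norm W B) \<Longrightarrow>
    enat n \<le> cdim N \<Longrightarrow>
    \<exists>x. orthonormal {1..n} x \<and> (\<forall>i\<in>{1..n}. x i \<in> N \<and> norm (B (x i)) = lambda_op M B i)"
proof (induction n arbitrary: B N rule: less_induct)
  case (less n)
  note pB = less.prems(1) and cN = less.prems(2) and NM = less.prems(3) and zero = less.prems(4)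
    and att = less.prems(5) and dimN = less.prems(6)
  note subM = closed_csubspaceD(1)[OF M] and subN = closed_csubspaceD(1)[OF cN]
  have sB: "sym_op M B" by (rule positive_op_sym[OF subM pB])
  note linB = sym_opD(1)[OF sB]
  have BM: "B y \<in> M" if "y \<in> M" for y by (rule bounded_opD(1)[OF linB that])
  have PN: "orth_proj N y \<in> N" "orth_proj N y \<in> M" for y using orth_proj_in[OF cN] NM by auto
  have B_proj: "B y = B (orth_proj N y)" if y: "y \<in> M" for y
  proof -
    have "y - orth_proj N y \<in> M" by (intro csubspace_ops[OF subM] y PN)
    then have "B (y - orth_proj N y) = 0" using zero orth_proj_resid[OF cN] by blast
    then show ?thesis using bounded_op_diff[OF subM linB y PN(2)] by simp
  qed
  have BN: "B y \<in> N" if y: "y \<in> M" for y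
  proof -
    define r where "r = B y - orth_proj N (B y)"
    have r: "r \<in> M" unfolding r_def by (intro csubspace_ops[OF subM] BM y PN)
    have "r \<in> ortho N" unfolding r_def by (rule orth_proj_resid[OF cN])
    then have "B r = 0" using zero r by blast
    then have "cinner r (B y) = 0" using sym_opD(2)[OF sB r y] by simp
    moreover have "cinner r (orth_proj N (B y)) = 0" using orthoD(1)[OF \<open>r \<in> ortho N\<close> PN(1)] .
    ultimately have "cinner r r = 0" by (subst (2) r_def) (simp add: cinner_diff_right)
    then show ?thesis using PN(1)[of "B y"] by (simp add: r_def)
  qed
  show ?case
  proof (cases "n = 0")
    case True
    then show ?thesis by (auto simp: orthonormal_def)
  next
    case False
    obtain e0 where e0: "orthonormal {1..n} e0" "\<And>i. i \<in> {1..n} \<Longrightarrow> e0 i \<in> N"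
      by (rule orthonormal_vectors[OF subN dimN]) (rule that)
    have "N \<noteq> {0}" using orthonormal_norm[OF e0(1), of 1] e0(2)[of 1] False by auto
    then have "attains_norm N B" by (intro att cN) auto
    then obtain x0 where x0: "x0 \<in> N" "norm x0 = 1" and max: "\<And>y. y \<in> N \<Longrightarrow> norm (B y) \<le> norm (B x0) * norm y"
      unfolding attains_norm_def by blast
    define \<mu> where "\<mu> = norm (B x0)"
    have "x0 \<in> M" using x0 NM by blast
    have bound: "norm (B y) \<le> \<mu> * norm y" if y: "y \<in> M" for y
    proof -
      have "norm (B y) \<le> \<mu> * norm (orth_proj N y)" unfolding B_proj[OF y] \<mu>_def by (rule max[OF PN(1)])
      also have "\<dots> \<le> \<mu> * norm y" unfolding \<mu>_def by (intro mult_left_mono norm_orth_proj_le[OF cN]) simp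
      finally show ?thesis .
    qed
    have pos_on: "positive_op W B" if "W \<subseteq> M" "\<And>y. y \<in> W \<Longrightarrow> B y \<in> W" for W
      unfolding positive_op_def
    proof
      show "bounded_op W W B"
        using that bound bounded_opD(2,3)[OF linB] by (intro bounded_opI[where C = \<mu>]) (auto simp: subset_iff)
      show "\<forall>x\<in>W. cinner (B x) x \<in> \<real>\<^sub>\<ge>\<^sub>0" using pB that(1) unfolding positive_op_def by blast
    qed
    have eig0: "B x0 = \<mu> *\<^sub>R x0" unfolding \<mu>_def
      by (rule attains_norm_eigenvector[OF subN pos_on x0 max]) (use NM BN in auto)
    show ?thesis
    proof (cases "\<mu> = 0")
      case True
      \<comment> \<open>Here \<open>B\<close> vanishes, so its rank and all its \<lambda>-values are
        0, and any orthonormal family in \<open>N\<close> will do.\<close>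
      then have B0: "B y = 0" if "y \<in> M" for y using bound[OF that] by simp
      have "B ` M \<subseteq> cspan {}" using B0 by auto
      then have "rank_op M B \<le> enat (card ({} :: 'a set))" unfolding rank_op_def by (intro cdim_le_card) auto
      then have "rank_op M B = 0" by (simp flip: zero_enat_def)
      then have "lambda_op M B i = 0" if "i \<in> {1..n}" for i
        using that by (intro lambda_op_above_rank) (simp add: zero_enat_def)
      moreover have "B (e0 i) = 0" if "i \<in> {1..n}" for i using B0 e0(2)[OF that] NM by blast
      ultimately show ?thesis using e0 by (intro exI[of _ e0]) auto
    next
      case False
      then have "\<mu> > 0" by (simp add: \<mu>_def)
      have spec: "complex_of_real \<mu> \<in> spectrum_op M B"
        by (rule eigenvalue_in_spectrum[OF subM linB \<open>x0 \<in> M\<close> x0(2)]) (simp add: scaleC_of_real eig0)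
      have sup: "sup_spectrum_op M B = \<mu>" by (rule sup_spectrum_eq[OF M sB bound spec])
      define E where "E = eigenspace_op M B (complex_of_real \<mu>)"
      have E_iff: "y \<in> E \<longleftrightarrow> y \<in> M \<and> B y = \<mu> *\<^sub>R y" for y by (simp add: E_def eigenspace_op_def scaleC_of_real)
      have cE: "closed_csubspace E" unfolding E_def by (rule eigenspace_closed_csubspace[OF M linB])
      note subE = closed_csubspaceD(1)[OF cE]
      have E_inv: "y = (1 / \<mu>) *\<^sub>R B y" "y = B ((1 / \<mu>) *\<^sub>R y)" if "y \<in> E" for y
        using that \<open>\<mu> > 0\<close> by (auto simp: E_iff bounded_op_scaleR[OF linB])
      have EM: "E \<subseteq> M" by (auto simp: E_iff)
      have EN: "E \<subseteq> N" using E_inv(1) BN EM csubspace_ops(4)[OF subN] by (metis subset_iff)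
      have ER: "E \<subseteq> B ` M" using E_inv(2) EM csubspace_ops(4)[OF subM] by blast
      have subR: "csubspace (B ` M)" by (rule subspace_image[OF subM linB])
      have "x0 \<in> E" using \<open>x0 \<in> M\<close> eig0 by (simp add: E_iff)
      have normE: "norm (B y) = \<mu>" if "y \<in> E" "norm y = 1" for y using that \<open>\<mu> > 0\<close> by (simp add: E_iff)
      show ?thesis
      proof (cases "cdim E")
        case infinity
        \<comment> \<open>Infinite multiplicity puts \<mu> into the essential spectrum, so the
          sequence is constant and \<open>E\<close> alone supplies all vectors.\<close>
        then have "rank_op M B = \<infinity>" unfolding rank_op_def using cdim_mono[OF subE subR ER] by simp
        moreover have "complex_of_real (sup_spectrum_op M B) \<in> ess_spectrum_op M B"
          unfolding sup ess_spectrum_op_def using spec infinity by (simp add: E_def)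
        ultimately have lam: "lambda_op M B i = \<mu>" if "i \<in> {1..n}" for i
          using lambda_op_essential[of i M B] that sup by simp
        have "enat n \<le> cdim E" using infinity by simp
        then obtain e where e: "orthonormal {1..n} e" "\<And>i. i \<in> {1..n} \<Longrightarrow> e i \<in> E"
          by (rule orthonormal_vectors[OF subE]) (rule that)
        then show ?thesis using lam normE orthonormal_norm[OF e(1)] EN by (intro exI[of _ e]) auto
      next
        case (enat m)
        have "orthonormal {..<1::nat} (\<lambda>_. x0)" using cinner_unit[OF x0(2)] by (auto simp: orthonormal_def)
        then have "enat 1 \<le> cdim E" using le_cdim_iff[OF subE, of 1] \<open>x0 \<in> E\<close> by auto
        \<comment> \<open>Excludes the totality clause \<open>m = 0\<close> of
          \<open>lambda_op\<close> and makes the induction descend from \<open>n\<close> to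
          \<open>n - m\<close>.\<close>
        then have "m \<ge> 1" using enat by simp
        define F where "F = N \<inter> ortho E"
        have cF: "closed_csubspace F" unfolding F_def by (intro closed_csubspace_Int cN closed_csubspace_ortho)
        note subF = closed_csubspaceD(1)[OF cF]
        have FM: "F \<subseteq> M" and FN: "F \<subseteq> N" using NM by (auto simp: F_def)
        have B_orth: "B f \<in> ortho E" if f: "f \<in> M" "f \<in> ortho E" for f
        proof -
          have "cinner (B f) e = 0" if "e \<in> E" for e
            using sym_opD(2)[OF sB f(1), of e] orthoD(1)[OF f(2) that] that by (simp add: E_iff cinner_scaleR_right)
          then show ?thesis by (simp add: ortho_def)
        qed
        have BF: "B f \<in> F" if "f \<in> F" for f
          using BN B_orth that FM unfolding F_def by blast
        have proj_F: "orth_proj N f \<in> F" if "f \<in> ortho E" for f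
        proof -
          have "cinner (orth_proj N f) e = 0" if "e \<in> E" for e
            using cinner_orth_proj_left[OF cN, of e f] orthoD(1)[OF \<open>f \<in> ortho E\<close> that] that EN by auto
          then show ?thesis using PN(1) by (simp add: F_def ortho_def)
        qed
        \<comment> \<open>The decisive use of attainment: the norm on \<open>F\<close> is reached at
          an eigenvector, so if it equalled \<mu> that vector would lie both in \<open>E\<close> and
          orthogonal to it. The strict gap isolates \<mu> in the spectrum.\<close>
        have "\<exists>\<nu>\<ge>0. \<nu> < \<mu> \<and> (\<forall>f\<in>F. norm (B f) \<le> \<nu> * norm f)"
        proof (cases "F = {0}")
          case True
          then show ?thesis using \<open>\<mu> > 0\<close> bounded_op_0[OF subM linB] by (intro exI[of _ 0]) auto
        next
          case False
          then have "attains_norm F B" by (intro att cF FN)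
          then obtain f where f: "f \<in> F" "norm f = 1" and fmax: "\<And>y. y \<in> F \<Longrightarrow> norm (B y) \<le> norm (B f) * norm y"
            unfolding attains_norm_def by blast
          have Bf: "B f = norm (B f) *\<^sub>R f"
            by (rule attains_norm_eigenvector[OF subF pos_on f fmax]) (use FM BF in auto)
          have "norm (B f) \<noteq> \<mu>"
          proof
            assume "norm (B f) = \<mu>"
            then have "f \<in> E" using Bf f FM by (auto simp: E_iff)
            then have "cinner f f = 0" using f(1) unfolding F_def by (blast intro: orthoD(1))
            then show False using f(2) by simp
          qed
          moreover have "norm (B f) \<le> \<mu>" using bound[of f] f FM by auto
          ultimately show ?thesis using fmax by (intro exI[of _ "norm (B f)"]) auto
        qed
        then obtain \<nu> where \<nu>: "0 \<le> \<nu>" "\<nu> < \<mu>" "\<And>f. f \<in> F \<Longrightarrow> norm (B f) \<le> \<nu> * norm f" by blast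
        have \<nu>': "norm (B f) \<le> \<nu> * norm f" if f: "f \<in> M" "f \<in> ortho E" for f
        proof -
          have "norm (B f) \<le> \<nu> * norm (orth_proj N f)" unfolding B_proj[OF f(1)] by (rule \<nu>(3)[OF proj_F[OF f(2)]])
          also have "\<dots> \<le> \<nu> * norm f" by (intro mult_left_mono norm_orth_proj_le[OF cN] \<nu>(1))
          finally show ?thesis .
        qed
        have PE: "orth_proj E y \<in> E" "orth_proj E y \<in> M" "y - orth_proj E y \<in> ortho E" for y
          using orth_proj_in[OF cE] EM orth_proj_resid[OF cE] by auto
        have resid_M: "y - orth_proj E y \<in> M" if "y \<in> M" for y by (intro csubspace_ops[OF subM] that PE)
        have "\<not> complex_of_real \<mu> islimpt spectrum_op M B"
          unfolding islimpt_approachable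
          using eigenvalue_isolated_by_bound_on_complement[OF M sB cE EM _ \<nu>', of \<mu>] \<nu>(2) \<open>\<mu> > 0\<close>
          by (auto simp: E_iff intro!: exI[of _ "\<mu> - \<nu>"])
        then have ness: "complex_of_real \<mu> \<notin> ess_spectrum_op M B"
          using enat by (simp add: ess_spectrum_op_def E_def)
        \<comment> \<open>The operator on which \<open>lambda_op\<close> recurses: it annihilates
          \<open>E\<close> and agrees with \<open>B\<close> on the complement.\<close>
        define B1 where "B1 = (\<lambda>x. B x - \<mu> *\<^sub>R orth_proj E x)"
        have B1_eq: "B1 y = B (y - orth_proj E y)" if y: "y \<in> M" for y
          using PE(1)[of y] bounded_op_diff[OF subM linB y PE(2)] by (simp add: B1_def E_iff)
        have linB1: "bounded_op M M B1"
          using bounded_op_combine[OF subM linB bounded_op_mono[OF bounded_op_orth_proj[OF cE] subset_UNIV EM], of 1 "- \<mu>"]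
          by (simp add: B1_def)
        have B1_orth: "B1 y \<in> ortho E" if "y \<in> M" for y
          unfolding B1_eq[OF that] by (intro B_orth resid_M PE that)
        have pB1: "positive_op M B1"
          unfolding positive_op_def
        proof (intro conjI ballI linB1)
          fix y assume y: "y \<in> M"
          have "cinner (B1 y) (orth_proj E y) = 0" using orthoD(1)[OF B1_orth[OF y] PE(1)] .
          then have "cinner (B1 y) y = cinner (B (y - orth_proj E y)) (y - orth_proj E y)"
            by (simp add: cinner_diff_right B1_eq[OF y])
          then show "cinner (B1 y) y \<in> \<real>\<^sub>\<ge>\<^sub>0" using pB resid_M[OF y] unfolding positive_op_def by simp
        qed
        have B1_F: "B1 f = B f" if "f \<in> ortho E" for f using orth_proj_zero[OF cE that] by (simp add: B1_def)
        \<comment> \<open>The rank drops by exactly \<open>m\<close>, so the cutoff at the rank is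
          met at the same place before and after the index shift.\<close>
        have rank: "enat (m + i) \<le> rank_op M B \<longleftrightarrow> enat i \<le> rank_op M B1" for i
          unfolding rank_op_def
        proof (rule le_cdim_orth_sum_iff[OF subE enat subspace_image[OF subM linB1] subR ER])
          show "B1 ` M \<subseteq> B ` M" using B1_eq resid_M by auto
          show "B1 ` M \<subseteq> ortho E" using B1_orth by auto
          fix w assume "w \<in> B ` M"
          then obtain y where y: "y \<in> M" "w = B y" by blast
          have "\<mu> *\<^sub>R orth_proj E y \<in> E" by (intro csubspace_ops[OF subE] PE)
          then show "\<exists>e\<in>E. \<exists>v\<in>B1 ` M. w = e + v"
            using y by (intro bexI[of _ "\<mu> *\<^sub>R orth_proj E y"] bexI[of _ "B1 y"]) (auto simp: B1_def)
        qed
        have lam_low: "lambda_op M B i = \<mu>" if i: "1 \<le> i" "i \<le> m" for i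
        proof -
          have "enat m \<le> rank_op M B" using rank[of 0] by (simp flip: zero_enat_def)
          then have "\<not> rank_op M B < enat i" using i(2) by (meson enat_ord_simps(1) not_le order_trans)
          then show ?thesis
            using i ness enat by (subst lambda_op.simps) (simp add: sup Let_def E_def)
        qed
        have lam_high: "lambda_op M B i = lambda_op M B1 (i - m)" if i: "m < i" for i
        proof (cases "rank_op M B < enat i")
          case True
          then have "rank_op M B1 < enat (i - m)" using rank[of "i - m"] i by (simp add: not_le[symmetric])
          then show ?thesis using True by (simp add: lambda_op_above_rank)
        next
          case False
          then show ?thesis
            using i ness enat \<open>m \<ge> 1\<close> by (subst lambda_op.simps) (simp add: sup Let_def E_def B1_def)
        qed
        have "enat m \<le> cdim E" using enat by simp
        then obtain e where e: "orthonormal {1..m} e" "\<And>i. i \<in> {1..m} \<Longrightarrow> e i \<in> E"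
          by (rule orthonormal_vectors[OF subE]) (rule that)
        have e_low: "e i \<in> N \<and> norm (B (e i)) = lambda_op M B i" if "i \<in> {1..m}" for i
          using lam_low[of i] normE[OF e(2)[OF that] orthonormal_norm[OF e(1) that]] e(2)[OF that] EN that by auto
        show ?thesis
        proof (cases "n \<le> m")
          case True
          then have "{1..n} \<subseteq> {1..m}" by auto
          then show ?thesis using orthonormal_subset[OF e(1)] e_low by blast
        next
          case False
          have "\<exists>x. orthonormal {1..n - m} x \<and>
            (\<forall>i\<in>{1..n - m}. x i \<in> F \<and> norm (B1 (x i)) = lambda_op M B1 i)"
          proof (rule less.IH[OF _ pB1 cF FM])
            show "n - m < n" using False \<open>m \<ge> 1\<close> by simp
            \<comment> \<open>\<open>B1\<close> ignores the \<open>E\<close>-component of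
              \<open>y\<close>. The \<open>N\<close>-component \<open>g\<close> of the rest belongs
              to \<open>F\<close>, while \<open>y\<close> is orthogonal to \<open>F\<close>; hence
              \<open>g\<close> is orthogonal to itself.\<close>
            show "B1 y = 0" if y: "y \<in> M" "y \<in> ortho F" for y
            proof -
              define f where "f = y - orth_proj E y"
              have f: "f \<in> M" "f \<in> ortho E" unfolding f_def by (intro resid_M y PE)+
              define g where "g = orth_proj N f"
              have g: "g \<in> F" unfolding g_def by (rule proj_F[OF f(2)])
              have "cinner g g = cinner f g"
                using cinner_orth_proj_left[OF cN, of g f] g FN by (auto simp: g_def)
              also have "\<dots> = cinner y g - cinner (orth_proj E y) g" by (simp add: f_def cinner_diff_left)
              also have "\<dots> = 0" using orthoD(1)[OF y(2) g] orthoD(2)[OF _ PE(1), of g y] g by (simp add: F_def)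
              finally have "g = 0" by simp
              then show ?thesis
                unfolding B1_eq[OF y(1)] using B_proj[OF f(1)] bounded_op_0[OF subM linB] by (simp add: g_def f_def)
            qed
            show "attains_norm W B1" if W: "closed_csubspace W" "W \<subseteq> F" "W \<noteq> {0}" for W
            proof -
              have "attains_norm W B" using W FN by (intro att) auto
              moreover have "norm (B1 w) = norm (B w)" if "w \<in> W" for w
                using B1_F that W(2) by (auto simp: F_def)
              ultimately show ?thesis using attains_norm_cong[of W B1 B] by blast
            qed
            have "enat (m + (n - m)) \<le> cdim N \<longleftrightarrow> enat (n - m) \<le> cdim F"
            proof (rule le_cdim_orth_sum_iff[OF subE enat subF subN EN FN])
              show "F \<subseteq> ortho E" by (simp add: F_def)
              fix w assume w: "w \<in> N"
              have "orth_proj E w \<in> N" using PE(1) EN by blast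
              then have "w - orth_proj E w \<in> F" unfolding F_def using PE(3) csubspace_ops(2)[OF subN w] by blast
              then show "\<exists>e\<in>E. \<exists>v\<in>F. w = e + v"
                using PE(1)[of w] by (intro bexI[of _ "orth_proj E w"] bexI[of _ "w - orth_proj E w"]) auto
            qed
            then show "enat (n - m) \<le> cdim F" using dimN False by simp
          qed
          then obtain v where v: "orthonormal {1..n - m} v"
            "\<And>i. i \<in> {1..n - m} \<Longrightarrow> v i \<in> F \<and> norm (B1 (v i)) = lambda_op M B1 i" by blast
          define x where "x i = (if i \<le> m then e i else v (i - m))" for i
          have ev: "cinner (e i) (v j) = 0" "cinner (v j) (e i) = 0" if "i \<in> {1..m}" "j \<in> {1..n - m}" for i j
            using orthoD[OF _ e(2)[OF that(1)], of "v j"] v(2)[OF that(2)] by (auto simp: F_def)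
          have "orthonormal {1..n} x"
            unfolding orthonormal_def
          proof (intro ballI)
            fix i j assume ij: "i \<in> {1..n}" "j \<in> {1..n}"
            show "cinner (x i) (x j) = (if i = j then 1 else 0)"
            proof (cases "i \<le> m"; cases "j \<le> m")
              assume "i \<le> m" "j \<le> m"
              then show ?thesis using orthonormalD[OF e(1), of i j] ij by (simp add: x_def)
            next
              assume *: "i \<le> m" "\<not> j \<le> m"
              then have "i \<in> {1..m}" "j - m \<in> {1..n - m}" using ij by auto
              from ev(1)[OF this] show ?thesis using * by (auto simp: x_def)
            next
              assume *: "\<not> i \<le> m" "j \<le> m"
              then have "j \<in> {1..m}" "i - m \<in> {1..n - m}" using ij by auto
              from ev(2)[OF this] show ?thesis using * by (auto simp: x_def)
            next
              assume *: "\<not> i \<le> m" "\<not> j \<le> m"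
              then have "i - m \<in> {1..n - m}" "j - m \<in> {1..n - m}" "i - m = j - m \<longleftrightarrow> i = j" using ij by auto
              then show ?thesis using orthonormalD[OF v(1), of "i - m" "j - m"] * by (simp add: x_def)
            qed
          qed
          moreover have "x i \<in> N \<and> norm (B (x i)) = lambda_op M B i" if i: "i \<in> {1..n}" for i
          proof (cases "i \<le> m")
            case True
            then show ?thesis using e_low[of i] i by (simp add: x_def)
          next
            case False
            then have "i - m \<in> {1..n - m}" using i by auto
            from v(2)[OF this] show ?thesis
              using False lam_high[of i] B1_F[of "v (i - m)"] by (simp add: x_def F_def)
          qed
          ultimately show ?thesis by blast
        qed
      qed
    qed
  qed
qed

text \<open>Attainment on all closed subspaces of \<open>M\<close> passes to the modulus because the
  norms agree, and its eigenvectors for the first \<lambda>-values are the required orthonormal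
  vectors.\<close>

lemma attains_norm_imp_abs_k_norming:
  fixes P :: "'a::chilbert_space \<Rightarrow> 'a"
  assumes P: "positive_op UNIV P"
    and att: "\<And>M. closed_csubspace M \<Longrightarrow> M \<noteq> {0} \<Longrightarrow> attains_norm M P"
  shows "abs_k_norming k P"
  unfolding abs_k_norming_def
proof (intro conjI allI impI)
  show bP: "bounded_op UNIV UNIV P" using P by (simp add: positive_op_def)
  fix M :: "'a set" assume M: "closed_csubspace M \<and> M \<noteq> {0}"
  then have cM: "closed_csubspace M" by blast
  note subM = closed_csubspaceD(1)[OF cM]
  define A where "A = abs_op M P"
  have pA: "positive_op M A" unfolding A_def by (rule abs_op_positive[OF cM P])
  have nA: "norm (A x) = norm (P x)" if "x \<in> M" for x
    unfolding A_def by (rule norm_abs_op[OF cM P that])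
  define n where "n = (if cdim M < enat k then the_enat (cdim M) else k)"
  have n: "enat n \<le> cdim M" "n \<le> k" "n < k \<Longrightarrow> cdim M = enat n"
    unfolding n_def by (cases "cdim M"; auto)+
  have "\<exists>x. orthonormal {1..n} x \<and> (\<forall>i\<in>{1..n}. x i \<in> M \<and> norm (A (x i)) = lambda_op M A i)"
  proof (rule lambda_op_eigenvectors[OF cM pA cM subset_refl _ _ n(1)])
    show "A x = 0" if x: "x \<in> M" "x \<in> ortho M" for x
      using orthoD(1)[OF x(2,1)] bounded_op_0[OF subM, of M A] pA by (simp add: positive_op_def)
    show "attains_norm W A" if W: "closed_csubspace W" "W \<subseteq> M" "W \<noteq> {0}" for W
      using att[OF W(1,3)] attains_norm_cong[of W A P] nA W(2) by blast
  qed
  then obtain x where x: "orthonormal {1..n} x" "\<forall>i\<in>{1..n}. x i \<in> M \<and> norm (A (x i)) = lambda_op M A i"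
    by blast
  \<comment> \<open>This range of \<open>j\<close> is nonempty only if \<open>n\<close> is the
    dimension of \<open>M\<close>; the rank is then at most \<open>n\<close>, so the remaining
    s-numbers vanish.\<close>
  have "lambda_op M A j = 0" if "n < j" "j \<le> k" for j
  proof (rule lambda_op_above_rank)
    have lin: "bounded_op M M A" using pA by (simp add: positive_op_def)
    have "rank_op M A \<le> cdim M"
      unfolding rank_op_def using bounded_opD(1)[OF lin]
      by (intro cdim_mono subspace_image[OF subM lin] subM) auto
    also have "\<dots> < enat j" using n(3) that by simp
    finally show "rank_op M A < enat j" .
  qed
  then have "(\<Sum>j=1..k. lambda_op M A j) = (\<Sum>j=1..n. lambda_op M A j)"
    using n(2) by (intro sum.mono_neutral_right) auto
  also have "\<dots> = (\<Sum>j=1..n. norm (P (x j)))"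
    using x(2) nA by (intro sum.cong refl) metis
  finally have "ky_fan_norm M k P = (\<Sum>j=1..n. norm (P (x j)))"
    by (simp add: ky_fan_norm_def s_number_def A_def)
  then show "k_norming M k P"
    unfolding k_norming_def Let_def n_def[symmetric]
    using x bounded_op_mono[OF bP subset_UNIV subset_UNIV] unfolding orthonormal_def by blast
qed

section \<open>Compact perturbations of multiples of the identity\<close>

text \<open>Otherwise \<open>F\<close> would be injective on an infinite-dimensional space and would
  map \<open>card B + 1\<close> orthonormal vectors to independent vectors in the span of
  \<open>B\<close>.\<close>

lemma unit_kernel_vector_or_finite_dim:
  assumes M: "csubspace M" and F: "bounded_op UNIV UNIV F" and fin: "rank_op UNIV F < \<infinity>"
  shows "(\<exists>x\<in>M. norm x = 1 \<and> F x = 0) \<or> cdim M \<noteq> \<infinity>"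
proof (rule disjCI)
  assume "\<not> cdim M \<noteq> \<infinity>"
  then have inf: "cdim M = \<infinity>" by simp
  have subU: "csubspace (UNIV :: 'a set)" by (rule complex_vector.subspace_UNIV)
  obtain d where d: "cdim (range F) = enat d" using fin unfolding rank_op_def by (cases "cdim (range F)") auto
  then obtain B where B: "finite B" "range F \<subseteq> cspan B" using cdim_finite_span[of "range F"] by auto
  show "\<exists>x\<in>M. norm x = 1 \<and> F x = 0"
  proof (rule ccontr)
    assume no: "\<not> (\<exists>x\<in>M. norm x = 1 \<and> F x = 0)"
    have ker: "x = 0" if x: "x \<in> M" "F x = 0" for x
    proof (rule ccontr)
      assume "x \<noteq> 0"
      then show False
        using no csubspace_ops(4)[OF M x(1), of "1 / norm x"] bounded_op_scaleR[OF F, of x "1 / norm x"] x(2) by auto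
    qed
    have inj: "inj_on F M"
    proof (rule inj_onI)
      fix x y assume "x \<in> M" "y \<in> M" "F x = F y"
      then show "x = y" using ker[of "x - y"] csubspace_ops(2)[OF M] bounded_op_diff[OF subU F] by simp
    qed
    obtain e where e: "orthonormal {..<Suc (card B)} e" "e ` {..<Suc (card B)} \<subseteq> M"
      using le_cdim_iff[OF M, of "Suc (card B)"] inf by auto
    let ?I = "{..<Suc (card B)}"
    have sp: "cspan (e ` ?I) \<subseteq> M" using e(2) M by (rule complex_vector.span_minimal)
    have hom: "module_hom scaleC scaleC F"
      by (intro module_hom.intro module_hom_axioms.intro complex_vector.module_axioms)
         (auto simp: bounded_opD[OF F])
    have "complex_vector.independent (F ` (e ` ?I))"
      by (rule module_hom.independent_injective_image[OF hom orthonormal_independent[OF e(1)] inj_on_subset[OF inj sp]])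
    moreover have "F ` (e ` ?I) \<subseteq> cspan B" using B(2) by blast
    ultimately have "card (F ` (e ` ?I)) \<le> card B"
      using complex_vector.independent_span_bound[OF B(1)] by blast
    moreover have "card (F ` (e ` ?I)) = Suc (card B)"
      using card_image[OF inj_on_subset[OF inj e(2)]] card_image[OF orthonormal_inj[OF e(1)]] by simp
    ultimately show False by simp
  qed
qed

text \<open>The subsequence criterion is applied with \<beta> = \<alpha>^2: on vectors of
  \<open>M\<close>, A^2 - \<alpha>^2 is a continuous function of \<open>K x + F x\<close>, for which
  convergent subsequences exist.\<close>

lemma attains_norm_compact_perturbation:
  fixes P :: "'a::chilbert_space \<Rightarrow> 'a"
  assumes P: "positive_op UNIV P" and \<alpha>: "0 \<le> \<alpha>" and K: "positive_op UNIV K" "compact_op K"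
    and F: "finite_rank_op F" and PKF: "\<And>x. P x = \<alpha> *\<^sub>R x + K x + F x"
    and M: "closed_csubspace M" "M \<noteq> {0}"
  shows "attains_norm M P"
proof -
  define A where "A = abs_op M P"
  note csub = closed_csubspaceD(1)[OF M(1)]
  have subU: "csubspace (UNIV :: 'a set)" by (rule complex_vector.subspace_UNIV)
  have pA: "positive_op M A" unfolding A_def by (rule abs_op_positive[OF M(1) P])
  have nA: "norm (A x) = norm (P x)" if "x \<in> M" for x
    unfolding A_def by (rule norm_abs_op[OF M(1) P that])
  have s: "sym_op M A" using positive_op_sym[OF csub pA] .
  have linP: "bounded_op UNIV UNIV P" using P by (simp add: positive_op_def)
  have linK: "bounded_op UNIV UNIV K" using K(1) by (simp add: positive_op_def)
  have linF: "bounded_op UNIV UNIV F" and rankF: "rank_op UNIV F < \<infinity>" using F by (auto simp: finite_rank_op_def)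
  have "attains_norm M A"
  proof (rule attains_norm_if_subsequence[OF M s])
    fix \<mu> and x :: "nat \<Rightarrow> 'a"
    assume \<mu>: "\<And>y. y \<in> M \<Longrightarrow> norm (A y) \<le> \<mu> * norm y" and x: "\<And>n. x n \<in> M" "\<And>n. norm (x n) = 1"
      and not: "\<not> attains_norm M A"
    have "norm (A (x 0)) \<le> \<mu>" using \<mu>[OF x(1), of 0] x(2)[of 0] by simp
    then have "\<mu> \<ge> 0" using norm_ge_zero order_trans by blast
    \<comment> \<open>Equality would produce a maximizer: on a unit vector \<open>v\<close> with
      \<open>F v = 0\<close>, positivity of \<open>K\<close> gives \<alpha> v + K v norm at least
      \<alpha> = \<mu>. Such a \<open>v\<close> exists because \<open>M\<close> is
      infinite-dimensional.\<close>
    have "\<alpha>\<^sup>2 \<noteq> \<mu>\<^sup>2"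
    proof
      assume "\<alpha>\<^sup>2 = \<mu>\<^sup>2"
      then have "\<alpha> = \<mu>" using \<alpha> \<open>\<mu> \<ge> 0\<close> by simp
      have "cdim M = \<infinity>" using attains_norm_finite_rank[OF M s] not by blast
      then obtain v where v: "v \<in> M" "norm v = 1" "F v = 0"
        using unit_kernel_vector_or_finite_dim[OF csub linF rankF] by blast
      have "\<mu> = \<alpha> * norm v" using v(2) \<open>\<alpha> = \<mu>\<close> by simp
      also have "\<dots> \<le> norm (P v)"
      proof (rule power2_le_imp_le)
        have "0 \<le> Re (cinner (K v) v)" using K(1) positive_op_iff[OF subU] by blast
        then have "0 \<le> Re (cinner (\<alpha> *\<^sub>R v) (K v))"
          using \<alpha> by (simp add: cinner_scaleR_left Re_cinner_commute[of v])
        then show "(\<alpha> * norm v)\<^sup>2 \<le> (norm (P v))\<^sup>2"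
          using norm_add_sq[of "\<alpha> *\<^sub>R v" "K v"] \<alpha> by (simp add: PKF v(3))
      qed simp
      finally have "norm (A v) \<ge> \<mu>" using nA[OF v(1)] by simp
      then have "norm (A y) \<le> norm (A v) * norm y" if "y \<in> M" for y
        using \<mu>[OF that] mult_right_mono[OF \<open>norm (A v) \<ge> \<mu>\<close>, of "norm y"] by simp
      then show False using not v unfolding attains_norm_def by blast
    qed
    obtain C where C: "\<And>x. x \<in> UNIV \<Longrightarrow> norm (F x) \<le> C * norm x" by (rule bounded_op_bound[OF linF]) (rule that)
    have "compact (closure (K ` cball 0 1))" using K(2) by (simp add: compact_op_def)
    moreover have "\<forall>n. K (x n) \<in> closure (K ` cball 0 1)"
      using x(2) closure_subset[of "K ` cball 0 1"] by (auto simp: subset_iff)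
    ultimately obtain k r1 where r1: "strict_mono (r1::nat\<Rightarrow>nat)" "((\<lambda>n. K (x n)) \<circ> r1) \<longlonglongrightarrow> k"
      unfolding compact_def by meson
    have "\<exists>l\<in>range F. \<exists>r::nat\<Rightarrow>nat. strict_mono r \<and> (\<lambda>n. F (x (r1 (r n)))) \<longlonglongrightarrow> l"
    proof (rule finite_cdim_convergent_subseq[OF subspace_image[OF subU linF]])
      show "cdim (range F) \<noteq> \<infinity>" using rankF by (auto simp: rank_op_def)
      show "norm (F (x (r1 n))) \<le> C" for n using C[of "x (r1 n)"] x(2) by simp
    qed auto
    then obtain f r2 where r2: "strict_mono (r2::nat\<Rightarrow>nat)" "(\<lambda>n. F (x (r1 (r2 n)))) \<longlonglongrightarrow> f" by blast
    define r where "r = r1 \<circ> r2"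
    have r: "strict_mono r" unfolding r_def using r1(1) r2(1) by (rule strict_mono_o)
    have limK: "(\<lambda>n. K (x (r n))) \<longlonglongrightarrow> k"
      using LIMSEQ_subseq_LIMSEQ[OF r1(2) r2(1)] by (simp add: r_def o_def)
    have limF: "(\<lambda>n. F (x (r n))) \<longlonglongrightarrow> f" using r2(2) by (simp add: r_def)
    define g where "g n = K (x (r n)) + F (x (r n))" for n
    have g: "g \<longlonglongrightarrow> k + f" unfolding g_def by (intro tendsto_add limK limF)
    have "A (A (x (r n))) - (\<alpha>\<^sup>2) *\<^sub>R x (r n) = orth_proj M (\<alpha> *\<^sub>R g n + P (g n))" for n
    proof -
      let ?x = "x (r n)"
      \<comment> \<open>With P x = \<alpha> x + g, applying \<open>P\<close> again gives P^2 x =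
        \<alpha>^2 x + (\<alpha> g + P g).\<close>
      have "P (P ?x) = P (\<alpha> *\<^sub>R ?x + g n)" by (subst PKF[of ?x]) (simp add: g_def add.assoc)
      also have "\<dots> = \<alpha> *\<^sub>R P ?x + P (g n)"
        by (simp add: bounded_opD(2)[OF linP] bounded_op_scaleR[OF linP])
      also have "\<dots> = (\<alpha>\<^sup>2) *\<^sub>R ?x + (\<alpha> *\<^sub>R g n + P (g n))"
        by (subst PKF[of ?x]) (simp add: g_def scaleR_add_right power2_eq_square)
      finally have "P (P ?x) = (\<alpha>\<^sup>2) *\<^sub>R ?x + (\<alpha> *\<^sub>R g n + P (g n))" .
      moreover have "orth_proj M ((\<alpha>\<^sup>2) *\<^sub>R ?x) = (\<alpha>\<^sup>2) *\<^sub>R ?x"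
        by (intro orth_proj_id[OF M(1)] csubspace_ops[OF csub] x)
      ultimately show ?thesis
        unfolding A_def abs_op_square[OF M(1) P x(1)] by (simp add: orth_proj_add[OF M(1)])
    qed
    moreover have "(\<lambda>n. orth_proj M (\<alpha> *\<^sub>R g n + P (g n))) \<longlonglongrightarrow> orth_proj M (\<alpha> *\<^sub>R (k + f) + P (k + f))"
      by (intro bounded_op_tendsto[OF subU bounded_op_orth_proj[OF M(1)]] tendsto_intros g
          bounded_op_tendsto[OF subU linP] UNIV_I)
    ultimately have "(\<lambda>n. A (A (x (r n))) - (\<alpha>\<^sup>2) *\<^sub>R x (r n)) \<longlonglongrightarrow> orth_proj M (\<alpha> *\<^sub>R (k + f) + P (k + f))"
      by simp
    then show "\<exists>\<beta> l r. \<beta> \<noteq> \<mu>\<^sup>2 \<and> strict_mono (r::nat\<Rightarrow>nat) \<and> (\<lambda>n. A (A (x (r n))) - \<beta> *\<^sub>R x (r n)) \<longlonglongrightarrow> l"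
      using r \<open>\<alpha>\<^sup>2 \<noteq> \<mu>\<^sup>2\<close> by blast
  qed
  then show ?thesis using attains_norm_cong[of M A P] nA by blast
qed

section \<open>Operators attaining their norm on every subspace\<close>

lemma orthonormalI_linorder:
  fixes I :: "'i::linorder set"
  assumes "\<And>i. i \<in> I \<Longrightarrow> norm (x i) = 1" "\<And>i j. i \<in> I \<Longrightarrow> j \<in> I \<Longrightarrow> i < j \<Longrightarrow> cinner (x j) (x i) = 0"
  shows "orthonormal I x"
  unfolding orthonormal_def
proof (intro ballI)
  fix i j assume ij: "i \<in> I" "j \<in> I"
  show "cinner (x i) (x j) = (if i = j then 1 else 0)"
  proof (cases i j rule: linorder_cases)
    case less
    then show ?thesis using assms(2)[OF ij] cinner_zero_commute by auto
  next
    case equal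
    then show ?thesis using cinner_unit[OF assms(1)[OF ij(1)]] by simp
  next
    case greater
    then show ?thesis using assms(2)[OF ij(2,1)] by simp
  qed
qed

text \<open>The part of \<open>W\<close> orthogonal to earlier eigenvectors is invariant under
  \<open>P\<close>, so a maximizer there is again an eigenvector. It is used for the whole space and
  again below the limit of the first sequence.\<close>

lemma peeling:
  fixes P :: "'a::chilbert_space \<Rightarrow> 'a"
  assumes P: "positive_op UNIV P"
    and att: "\<And>M. closed_csubspace M \<Longrightarrow> M \<noteq> {0} \<Longrightarrow> attains_norm M P"
    and W: "closed_csubspace W" "\<And>y. y \<in> W \<Longrightarrow> P y \<in> W" "cdim W = \<infinity>"
  obtains x :: "nat \<Rightarrow> 'a" where "orthonormal UNIV x" "\<And>n. x n \<in> W" "\<And>n. P (x n) = norm (P (x n)) *\<^sub>R x n"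
    "\<And>n y. y \<in> W \<Longrightarrow> (\<And>i. i < n \<Longrightarrow> cinner y (x i) = 0) \<Longrightarrow> norm (P y) \<le> norm (P (x n)) * norm y"
proof -
  have subU: "csubspace (UNIV :: 'a set)" by (rule complex_vector.subspace_UNIV)
  note subW = closed_csubspaceD(1)[OF W(1)]
  have sP: "sym_op UNIV P" by (rule positive_op_sym[OF subU P])
  \<comment> \<open>The requirement on the \<open>n\<close>-th vector, depending on \<open>f\<close>
    only below \<open>n\<close> as well-founded dependent choice demands.\<close>
  define Q where "Q f n v \<longleftrightarrow> v \<in> W \<and> norm v = 1 \<and> P v = norm (P v) *\<^sub>R v \<and> (\<forall>i<n. cinner v (f i) = 0) \<and>
    (\<forall>y\<in>W. (\<forall>i<n. cinner y (f i) = 0) \<longrightarrow> norm (P y) \<le> norm (P v) * norm y)"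
    for f :: "nat \<Rightarrow> 'a" and n v
  have "\<exists>f. \<forall>n. Q f n (f n)"
  proof (rule dependent_wellorder_choice)
    fix r and f g :: "nat \<Rightarrow> 'a" and n :: nat
    assume "\<And>i. i < n \<Longrightarrow> f i = g i"
    then show "Q f n r = Q g n r" by (simp add: Q_def)
  next
    fix n :: nat and f :: "nat \<Rightarrow> 'a"
    assume IH: "\<And>i. i < n \<Longrightarrow> Q f i (f i)"
    have on: "orthonormal {..<n} f"
      using IH by (intro orthonormalI_linorder) (auto simp: Q_def)
    have fW: "f ` {..<n} \<subseteq> W" using IH by (auto simp: Q_def)
    define V where "V = W \<inter> ortho (f ` {..<n})"
    have V_iff: "y \<in> V \<longleftrightarrow> y \<in> W \<and> (\<forall>i<n. cinner y (f i) = 0)" for y by (auto simp: V_def ortho_def)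
    have cV: "closed_csubspace V" unfolding V_def by (intro closed_csubspace_Int W closed_csubspace_ortho)
    have "\<not> W \<subseteq> cspan (f ` {..<n})"
    proof
      assume "W \<subseteq> cspan (f ` {..<n})"
      then have "cdim W \<le> enat (card (f ` {..<n}))" by (intro cdim_le_card) auto
      then show False using W(3) by simp
    qed
    then obtain u where "u \<in> W" "norm u = 1" "\<forall>i<n. cinner u (f i) = 0"
      using orthonormal_extend[OF subW on fW] by blast
    then have "u \<in> V" "u \<noteq> 0" by (auto simp: V_iff)
    then have "V \<noteq> {0}" by blast
    then obtain v where v: "v \<in> V" "norm v = 1" "\<And>y. y \<in> V \<Longrightarrow> norm (P y) \<le> norm (P v) * norm y"
      using att[OF cV] unfolding attains_norm_def by blast
    have PV: "P y \<in> V" if y: "y \<in> V" for y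
    proof -
      have "cinner (P y) (f i) = 0" if "i < n" for i
      proof -
        have "P (f i) = norm (P (f i)) *\<^sub>R f i" using IH[OF that] by (simp add: Q_def)
        then have "cinner y (P (f i)) = norm (P (f i)) * cinner y (f i)" by (metis cinner_scaleR_right)
        then show ?thesis using sym_opD(2)[OF sP, of y "f i"] y that by (simp add: V_iff)
      qed
      then show ?thesis using W(2) y by (simp add: V_iff)
    qed
    have "positive_op V P"
      using P PV unfolding positive_op_def bounded_op_def by (auto simp: Pi_def)
    from attains_norm_eigenvector[OF closed_csubspaceD(1)[OF cV] this v]
    have "Q f n v" using v by (simp add: Q_def V_iff)
    then show "\<exists>v. Q f n v" by blast
  qed
  then obtain x where x: "\<And>n. Q x n (x n)" by blast
  have "orthonormal UNIV x"
    using x by (intro orthonormalI_linorder) (auto simp: Q_def)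
  moreover have "x n \<in> W" "P (x n) = norm (P (x n)) *\<^sub>R x n" for n using x[of n] by (auto simp: Q_def)
  moreover have "norm (P y) \<le> norm (P (x n)) * norm y" if "y \<in> W" "\<And>i. i < n \<Longrightarrow> cinner y (x i) = 0" for n y
    using x[of n] that by (auto simp: Q_def)
  ultimately show ?thesis using that[of x] by blast
qed

lemma closure_span_subset:
  assumes "closed_csubspace V" "S \<subseteq> V"
  shows "closure (cspan S) \<subseteq> V"
  using assms complex_vector.span_minimal[of S V] closure_minimal[of "cspan S" V]
  by (simp add: closed_csubspace_def)

lemma span_range_sum:
  fixes x :: "'i \<Rightarrow> 'a::complex_inner"
  assumes x: "orthonormal UNIV x" and z: "z \<in> cspan (range x)"
  obtains I c where "finite I" "z = (\<Sum>i\<in>I. c i *\<^sub>C x i)"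
proof -
  obtain t r where t: "finite t" "t \<subseteq> range x" "z = (\<Sum>a\<in>t. r a *\<^sub>C a)"
    using z unfolding complex_vector.span_explicit by blast
  obtain I where I: "finite I" "t = x ` I" using finite_subset_image[OF t(1,2)] by blast
  have "inj_on x I" using orthonormal_inj[OF x] by (rule inj_on_subset) simp
  then have "z = (\<Sum>i\<in>I. r (x i) *\<^sub>C x i)" unfolding t(3) I(2) by (simp add: sum.reindex)
  then show ?thesis by (rule that[OF I(1)])
qed

lemma Re_cinner_orthogonal_sum:
  assumes "finite I" "\<And>i j. i \<in> I \<Longrightarrow> j \<in> I \<Longrightarrow> i \<noteq> j \<Longrightarrow> cinner (u i) (v j) = 0"
  shows "Re (cinner (\<Sum>i\<in>I. c i *\<^sub>C u i) (\<Sum>i\<in>I. c i *\<^sub>C v i)) = (\<Sum>i\<in>I. (cmod (c i))\<^sup>2 * Re (cinner (u i) (v i)))"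
proof -
  have "cinner (\<Sum>i\<in>I. c i *\<^sub>C u i) (\<Sum>i\<in>I. c i *\<^sub>C v i)
    = (\<Sum>i\<in>I. \<Sum>j\<in>I. if i = j then c i * cnj (c i) * cinner (u i) (v i) else 0)"
    unfolding cinner_sum_left cinner_sum_right
    by (intro sum.cong refl) (auto simp: cinner_scaleC_left cinner_scaleC_right assms(2))
  also have "\<dots> = (\<Sum>i\<in>I. of_real ((cmod (c i))\<^sup>2) * cinner (u i) (v i))"
    using assms(1) by (simp add: complex_norm_square del: of_real_power)
  finally show ?thesis by (simp add: Re_sum)
qed

text \<open>If \<open>P\<close> had infinitely many eigenvectors \<open>x\<^sub>n\<close> with eigenvalues at least \<open>\<alpha>\<close> and \<open>y\<^sub>n\<close> with eigenvalues
at most \<open>\<gamma> < \<alpha>\<close>, suitable unit vectors \<open>z\<^sub>n\<close> in the span of \<open>x\<^sub>n\<close> and \<open>y\<^sub>n\<close> would have mutually orthogonal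
images with strictly increasing norms, and the norm of \<open>P\<close> would not be attained on their closed span.\<close>

lemma separated_eigenvalues_contradiction:
  fixes P :: "'a::chilbert_space \<Rightarrow> 'a" and x y :: "nat \<Rightarrow> 'a"
  assumes P: "positive_op UNIV P"
    and att: "\<And>M. closed_csubspace M \<Longrightarrow> M \<noteq> {0} \<Longrightarrow> attains_norm M P"
    and x: "orthonormal UNIV x" "\<And>n. P (x n) = \<beta> n *\<^sub>R x n" "\<And>n. \<alpha> \<le> \<beta> n"
    and y: "orthonormal UNIV y" "\<And>n. P (y n) = \<kappa> n *\<^sub>R y n" "\<And>n. 0 \<le> \<kappa> n" "\<And>n. \<kappa> n \<le> \<gamma>"
    and xy: "\<And>m n. cinner (x m) (y n) = 0" and gap: "\<gamma> < \<alpha>"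
  shows False
proof -
  have subU: "csubspace (UNIV :: 'a set)" by (rule complex_vector.subspace_UNIV)
  have sP: "sym_op UNIV P" by (rule positive_op_sym[OF subU P])
  have linP: "bounded_op UNIV UNIV P" by (rule sym_opD(1)[OF sP])
  have yx: "cinner (y m) (x n) = 0" for m n using xy cinner_zero_commute by blast
  have "0 \<le> \<gamma>" using y(3,4) order_trans by blast
  then have g2: "\<gamma>\<^sup>2 < \<alpha>\<^sup>2" "0 \<le> \<alpha>" using gap by (auto intro: power_strict_mono)
  \<comment> \<open>Prescribed squared norms of the images: they start at \<gamma>^2 and increase to
    \<alpha>^2 without reaching it.\<close>
  define \<delta> where "\<delta> n = \<alpha>\<^sup>2 - (\<alpha>\<^sup>2 - \<gamma>\<^sup>2) * inverse (real (Suc n))" for n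
  have \<delta>: "\<gamma>\<^sup>2 \<le> \<delta> n" "\<delta> n < \<alpha>\<^sup>2" for n
  proof -
    have "inverse (real (Suc n)) \<le> 1" "inverse (real (Suc n)) > 0" by (simp_all add: field_simps)
    then have "(\<alpha>\<^sup>2 - \<gamma>\<^sup>2) * inverse (real (Suc n)) \<le> (\<alpha>\<^sup>2 - \<gamma>\<^sup>2) * 1" "(\<alpha>\<^sup>2 - \<gamma>\<^sup>2) * inverse (real (Suc n)) > 0"
      using g2(1) mult_left_mono[of "inverse (real (Suc n))" 1 "\<alpha>\<^sup>2 - \<gamma>\<^sup>2"] by auto
    then show "\<gamma>\<^sup>2 \<le> \<delta> n" "\<delta> n < \<alpha>\<^sup>2" by (auto simp: \<delta>_def)
  qed
  have "\<delta> \<longlonglongrightarrow> \<alpha>\<^sup>2 - (\<alpha>\<^sup>2 - \<gamma>\<^sup>2) * 0"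
    unfolding \<delta>_def by (intro tendsto_intros LIMSEQ_inverse_real_of_nat)
  then have lim_\<delta>: "\<delta> \<longlonglongrightarrow> \<alpha>\<^sup>2" by simp
  have \<kappa>2: "(\<kappa> n)\<^sup>2 \<le> \<gamma>\<^sup>2" for n using y(3,4) by (intro power_mono)
  have \<beta>2: "\<alpha>\<^sup>2 \<le> (\<beta> n)\<^sup>2" for n using x(3) g2(2) by (intro power_mono)
  \<comment> \<open>The convex weight that mixes the squared eigenvalues into \<delta>; it lies in
    [0, 1] because \<kappa>^2 \<le> \<gamma>^2 \<le> \<delta> < \<alpha>^2 \<le> \<beta>^2.\<close>
  define p where "p n = (\<delta> n - (\<kappa> n)\<^sup>2) / ((\<beta> n)\<^sup>2 - (\<kappa> n)\<^sup>2)" for n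
  have den: "(\<beta> n)\<^sup>2 - (\<kappa> n)\<^sup>2 > 0" for n using \<kappa>2[of n] \<beta>2[of n] g2(1) by linarith
  have p: "0 \<le> p n" "p n \<le> 1" for n
    using den[of n] \<delta>[of n] \<kappa>2[of n] \<beta>2[of n] unfolding p_def by (auto simp: divide_le_eq)
  have "p n * ((\<beta> n)\<^sup>2 - (\<kappa> n)\<^sup>2) = \<delta> n - (\<kappa> n)\<^sup>2" for n using den[of n] unfolding p_def by simp
  then have p_eq: "p n * (\<beta> n)\<^sup>2 + (1 - p n) * (\<kappa> n)\<^sup>2 = \<delta> n" for n by (simp add: algebra_simps)
  define z where "z n = sqrt (p n) *\<^sub>R x n + sqrt (1 - p n) *\<^sub>R y n" for n
  have Pz: "P (z n) = (sqrt (p n) * \<beta> n) *\<^sub>R x n + (sqrt (1 - p n) * \<kappa> n) *\<^sub>R y n" for n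
    by (simp add: z_def bounded_opD(2)[OF linP] bounded_op_scaleR[OF linP] x(2) y(2))
  have xx: "cinner (x m) (x n) = (if m = n then 1 else 0)" and yy: "cinner (y m) (y n) = (if m = n then 1 else 0)" for m n
    using orthonormalD[OF x(1)] orthonormalD[OF y(1)] by auto
  have z: "orthonormal UNIV z"
    using p by (auto simp: orthonormal_def z_def cinner_simps xx yy xy yx simp flip: of_real_mult of_real_add)
  have zz: "cinner (P (z m)) (P (z n)) = (if m = n then complex_of_real (\<delta> n) else 0)" for m n
  proof -
    have "sqrt (p n) * \<beta> n * (sqrt (p n) * \<beta> n) + sqrt (1 - p n) * \<kappa> n * (sqrt (1 - p n) * \<kappa> n)
      = (sqrt (p n))\<^sup>2 * (\<beta> n)\<^sup>2 + (sqrt (1 - p n))\<^sup>2 * (\<kappa> n)\<^sup>2"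
      by (simp only: power2_eq_square mult_ac)
    then have "sqrt (p n) * \<beta> n * (sqrt (p n) * \<beta> n) + sqrt (1 - p n) * \<kappa> n * (sqrt (1 - p n) * \<kappa> n) = \<delta> n"
      using p[of n] p_eq[of n] by simp
    then show ?thesis
      unfolding Pz by (simp add: cinner_simps xx yy xy yx flip: of_real_mult of_real_add)
  qed
  define N where "N = closure (cspan (range z))"
  have cN: "closed_csubspace N" unfolding N_def by (rule closed_csubspace_closure_span)
  note subN = closed_csubspaceD(1)[OF cN]
  have zN: "z n \<in> N" for n
    unfolding N_def using closure_subset complex_vector.span_base[of "z n" "range z"] by blast
  have znorm: "norm (z n) = 1" for n by (rule orthonormal_norm[OF z]) simp
  have "N \<noteq> {0}" using zN[of 0] znorm[of 0] by auto
  then obtain v where v: "v \<in> N" "norm v = 1" "\<And>w. w \<in> N \<Longrightarrow> norm (P w) \<le> norm (P v) * norm w"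
    using att[OF cN] unfolding attains_norm_def by blast
  have contP: "continuous_on UNIV P" by (rule bounded_op_continuous_on[OF subU linP])
  have upper: "(norm (P w))\<^sup>2 \<le> \<alpha>\<^sup>2 * (norm w)\<^sup>2" if "w \<in> N" for w
  proof -
    have "closed {w. (norm (P w))\<^sup>2 \<le> \<alpha>\<^sup>2 * (norm w)\<^sup>2}"
      by (intro closed_Collect_le continuous_intros contP)
    moreover have "cspan (range z) \<subseteq> {w. (norm (P w))\<^sup>2 \<le> \<alpha>\<^sup>2 * (norm w)\<^sup>2}"
    proof (intro subsetI CollectI)
      fix w assume "w \<in> cspan (range z)"
      then obtain I c where I: "finite I" "w = (\<Sum>i\<in>I. c i *\<^sub>C z i)" by (rule span_range_sum[OF z])
      have Pw: "P w = (\<Sum>i\<in>I. c i *\<^sub>C P (z i))"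
        unfolding I(2) using I(1) by (subst bounded_op_sum[OF subU linP]) (auto simp: bounded_opD(3)[OF linP])
      have "(norm (P w))\<^sup>2 = (\<Sum>i\<in>I. (cmod (c i))\<^sup>2 * \<delta> i)"
        unfolding Re_cinner_self[symmetric] Pw
        by (subst Re_cinner_orthogonal_sum[OF I(1)]) (auto simp: zz)
      also have "\<dots> \<le> (\<Sum>i\<in>I. (cmod (c i))\<^sup>2 * \<alpha>\<^sup>2)" using \<delta>(2) by (intro sum_mono mult_left_mono) (auto intro: less_imp_le)
      also have "\<dots> = \<alpha>\<^sup>2 * (norm w)\<^sup>2"
        unfolding Re_cinner_self[symmetric] I(2)
        by (subst Re_cinner_orthogonal_sum[OF I(1)]) (auto simp: orthonormalD[OF z] sum_distrib_left mult.commute)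
      finally show "(norm (P w))\<^sup>2 \<le> \<alpha>\<^sup>2 * (norm w)\<^sup>2" .
    qed
    ultimately show ?thesis using closure_minimal[of "cspan (range z)"] that unfolding N_def by blast
  qed
  have "\<alpha>\<^sup>2 \<le> (norm (P v))\<^sup>2"
  proof (rule LIMSEQ_le_const2[OF lim_\<delta>])
    have "\<delta> n \<le> (norm (P v))\<^sup>2" for n
    proof -
      have "\<delta> n = (norm (P (z n)))\<^sup>2" using zz[of n n] Re_cinner_self[of "P (z n)"] by simp
      also have "\<dots> \<le> (norm (P v))\<^sup>2" using v(3)[OF zN, of n] znorm by (intro power_mono) auto
      finally show ?thesis .
    qed
    then show "\<exists>N. \<forall>n\<ge>N. \<delta> n \<le> (norm (P v))\<^sup>2" by blast
  qed
  then have Pv: "(norm (P v))\<^sup>2 = \<alpha>\<^sup>2" using upper[OF v(1)] v(2) by simp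
  \<comment> \<open>The compression of \<alpha>^2 - P^2 to \<open>N\<close> is positive by
    \<open>upper\<close>. A maximizer makes its form zero, so it lies in the kernel.\<close>
  define T where "T = (\<lambda>w. (\<alpha>\<^sup>2) *\<^sub>R w + (- 1) *\<^sub>R orth_proj N (P (P w)))"
  have "sym_op N (\<lambda>w. orth_proj N (P (P w)))"
    by (rule positive_op_sym[OF subN positive_op_compression_square[OF cN P]])
  then have sT: "sym_op N T" unfolding T_def by (intro sym_op_combine[OF subN sym_op_id])
  have ReT: "Re (cinner (T w) w) = \<alpha>\<^sup>2 * (norm w)\<^sup>2 - (norm (P w))\<^sup>2" if "w \<in> N" for w
    using sym_opD(2)[OF sP, of "P w" w]
    by (simp add: T_def cinner_diff_left cinner_scaleR_left cinner_orth_proj_left[OF cN that] Re_cinner_self)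
  have "positive_op N T" unfolding positive_op_iff[OF subN] using sT ReT upper by simp
  then have "T v = 0" by (rule positive_op_ker[OF subN _ v(1)]) (simp add: ReT[OF v(1)] Pv v(2))
  \<comment> \<open>Against vectors of \<open>N\<close>, P^2 z_n acts as \<delta>_n z_n. The inner
    product of P^2 v with z_n is thus both \<alpha>^2 and \<delta>_n times that of \<open>v\<close>
    with z_n, so the latter is 0 and \<open>v\<close> is orthogonal to the span it lies in.\<close>
  have "v \<in> ortho (range z)"
    unfolding ortho_def
  proof (intro CollectI ballI, elim imageE, simp)
    fix n
    have "closure (cspan (range z)) \<subseteq> ortho {P (P (z n)) - \<delta> n *\<^sub>R z n}"
    proof (intro closure_span_subset closed_csubspace_ortho image_subsetI)
      fix m
      have "cinner (z m) (P (P (z n))) = cinner (P (z m)) (P (z n))" using sym_opD(2)[OF sP] by simp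
      then show "z m \<in> ortho {P (P (z n)) - \<delta> n *\<^sub>R z n}"
        by (simp add: ortho_def cinner_diff_right cinner_scaleR_right zz orthonormalD[OF z])
    qed
    then have "v \<in> ortho {P (P (z n)) - \<delta> n *\<^sub>R z n}" using v(1) unfolding N_def by blast
    then have 1: "cinner v (P (P (z n))) = complex_of_real (\<delta> n) * cinner v (z n)"
      by (simp add: ortho_def cinner_diff_right cinner_scaleR_right)
    have "cinner (T v) (z n) = 0" using \<open>T v = 0\<close> by simp
    then have "complex_of_real (\<alpha>\<^sup>2) * cinner v (z n) = cinner (P (P v)) (z n)"
      by (simp add: T_def cinner_diff_left cinner_scaleR_left cinner_orth_proj_left[OF cN zN])
    also have "\<dots> = cinner v (P (P (z n)))" using sym_opD(2)[OF sP] by simp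
    finally have "complex_of_real (\<alpha>\<^sup>2 - \<delta> n) * cinner v (z n) = 0" using 1 by (simp add: algebra_simps)
    then show "cinner v (z n) = 0" using \<delta>(2)[of n] by (simp flip: of_real_diff of_real_power)
  qed
  then have "range z \<subseteq> ortho {v}" by (auto simp: ortho_def cinner_zero_commute[of v])
  then have "N \<subseteq> ortho {v}" unfolding N_def by (intro closure_span_subset closed_csubspace_ortho)
  then have "cinner v v = 0" using v(1) by (auto simp: ortho_def)
  then show False using v(2) by simp
qed

text \<open>A finite net of \<open>S\<close> of radius e/4 is a net of \<open>X\<close> of radius
  e/2. Closed balls are used so that the covering survives passing to the closure.\<close>

lemma compact_closure_if_approx_compact:
  fixes X :: "'a::complete_space set"
  assumes "\<And>e. e > 0 \<Longrightarrow> \<exists>S. compact S \<and> (\<forall>y\<in>X. \<exists>s\<in>S. dist y s \<le> e)"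
  shows "compact (closure X)"
  unfolding compact_eq_totally_bounded
proof (intro conjI allI impI)
  show "complete (closure X)" by (simp add: complete_eq_closed)
  fix e :: real assume "e > 0"
  then obtain S where S: "compact S" "\<forall>y\<in>X. \<exists>s\<in>S. dist y s \<le> e / 4" using assms[of "e / 4"] by auto
  obtain k where k: "finite k" "S \<subseteq> (\<Union>x\<in>k. ball x (e / 4))"
    using S(1) \<open>e > 0\<close> unfolding compact_eq_totally_bounded by (meson divide_pos_pos zero_less_numeral)
  have "X \<subseteq> (\<Union>x\<in>k. cball x (e / 2))"
  proof
    fix y assume "y \<in> X"
    then obtain s where s: "s \<in> S" "dist y s \<le> e / 4" using S(2) by blast
    then obtain x where x: "x \<in> k" "dist x s < e / 4" using k(2) by auto
    have "dist x y \<le> dist x s + dist y s" by (metis dist_triangle dist_commute)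
    then show "y \<in> (\<Union>x\<in>k. cball x (e / 2))" using x s by (intro UN_I[of x]) auto
  qed
  moreover have "closed (\<Union>x\<in>k. cball x (e / 2))" using k(1) by (intro closed_UN) auto
  ultimately have "closure X \<subseteq> (\<Union>x\<in>k. cball x (e / 2))" by (rule closure_minimal)
  also have "\<dots> \<subseteq> (\<Union>x\<in>k. ball x e)" using \<open>e > 0\<close> by (intro UN_mono) auto
  finally show "\<exists>k. finite k \<and> closure X \<subseteq> (\<Union>x\<in>k. ball x e)" using k(1) by blast
qed

lemma sym_op_self_adjoint:
  assumes F: "sym_op UNIV F"
  shows "self_adjoint_op F"
proof -
  have "adjoint_op UNIV F y = F y" for y
    unfolding adjoint_op_def
  proof (rule the_equality)
    show "F y \<in> UNIV \<and> (\<forall>z\<in>UNIV. cinner (F z) y = cinner z (F y))" using sym_opD(2)[OF F] by simp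
    fix v assume "v \<in> UNIV \<and> (\<forall>z\<in>UNIV. cinner (F z) y = cinner z v)"
    then have "cinner (v - F y) (v - F y) = 0" using sym_opD(2)[OF F, of "v - F y" y] by (simp add: cinner_diff_right)
    then show "v = F y" by simp
  qed
  then show ?thesis using sym_opD(1)[OF F] by (auto simp: self_adjoint_op_def)
qed

text \<open>Invariance of \<open>N\<close> means that \<open>A\<close> after the projection equals
  projection, \<open>A\<close>, projection, which is a symmetric expression.\<close>

lemma sym_op_comp_orth_proj:
  fixes N :: "'a::chilbert_space set"
  assumes N: "closed_csubspace N" and A: "sym_op UNIV A" and AN: "\<And>y. y \<in> N \<Longrightarrow> A y \<in> N"
  shows "sym_op UNIV (\<lambda>y. A (orth_proj N y))"
  unfolding sym_op_def
proof (intro conjI ballI)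
  show "bounded_op UNIV UNIV (\<lambda>y. A (orth_proj N y))"
    by (rule bounded_op_comp[OF sym_opD(1)[OF A] bounded_op_mono[OF bounded_op_orth_proj[OF N]]]) auto
  fix x y :: 'a
  have "cinner (A (orth_proj N x)) y = cinner (A (orth_proj N x)) (orth_proj N y)"
    by (simp add: cinner_orth_proj_right[OF N] AN orth_proj_in[OF N])
  also have "\<dots> = cinner (orth_proj N x) (A (orth_proj N y))" using sym_opD(2)[OF A] by simp
  also have "\<dots> = cinner x (A (orth_proj N y))"
    by (simp add: cinner_orth_proj_left[OF N] AN orth_proj_in[OF N])
  finally show "cinner (A (orth_proj N x)) y = cinner x (A (orth_proj N y))" .
qed

lemma invariant_ortho:
  assumes A: "sym_op UNIV A" and "\<And>y. y \<in> S \<Longrightarrow> \<exists>c. A y = c *\<^sub>R y" and x: "x \<in> ortho S"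
  shows "A x \<in> ortho S"
  unfolding ortho_def
proof (intro CollectI ballI)
  fix y assume y: "y \<in> S"
  then obtain c where "A y = c *\<^sub>R y" using assms(2) by blast
  then show "cinner (A x) y = 0"
    using sym_opD(2)[OF A, of x y] orthoD(1)[OF x y] by (simp add: cinner_scaleR_right)
qed

text \<open>With D = P - \<alpha>, the part of \<open>D\<close> on the closed span of the maximizers
  becomes \<open>K\<close> and the part on the complement \<open>N\<close> becomes \<open>F\<close>;
  both spaces are invariant, so the parts are symmetric and add up to \<open>D\<close>.\<close>

lemma compact_perturbation_of_attains_norm:
  fixes P :: "'a::chilbert_space \<Rightarrow> 'a"
  assumes P: "positive_op UNIV P"
    and att: "\<And>M. closed_csubspace M \<Longrightarrow> M \<noteq> {0} \<Longrightarrow> attains_norm M P"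
  shows "\<exists>(\<alpha>::real) K F. 0 \<le> \<alpha> \<and> positive_op UNIV K \<and> compact_op K \<and>
    self_adjoint_op F \<and> finite_rank_op F \<and> (\<forall>x. P x = \<alpha> *\<^sub>R x + K x + F x)"
proof -
  have subU: "csubspace (UNIV :: 'a set)" by (rule complex_vector.subspace_UNIV)
  have sP: "sym_op UNIV P" by (rule positive_op_sym[OF subU P])
  note linP = sym_opD(1)[OF sP]
  show ?thesis
  proof (cases "cdim (UNIV :: 'a set) = \<infinity>")
    case False
    \<comment> \<open>In finite dimension there is no infinite sequence of maximizers; \<alpha> = 0,
      K = 0 and F = P serve instead.\<close>
    have "positive_op UNIV (\<lambda>x::'a. 0 :: 'a)"
      by (auto simp: positive_op_def bounded_op_def intro: exI[of _ 0])
    moreover have "(\<lambda>x::'a. 0::'a) ` cball 0 1 = {0}" by (auto intro!: image_eqI[of _ _ 0])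
    then have "compact_op (\<lambda>x::'a. 0 :: 'a)"
      by (auto simp: compact_op_def bounded_op_def intro: exI[of _ 0])
    moreover have "rank_op UNIV P < \<infinity>"
      using cdim_mono[OF subspace_image[OF subU linP] subU subset_UNIV] False
      unfolding rank_op_def by (cases "cdim (UNIV :: 'a set)") (auto dest: enat_ile)
    then have "finite_rank_op P" using linP by (simp add: finite_rank_op_def)
    ultimately show ?thesis using sym_op_self_adjoint[OF sP]
      by (intro exI[of _ 0] exI[of _ "\<lambda>_. 0"] exI[of _ P]) simp
  next
    case True
    obtain x :: "nat \<Rightarrow> 'a" where x: "orthonormal UNIV x" "\<And>n. P (x n) = norm (P (x n)) *\<^sub>R x n"
      and top: "\<And>n y. (\<And>i. i < n \<Longrightarrow> cinner y (x i) = 0) \<Longrightarrow> norm (P y) \<le> norm (P (x n)) * norm y"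
      by (rule peeling[OF P att closed_csubspace_UNIV _ True]) (use that in auto)
    define \<beta> where "\<beta> n = norm (P (x n))" for n
    have Px: "P (x n) = \<beta> n *\<^sub>R x n" for n using x(2) by (simp add: \<beta>_def)
    have xnorm: "norm (x n) = 1" for n by (rule orthonormal_norm[OF x(1)]) simp
    have "decseq \<beta>"
    proof (rule decseq_SucI)
      fix n
      have "norm (P (x (Suc n))) \<le> norm (P (x n)) * norm (x (Suc n))"
        by (rule top) (simp add: orthonormalD[OF x(1)])
      then show "\<beta> (Suc n) \<le> \<beta> n" by (simp add: \<beta>_def xnorm)
    qed
    moreover have "\<forall>n. 0 \<le> \<beta> n" by (simp add: \<beta>_def)
    ultimately obtain \<alpha> where \<alpha>: "\<beta> \<longlonglongrightarrow> \<alpha>" "\<forall>n. \<alpha> \<le> \<beta> n" by (rule decseq_convergent)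
    have "0 \<le> \<alpha>" using \<alpha>(1) by (rule LIMSEQ_le_const) (simp add: \<beta>_def)
    define N where "N = ortho (range x)"
    have cN: "closed_csubspace N" unfolding N_def by (rule closed_csubspace_ortho)
    note subN = closed_csubspaceD(1)[OF cN]
    define D where "D = (\<lambda>y. 1 *\<^sub>R P y + (- \<alpha>) *\<^sub>R y)"
    have D_eq: "D y = P y - \<alpha> *\<^sub>R y" for y by (simp add: D_def)
    have sD: "sym_op UNIV D" unfolding D_def by (rule sym_op_combine[OF subU sP sym_op_id])
    note linD = sym_opD(1)[OF sD]
    have Dx: "D (x n) = (\<beta> n - \<alpha>) *\<^sub>R x n" for n by (simp add: D_eq Px scaleR_diff_left)
    have PN: "P y \<in> N" if "y \<in> N" for y
      using invariant_ortho[OF sP _ that[unfolded N_def]] Px unfolding N_def by blast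
    have DN: "D y \<in> N" if "y \<in> N" for y
      unfolding D_eq by (intro csubspace_ops[OF subN] PN that)
    have boundN: "norm (P y) \<le> \<alpha> * norm y" if y: "y \<in> N" for y
    proof (rule LIMSEQ_le_const[OF tendsto_mult_right[OF \<alpha>(1)]])
      show "\<exists>M. \<forall>n\<ge>M. norm (P y) \<le> \<beta> n * norm y"
        using top[of _ y] orthoD(1)[OF y[unfolded N_def]] by (auto simp: \<beta>_def)
    qed
    define F where "F y = D (orth_proj N y)" for y
    have sF: "sym_op UNIV F" unfolding F_def by (rule sym_op_comp_orth_proj[OF cN sD DN])
    \<comment> \<open>\<open>L\<close> is the closed span of the maximizers. Given as an orthogonal
      complement it inherits invariance under \<open>D\<close> from \<open>N\<close>;
      \<open>L_closure\<close> supplies the density of finite combinations.\<close>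
    define L where "L = ortho N"
    have cL: "closed_csubspace L" unfolding L_def by (rule closed_csubspace_ortho)
    note subL = closed_csubspaceD(1)[OF cL]
    have resid: "y - orth_proj N y \<in> L" for y unfolding L_def by (rule orth_proj_resid[OF cN])
    have DL: "D y \<in> L" if y: "y \<in> L" for y
    proof -
      have "cinner (D y) w = 0" if "w \<in> N" for w
        using sym_opD(2)[OF sD, of y w] orthoD(1)[OF y[unfolded L_def] DN[OF that]] by simp
      then show ?thesis by (simp add: L_def ortho_def)
    qed
    have xL: "x n \<in> L" for n by (auto simp: L_def N_def ortho_def cinner_zero_commute[of "x n"])
    have L_closure: "L \<subseteq> closure (cspan (range x))"
    proof
      fix w assume w: "w \<in> L"
      show "w \<in> closure (cspan (range x))"
      proof (rule ortho_ortho_closed[OF closed_csubspace_closure_span])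
        fix y assume y: "y \<in> ortho (closure (cspan (range x)))"
        have "x n \<in> closure (cspan (range x))" for n
          using closure_subset complex_vector.span_base[of "x n" "range x"] by blast
        then have "y \<in> N" unfolding N_def ortho_def using orthoD(1)[OF y] by blast
        then show "cinner w y = 0" using w unfolding L_def by (rule orthoD(1)[rotated])
      qed
    qed
    have D_pos: "0 \<le> Re (cinner (D w) w)" if w: "w \<in> L" for w
    proof -
      have "closed {w. 0 \<le> Re (cinner (D w) w)}"
        by (intro closed_Collect_le continuous_intros bounded_op_continuous_on[OF subU linD])
      moreover have "cspan (range x) \<subseteq> {w. 0 \<le> Re (cinner (D w) w)}"
      proof (intro subsetI CollectI)
        fix w assume "w \<in> cspan (range x)"
        then obtain I c where I: "finite I" "w = (\<Sum>i\<in>I. c i *\<^sub>C x i)" by (rule span_range_sum[OF x(1)])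
        have "D w = (\<Sum>i\<in>I. c i *\<^sub>C D (x i))"
          unfolding I(2) using I(1) by (subst bounded_op_sum[OF subU linD]) (auto simp: bounded_opD(3)[OF linD])
        then have "Re (cinner (D w) w) = (\<Sum>i\<in>I. (cmod (c i))\<^sup>2 * (\<beta> i - \<alpha>))"
          unfolding I(2)
          by (simp add: Re_cinner_orthogonal_sum[OF I(1)] Dx cinner_scaleR_left orthonormalD[OF x(1)])
        then show "0 \<le> Re (cinner (D w) w)" using \<alpha>(2) by (simp add: sum_nonneg)
      qed
      ultimately show ?thesis using closure_minimal[of "cspan (range x)"] L_closure w by blast
    qed
    define K where "K y = D (y - orth_proj N y)" for y
    have K_eq: "K y = 1 *\<^sub>R D y + (- 1) *\<^sub>R F y" for y
      by (simp add: K_def F_def bounded_op_diff[OF subU linD])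
    then have sK: "sym_op UNIV K" using sym_op_combine[OF subU sD sF, of 1 "- 1"] by (simp add: K_eq[abs_def])
    have K_pos: "positive_op UNIV K"
      unfolding positive_op_iff[OF subU]
    proof (intro conjI ballI sK)
      fix y :: 'a
      have "cinner (K y) (orth_proj N y) = 0"
        using orthoD(1)[OF DL[OF resid, unfolded L_def] orth_proj_in[OF cN]] by (simp add: K_def)
      then have "cinner (K y) y = cinner (D (y - orth_proj N y)) (y - orth_proj N y)"
        by (simp add: K_def cinner_diff_right)
      then show "0 \<le> Re (cinner (K y) y)" using D_pos[OF resid] by simp
    qed
    \<comment> \<open>On the invariant subspace \<open>V\<close> the operator \<open>D\<close> is
      positive, so its norm follows from its form, and maximality of \<open>x n\<close> bounds the
      form of \<open>P\<close> there by \<beta>_n.\<close>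
    have tail: "norm (D t) \<le> (\<beta> n - \<alpha>) * norm t" if t: "t \<in> L" "t \<in> ortho (x ` {..<n})" for n t
    proof -
      define V where "V = L \<inter> ortho (x ` {..<n})"
      have "closed_csubspace V" unfolding V_def by (intro closed_csubspace_Int cL closed_csubspace_ortho)
      note subV = closed_csubspaceD(1)[OF this]
      have "D v \<in> ortho (x ` {..<n})" if "v \<in> ortho (x ` {..<n})" for v
        using invariant_ortho[OF sD _ that] Dx by blast
      then have DV: "D v \<in> V" if "v \<in> V" for v using DL that unfolding V_def by blast
      obtain C where C: "\<And>v. v \<in> UNIV \<Longrightarrow> norm (D v) \<le> C * norm v" by (rule bounded_op_bound[OF linD]) (rule that)
      have "bounded_op V V D"
        using DV C by (intro bounded_opI[where C = C]) (auto simp: bounded_opD(2,3)[OF linD])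
      then have "sym_op V D" using sym_opD(2)[OF sD] by (simp add: sym_op_def)
      then have pV: "positive_op V D" unfolding positive_op_iff[OF subV] using D_pos by (simp add: V_def)
      show ?thesis
      proof (rule positive_op_norm_le[OF subV pV])
        fix v assume "v \<in> V"
        then have "norm (P v) \<le> \<beta> n * norm v"
          unfolding \<beta>_def by (intro top) (auto simp: V_def ortho_def)
        then have "Re (cinner (P v) v) \<le> \<beta> n * (norm v)\<^sup>2" by (intro positive_op_Re_le[OF subU P UNIV_I])
        then show "Re (cinner (D v) v) \<le> (\<beta> n - \<alpha>) * (norm v)\<^sup>2"
          by (simp add: D_eq cinner_diff_left cinner_scaleR_left Re_cinner_self algebra_simps)
      qed (use t \<alpha>(2) in \<open>auto simp: V_def\<close>)
    qed
    have "compact (closure (K ` cball 0 1))"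
    proof (rule compact_closure_if_approx_compact)
      fix e :: real assume "e > 0"
      then obtain n where n: "\<beta> n < \<alpha> + e"
        using order_tendstoD(2)[OF \<alpha>(1), of "\<alpha> + e"] eventually_sequentially by auto
      \<comment> \<open>This set contains all head terms \<open>D s\<close>: the coefficients of a
        vector of norm at most 1 are at most 2 by \<open>cmod_cinner_unit_le\<close>, and |\<beta>_i
        - \<alpha>| \<le> \<beta>_0. The tail costs at most \<beta>_n - \<alpha> < e.\<close>
      let ?S = "{\<Sum>i<n. c i *\<^sub>C x i | c. \<forall>i<n. cmod (c i) \<le> 2 * \<beta> 0}"
      have "\<exists>s\<in>?S. dist (K y) s \<le> e" if y: "norm y \<le> 1" for y
      proof -
        define w where "w = y - orth_proj N y"
        have w: "w \<in> L" unfolding w_def by (rule resid)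
        have "(norm w)\<^sup>2 \<le> (norm y)\<^sup>2" using norm_orth_proj_sq[OF cN, of y] by (simp add: w_def)
        then have "norm w \<le> norm y" by (rule power2_le_imp_le) simp
        then have w1: "norm w \<le> 1" using y by linarith
        define s where "s = (\<Sum>i<n. cinner w (x i) *\<^sub>C x i)"
        define t where "t = w - s"
        have sL: "s \<in> L" unfolding s_def by (intro complex_vector.subspace_sum[OF subL] csubspace_ops(3)[OF subL] xL)
        have tL: "t \<in> L" unfolding t_def by (intro csubspace_ops(2)[OF subL] w sL)
        have t_orth: "cinner t (x i) = 0" if "i < n" for i
          using cinner_orthonormal_sum[OF orthonormal_subset[OF x(1) subset_UNIV], of "{..<n}" i "\<lambda>i. cinner w (x i)"] that
          by (simp add: t_def s_def cinner_diff_left)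
        have "cinner t s = 0"
          unfolding s_def cinner_sum_right by (intro sum.neutral) (simp add: cinner_scaleC_right t_orth)
        then have "(norm w)\<^sup>2 = (norm t)\<^sup>2 + (norm s)\<^sup>2" using pythagoras[of t s] by (simp add: t_def)
        then have "(norm t)\<^sup>2 \<le> (norm w)\<^sup>2" by simp
        then have "norm t \<le> norm w" by (rule power2_le_imp_le) simp
        then have "norm (D t) \<le> (\<beta> n - \<alpha>) * 1"
          using tail[OF tL, of n] t_orth w1 \<alpha>(2) mult_left_mono[of "norm t" 1 "\<beta> n - \<alpha>"] by (fastforce simp: ortho_def)
        moreover have "K y = D s + D t"
          unfolding K_def w_def[symmetric] using bounded_opD(2)[OF linD, of s t] by (simp add: t_def)
        ultimately have close: "dist (K y) (D s) \<le> e" using n by (simp add: dist_norm)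
        have Ds: "D s = (\<Sum>i<n. (complex_of_real (\<beta> i - \<alpha>) * cinner w (x i)) *\<^sub>C x i)"
          unfolding s_def
          by (subst bounded_op_sum[OF subU linD])
             (auto simp: bounded_opD(3)[OF linD] Dx mult.commute simp flip: scaleC_of_real scaleC_scaleC intro!: sum.cong)
        have coeff: "cmod (complex_of_real (\<beta> i - \<alpha>) * cinner w (x i)) \<le> 2 * \<beta> 0" for i
        proof -
          have "\<bar>\<beta> i - \<alpha>\<bar> \<le> \<beta> 0" using \<alpha>(2)[rule_format, of i] \<open>0 \<le> \<alpha>\<close> decseqD[OF \<open>decseq \<beta>\<close>, of 0 i] by (auto simp: abs_if)
          moreover have "cmod (cinner w (x i)) \<le> 2" using cmod_cinner_unit_le[OF xnorm, of w i] w1 by simp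
          ultimately have "\<bar>\<beta> i - \<alpha>\<bar> * cmod (cinner w (x i)) \<le> \<beta> 0 * 2"
            by (intro mult_mono) (auto simp: \<beta>_def)
          then show ?thesis by (simp add: norm_mult flip: of_real_diff)
        qed
        have "D s \<in> ?S"
          unfolding Ds using coeff
          by (intro CollectI exI[of _ "\<lambda>i. complex_of_real (\<beta> i - \<alpha>) * cinner w (x i)"]) blast
        with close show ?thesis by (rule bexI)
      qed
      then show "\<exists>S. compact S \<and> (\<forall>y\<in>K ` cball 0 1. \<exists>s\<in>S. dist y s \<le> e)"
        by (intro exI[of _ ?S] conjI compact_bounded_combinations) auto
    qed
    then have cK: "compact_op K" using sym_opD(1)[OF sK] by (simp add: compact_op_def)
    \<comment> \<open>\<open>Z\<close> may be infinite-dimensional, but \<open>D\<close> vanishes on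
      it, so \<open>F\<close> has its range in the complement \<open>W\<close> inside
      \<open>N\<close>; finite dimension of \<open>W\<close> is enough.\<close>
    define Z where "Z = eigenspace_op N P (complex_of_real \<alpha>)"
    have Z_iff: "y \<in> Z \<longleftrightarrow> y \<in> N \<and> P y = \<alpha> *\<^sub>R y" for y by (simp add: Z_def eigenspace_op_def scaleC_of_real)
    define W where "W = N \<inter> ortho Z"
    have cW: "closed_csubspace W" unfolding W_def by (intro closed_csubspace_Int cN closed_csubspace_ortho)
    have orthZ: "P y \<in> ortho Z" "D y \<in> ortho Z" if "y \<in> ortho Z" for y
      using invariant_ortho[OF sP _ that] invariant_ortho[OF sD _ that] by (auto simp: Z_iff D_eq intro: exI[of _ 0])
    have PW: "P y \<in> W" if "y \<in> W" for y using that PN orthZ unfolding W_def by blast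
    have "F y \<in> ortho Z" for y
    proof -
      have "cinner (F y) z = 0" if "z \<in> Z" for z
        using sym_opD(2)[OF sD, of "orth_proj N y" z] that by (simp add: F_def Z_iff D_eq)
      then show ?thesis by (simp add: ortho_def)
    qed
    then have FW: "range F \<subseteq> W" unfolding W_def F_def using DN orth_proj_in[OF cN] by blast
    have "cdim W \<noteq> \<infinity>"
    proof
      assume inf: "cdim W = \<infinity>"
      obtain y :: "nat \<Rightarrow> 'a" where y: "orthonormal UNIV y" "\<And>n. y n \<in> W" "\<And>n. P (y n) = norm (P (y n)) *\<^sub>R y n"
        and topW: "\<And>n v. v \<in> W \<Longrightarrow> (\<And>i. i < n \<Longrightarrow> cinner v (y i) = 0) \<Longrightarrow> norm (P v) \<le> norm (P (y n)) * norm v"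
        by (rule peeling[OF P att cW PW inf]) (use that in auto)
      have ynorm: "norm (y n) = 1" for n by (rule orthonormal_norm[OF y(1)]) simp
      have yN: "y n \<in> N" for n using y(2) by (simp add: W_def)
      \<comment> \<open>An eigenvector for \<alpha> in \<open>N\<close> would lie in
        \<open>Z\<close>, to which \<open>W\<close> is orthogonal. So the largest eigenvalue on
        \<open>W\<close> is strictly below \<alpha> and serves as the separating constant
        \<gamma>.\<close>
      have "norm (P (y 0)) \<noteq> \<alpha>"
      proof
        assume "norm (P (y 0)) = \<alpha>"
        then have "y 0 \<in> Z" using y(3)[of 0] yN by (simp add: Z_iff)
        then have "cinner (y 0) (y 0) = 0" using y(2)[of 0] unfolding W_def by (blast intro: orthoD(1))
        then show False using ynorm[of 0] by simp
      qed
      then have gap: "norm (P (y 0)) < \<alpha>" using boundN[OF yN, of 0] ynorm by simp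
      show False
      proof (rule separated_eigenvalues_contradiction[OF P att x(1) Px _ y(1,3) _ _ _ gap])
        show "\<alpha> \<le> \<beta> n" for n using \<alpha>(2) by blast
        show "norm (P (y n)) \<le> norm (P (y 0))" for n using topW[OF y(2), of 0 n] ynorm by simp
        show "cinner (x m) (y n) = 0" for m n using orthoD(2)[OF yN[unfolded N_def], of "x m" n] by simp
      qed auto
    qed
    then have "rank_op UNIV F < \<infinity>"
      using cdim_mono[OF subspace_image[OF subU sym_opD(1)[OF sF]] closed_csubspaceD(1)[OF cW] FW]
      unfolding rank_op_def by (cases "cdim W") (auto dest: enat_ile)
    then have "finite_rank_op F" using sym_opD(1)[OF sF] by (simp add: finite_rank_op_def)
    moreover have "P y = \<alpha> *\<^sub>R y + K y + F y" for y by (simp add: K_eq D_eq)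
    ultimately show ?thesis using \<open>0 \<le> \<alpha>\<close> K_pos cK sym_op_self_adjoint[OF sF] by blast
  qed
qed

theorem theorem4p21:
  fixes P :: "'a::chilbert_space \<Rightarrow> 'a"
  assumes "positive_op UNIV P"
  shows "((\<forall>k\<ge>1. abs_k_norming k P) \<longleftrightarrow> (\<exists>k\<ge>1. abs_k_norming k P)) \<and>
         ((\<exists>k\<ge>1. abs_k_norming k P) \<longleftrightarrow>
          (\<exists>(\<alpha>::real) K F. 0 \<le> \<alpha> \<and>
             positive_op UNIV K \<and> compact_op K \<and>
             self_adjoint_op F \<and> finite_rank_op F \<and>
             (\<forall>x. P x = \<alpha> *\<^sub>R x + K x + F x)))"
proof -
  let ?att = "\<forall>M. closed_csubspace M \<and> M \<noteq> {0} \<longrightarrow> attains_norm M P"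
  have "?att" if "\<exists>k\<ge>1. abs_k_norming k P"
    using that abs_k_norming_imp_attains_norm[OF assms] by blast
  moreover have "\<forall>k\<ge>1. abs_k_norming k P" if ?att
    using that attains_norm_imp_abs_k_norming[OF assms] by blast
  moreover have "\<exists>(\<alpha>::real) K F. 0 \<le> \<alpha> \<and> positive_op UNIV K \<and> compact_op K \<and>
      self_adjoint_op F \<and> finite_rank_op F \<and> (\<forall>x. P x = \<alpha> *\<^sub>R x + K x + F x)" if ?att
    by (rule compact_perturbation_of_attains_norm[OF assms]) (use that in blast)
  moreover have "?att" if "\<exists>(\<alpha>::real) K F. 0 \<le> \<alpha> \<and> positive_op UNIV K \<and> compact_op K \<and>
      self_adjoint_op F \<and> finite_rank_op F \<and> (\<forall>x. P x = \<alpha> *\<^sub>R x + K x + F x)"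
    using that attains_norm_compact_perturbation[OF assms] by blast
  moreover have "(\<exists>k\<ge>1. abs_k_norming k P)" if "\<forall>k\<ge>1. abs_k_norming k P" using that by blast
  ultimately show ?thesis by argo
qed

end
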